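(* Let $\Gamma$ be a finite-rank subgroup of $\overline{\mathbb{Q}}^\times$ with $\Gamma = \Gamma^{\mathrm{div}}$. Then for any $\varepsilon > 0$ there exists a constant $C_\Gamma(\varepsilon) > 0$, depending only on $\Gamma$ and $\varepsilon$, such that for every $\alpha \in \overline{\mathbb{Q}}^\times \setminus \Gamma$ we have $$h_\Gamma(\alpha) \geq \frac{C_\Gamma(\varepsilon)}{[\mathbb{Q}(\alpha):\mathbb{Q}]^{\operatorname{rank}(\Gamma) + 1 + \varepsilon}}.$$
   Context: $\overline{\mathbb{Q}}$ is a fixed algebraic closure of $\mathbb{Q}$, and $h:\overline{\mathbb{Q}}^\times \to [0,\infty)$ is the absolute logarithmic Weil height. For a subgroup $\Gamma$ of $\overline{\mathbb{Q}}^\times$: $\Gamma^{\mathrm{div}} = \{\beta \in \overline{\mathbb{Q}}^\times : \beta^n \in \Gamma \text{ for some integer } n \geq 1\}$; $\operatorname{rank}(\Gamma) = \dim_{\mathbb{Q}}(\Gamma \otimes_{\mathbb{Z}} \mathbb{Q})$; and $h_\Gamma(\alpha) = \inf_{\gamma \in \Gamma} h(\alpha/\gamma)$ for $\alpha \in \overline{\mathbb{Q}}^\times$. *)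

theory Defs
  imports "HOL-Analysis.Analysis" "HOL-Library.Poly_Mapping"
begin

text \<open>The field of algebraic numbers inside the complex numbers serves as the fixed algebraic
  closure of the rationals.\<close>

definition Qbar_units :: "complex set" where
  "Qbar_units = {x. algebraic x \<and> x \<noteq> 0}"

definition is_subgroup :: "complex set \<Rightarrow> bool" where
  "is_subgroup G \<longleftrightarrow> G \<subseteq> Qbar_units \<and> 1 \<in> G \<and>
     (\<forall>x\<in>G. \<forall>y\<in>G. x * y \<in> G) \<and> (\<forall>x\<in>G. inverse x \<in> G)"

definition div_closure :: "complex set \<Rightarrow> complex set" where
  "div_closure G = {\<beta> \<in> Qbar_units. \<exists>n\<ge>1::nat. \<beta> ^ n \<in> G}"


subsection \<open>Simple extensions of the rationals and their embeddings\<close>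

definition is_subfield :: "complex set \<Rightarrow> bool" where
  "is_subfield K \<longleftrightarrow> 0 \<in> K \<and> 1 \<in> K \<and>
     (\<forall>x\<in>K. \<forall>y\<in>K. x + y \<in> K \<and> x * y \<in> K) \<and> (\<forall>x\<in>K. - x \<in> K \<and> inverse x \<in> K)"

definition adjoin :: "complex \<Rightarrow> complex set" where
  "adjoin \<alpha> = \<Inter>{K. is_subfield K \<and> \<alpha> \<in> K}"

global_interpretation rat_complex: vector_space "\<lambda>(q::rat) (x::complex). of_rat q * x"
  by standard (simp_all add: of_rat_add of_rat_mult algebra_simps)

definition field_degree :: "complex set \<Rightarrow> nat" where
  "field_degree K = rat_complex.dim K"

definition embeddings :: "complex set \<Rightarrow> (complex \<Rightarrow> complex) set" where
  "embeddings K = {\<sigma> \<in> extensional K. \<sigma> 1 = 1 \<and>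
     (\<forall>x\<in>K. \<forall>y\<in>K. \<sigma> (x + y) = \<sigma> x + \<sigma> y \<and> \<sigma> (x * y) = \<sigma> x * \<sigma> y)}"


subsection \<open>The absolute logarithmic Weil height\<close>

definition padic_abs :: "nat \<Rightarrow> rat \<Rightarrow> real" where
  "padic_abs p q = (if q = 0 then 0 else
     (case quotient_of q of (a, b) \<Rightarrow>
        real p powi (int (multiplicity (int p) b) - int (multiplicity (int p) a))))"

definition extends_padic :: "nat \<Rightarrow> (complex \<Rightarrow> real) \<Rightarrow> bool" where
  "extends_padic p v \<longleftrightarrow>
     (\<forall>x. algebraic x \<longrightarrow> 0 \<le> v x \<and> (v x = 0 \<longleftrightarrow> x = 0)) \<and>
     (\<forall>x y. algebraic x \<and> algebraic y \<longrightarrow> v (x * y) = v x * v y \<and> v (x + y) \<le> v x + v y) \<and>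
     (\<forall>q. v (of_rat q) = padic_abs p q)"

text \<open>One extension of the \<open>p\<close>-adic absolute value to the algebraic numbers, i.e. one embedding of
  the algebraic numbers into the completed algebraic closure of the \<open>p\<close>-adic numbers.
  Such extensions exist, and any two differ by an automorphism of the field of algebraic numbers,
  so the choice does not affect the sum over all embeddings used for the height.\<close>

definition Qbar_padic_abs :: "nat \<Rightarrow> complex \<Rightarrow> real" where
  "Qbar_padic_abs p = (SOME v. extends_padic p v)"

definition log_plus :: "real \<Rightarrow> real" where
  "log_plus t = ln (max 1 t)"

text \<open>For \<open>K = \<rat>(\<alpha>)\<close>, the sum of \<open>[K\<^sub>v : \<rat>\<^sub>v] log\<^sup>+ \<bar>\<alpha>\<bar>\<^sub>v\<close> over all places \<open>v\<close> of \<open>K\<close>, divided by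
  \<open>[K : \<rat>]\<close>. Each place \<open>v\<close> of \<open>K\<close> above a place \<open>w\<close> of the rationals is \<open>x \<mapsto> \<bar>\<sigma> x\<bar>\<^sub>w\<close> for exactly
  \<open>[K\<^sub>v : \<rat>\<^sub>w]\<close> embeddings \<open>\<sigma>\<close> of \<open>K\<close>, so the local degrees are accounted for by summing over
  embeddings. Only finitely many primes contribute.\<close>

definition weil_height :: "complex \<Rightarrow> real" where
  "weil_height \<alpha> =
     ((\<Sum>\<sigma>\<in>embeddings (adjoin \<alpha>). log_plus (norm (\<sigma> \<alpha>))) +
      (\<Sum>\<^sub>\<infinity>p\<in>{p. prime p}. \<Sum>\<sigma>\<in>embeddings (adjoin \<alpha>). log_plus (Qbar_padic_abs p (\<sigma> \<alpha>))))
     / real (field_degree (adjoin \<alpha>))"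

definition height_mod :: "complex set \<Rightarrow> complex \<Rightarrow> real" where
  "height_mod G \<alpha> = (INF \<gamma>\<in>G. weil_height (\<alpha> / \<gamma>))"


subsection \<open>The rank of a multiplicative group\<close>

lemma lookup_scale:
  "Poly_Mapping.lookup (Poly_Mapping.map ((*) q) f) x = q * Poly_Mapping.lookup f x"
  for q :: rat
  by (simp add: map.rep_eq when_def)

global_interpretation free_rat: vector_space
  "\<lambda>(q::rat) (f :: complex \<Rightarrow>\<^sub>0 rat). Poly_Mapping.map ((*) q) f"
  by standard
    (auto intro!: poly_mapping_eqI simp: lookup_scale lookup_add algebra_simps)

text \<open>The tensor product of \<open>G\<close> with the rationals is the quotient \<open>V / W\<close> of the rational vector
  space \<open>V\<close> with basis \<open>[\<gamma>]\<close>, \<open>\<gamma> \<in> G\<close>, by the subspace \<open>W\<close> spanned by all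
  \<open>[\<gamma> \<delta>] - [\<gamma>] - [\<delta>]\<close>; the class of \<open>q [\<gamma>]\<close> is \<open>\<gamma> \<otimes> q\<close>.\<close>

definition tensor_gens :: "complex set \<Rightarrow> (complex \<Rightarrow>\<^sub>0 rat) set" where
  "tensor_gens G = free_rat.span ((\<lambda>\<gamma>. Poly_Mapping.single \<gamma> 1) ` G)"

definition tensor_rels :: "complex set \<Rightarrow> (complex \<Rightarrow>\<^sub>0 rat) set" where
  "tensor_rels G = free_rat.span
     {Poly_Mapping.single (\<gamma> * \<delta>) 1 - Poly_Mapping.single \<gamma> 1 - Poly_Mapping.single \<delta> 1 | \<gamma> \<delta>.
        \<gamma> \<in> G \<and> \<delta> \<in> G}"

text \<open>\<open>B\<close> is a set of representatives, one for each basis vector, of a basis of \<open>V / W\<close>.\<close>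

definition tensor_basis :: "complex set \<Rightarrow> (complex \<Rightarrow>\<^sub>0 rat) set \<Rightarrow> bool" where
  "tensor_basis G B \<longleftrightarrow> B \<subseteq> tensor_gens G \<and>
     free_rat.span (B \<union> tensor_rels G) = tensor_gens G \<and>
     (\<forall>b\<in>B. b \<notin> free_rat.span ((B - {b}) \<union> tensor_rels G))"

definition finite_rank :: "complex set \<Rightarrow> bool" where
  "finite_rank G \<longleftrightarrow> (\<exists>B. tensor_basis G B \<and> finite B)"

definition group_rank :: "complex set \<Rightarrow> nat" where
  "group_rank G = card (SOME B. tensor_basis G B)"

end

theory Submission
  imports Defs "HOL-Computational_Algebra.Fundamental_Theorem_Algebra" "HOL-Real_Asymp.Real_Asymp"
begin

text \<open>Let \<open>r\<close> be the rank and \<open>\<gamma>\<^sub>1, \<dots>, \<gamma>\<^sub>r\<close> generators of \<open>\<Gamma>\<close> up to torsion. For \<open>\<gamma> \<in> \<Gamma>\<close>, simultaneous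
  Dirichlet approximation of the exponents of \<open>\<gamma>\<close> gives \<open>q \<le> T^r\<close> and integers \<open>p\<^sub>i\<close> such that
  \<open>\<beta> = \<alpha>^q / \<Prod> \<gamma>\<^sub>i^(p\<^sub>i)\<close> has height at most \<open>q h(\<alpha>/\<gamma>) + O(1/T)\<close>. Since \<open>\<Gamma>\<close> is divisible and does not
  contain \<open>\<alpha>\<close>, \<open>\<beta>\<close> is not a root of unity; its degree is \<open>O(D)\<close> with \<open>D = [\<rat>(\<alpha>) : \<rat>]\<close>. A bound
  \<open>h(\<beta>) \<ge> c D^(- 1 - \<delta>)\<close> then yields the claim with \<open>T\<close> of order \<open>D^(1 + \<delta>)\<close>.

  That bound is a weak form of Dobrowolski's theorem. If \<open>\<beta>\<close> is not integral, one \<open>p\<close>-adic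
  contribution already gives \<open>h(\<beta>) \<ge> log 2 / D\<close>. Otherwise the box principle gives an integer
  polynomial \<open>F\<close> of degree below \<open>k (k + 1) D\<close> with small coefficients that vanishes to order \<open>k\<close> at the
  conjugates of \<open>\<beta>\<close>. For primes \<open>p\<close> in the range from \<open>D^(\<delta>/2)\<close> to \<open>D^\<delta>\<close> the norm of \<open>F(\<beta>^p)\<close> is
  divisible by \<open>p^(k D)\<close>, so \<open>F(\<beta>^p) = 0\<close> if the Mahler measure of \<open>\<beta>\<close> is too small, and \<open>F\<close> gets too
  many zeros.\<close>


section \<open>The field of algebraic numbers\<close>

text \<open>The exponent r + 1 is the price of two choices. Making the O(1/T) error negligible
  forces T to be of order D^(1 + \<delta>), and the multiplier q may then be as large as T^r. So
  h(\<alpha>/\<gamma>) is bounded below by a constant times D^(- 1 - \<delta>) / T^r, and \<delta> =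
  \<epsilon> / (r + 1) makes the losses add up to \<epsilon>. The degree of \<beta> is O(D) whatever
  the p_i are, because conjugates of a power are powers of conjugates; hence one constant serves
  every \<gamma>, as the infimum demands.

  All arithmetic is phrased with the homomorphisms in \<open>Gal\<close> of the whole field of
  algebraic numbers: degrees, heights, norms and Mahler measures become cardinalities, averages and
  products over the finite set \<open>orb x\<close>.

  In the lower bound for h(\<beta>) the order k depends on \<delta> alone and is so large that p^k
  exceeds a given multiple of D^2 already for p near D^(\<delta>/2). The largest prime, of size
  D^\<delta>, enters the bound as a factor and accounts for the \<delta> in the exponent.\<close>

abbreviation rat_coeffs :: "complex poly \<Rightarrow> bool" where
  "rat_coeffs p \<equiv> \<forall>i. coeff p i \<in> \<rat>"

lemma span_mult:
  assumes "a \<in> rat_complex.span S" "b \<in> rat_complex.span T"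
  shows "a * b \<in> rat_complex.span ((\<lambda>(s,t). s * t) ` (S \<times> T))" (is "_ \<in> ?R")
proof -
  have *: "s * b \<in> ?R" if s: "s \<in> S" for s
    using assms(2)
  proof (induction rule: rat_complex.span_induct_alt)
    case (step c t y)
    have "s * t \<in> ?R" using s step(1) by (auto intro!: rat_complex.span_base)
    then have "of_rat c * (s * t) + s * y \<in> ?R"
      using step by (intro rat_complex.span_add rat_complex.span_scale) auto
    then show ?case by (simp add: algebra_simps)
  qed (simp add: rat_complex.span_zero)
  show ?thesis using assms(1)
  proof (induction rule: rat_complex.span_induct_alt)
    case (step c s y)
    have "of_rat c * (s * b) + y * b \<in> ?R"
      using step *[of s] by (intro rat_complex.span_add rat_complex.span_scale) auto
    then show ?case by (simp add: algebra_simps)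
  qed (simp add: rat_complex.span_zero)
qed

lemma poly_in_span_powers:
  assumes "rat_coeffs p" "\<And>i. i \<le> degree p \<Longrightarrow> x ^ i \<in> rat_complex.span S"
  shows "poly p x \<in> rat_complex.span S"
proof -
  have "coeff p i * x ^ i \<in> rat_complex.span S" if "i \<le> degree p" for i
  proof -
    obtain q where "coeff p i = of_rat q" using assms(1) Rats_cases by blast
    then show ?thesis using assms(2)[OF that] rat_complex.span_scale by auto
  qed
  then show ?thesis unfolding poly_altdef by (intro rat_complex.span_sum) auto
qed

lemma powers_in_span:
  assumes p: "rat_coeffs p" "p \<noteq> 0" "poly p x = 0"
  shows "x ^ n \<in> rat_complex.span ((\<lambda>i. x ^ i) ` {..<degree p})"
proof (induction n rule: less_induct)
  case (less n)
  let ?S = "(\<lambda>i. x ^ i) ` {..<degree p}"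
  define d where "d = degree p"
  define c where "c = coeff p d"
  have c: "c \<noteq> 0" "c \<in> \<rat>" using p by (auto simp: c_def d_def)
  show ?case
  proof (cases "n < d")
    case True
    then show ?thesis by (intro rat_complex.span_base) (auto simp: d_def)
  next
    case False
    have "0 = (\<Sum>i<d. coeff p i * x ^ i) + c * x ^ d"
      using p(3) by (simp add: poly_altdef c_def d_def lessThan_Suc_atMost[symmetric])
    then have "x ^ d = (\<Sum>i<d. (- coeff p i / c) * x ^ i)"
      using c by (simp add: field_simps sum_negf sum_divide_distrib[symmetric] add_eq_0_iff2)
    then have "x ^ n = x ^ (n - d) * (\<Sum>i<d. (- coeff p i / c) * x ^ i)"
      using False by (metis le_add_diff_inverse2 not_less power_add)
    also have "\<dots> = (\<Sum>i<d. (- coeff p i / c) * x ^ (n - d + i))"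
      by (simp add: sum_distrib_left power_add algebra_simps)
    also have "\<dots> \<in> rat_complex.span ?S"
    proof (intro rat_complex.span_sum)
      fix i assume i: "i \<in> {..<d}"
      have "- coeff p i / c \<in> \<rat>" using p(1) c by auto
      then obtain q where "- coeff p i / c = of_rat q" using Rats_cases by blast
      moreover have "x ^ (n - d + i) \<in> rat_complex.span ?S" using less i False by auto
      ultimately show "(- coeff p i / c) * x ^ (n - d + i) \<in> rat_complex.span ?S"
        using rat_complex.span_scale by auto
    qed
    finally show ?thesis .
  qed
qed

text \<open>Dependence is a property of sets, so a repetition among the powers is invisible to it:
  \<open>x ^ i = x ^ j\<close> merely shrinks the set, yet is a linear relation too. Hence the
  disjunction.\<close>

lemma rat_poly_of_dependent_powers:
  assumes "\<not> inj_on (\<lambda>i. x ^ i) {..<n} \<or> rat_complex.dependent ((\<lambda>i. x ^ i) ` {..<n})"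
  obtains P where "rat_coeffs P" "P \<noteq> 0" "poly P x = 0" "degree P < n"
proof -
  have "\<exists>u j. j < n \<and> u j \<noteq> (0::rat) \<and> (\<Sum>i<n. of_rat (u i) * x ^ i) = 0"
  proof (cases "inj_on (\<lambda>i. x ^ i) {..<n}")
    case False
    then obtain i j where ij: "i < n" "j < n" "i \<noteq> j" "x ^ i = x ^ j" by (auto simp: inj_on_def)
    define u :: "nat \<Rightarrow> rat" where "u k = (if k = i then 1 else if k = j then -1 else 0)" for k
    have "(\<Sum>k<n. of_rat (u k) * x ^ k) = (\<Sum>k<n. (if k = i then x ^ i else 0) - (if k = j then x ^ j else 0))"
      using ij by (intro sum.cong) (auto simp: u_def)
    also have "\<dots> = 0" using ij by (simp add: sum_subtractf)
    finally show ?thesis using ij by (intro exI[of _ u] exI[of _ i]) (simp add: u_def)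
  next
    case True
    then obtain u v where uv: "v \<in> (\<lambda>i. x ^ i) ` {..<n}" "u v \<noteq> 0"
      "(\<Sum>v\<in>(\<lambda>i. x ^ i) ` {..<n}. of_rat (u v) * v) = 0"
      using assms by (subst (asm) rat_complex.dependent_finite) auto
    then obtain j where j: "j < n" "v = x ^ j" by auto
    have "(\<Sum>i<n. of_rat (u (x ^ i)) * x ^ i) = 0"
      using uv(3) by (subst (asm) sum.reindex[OF True]) simp
    then show ?thesis using j uv(2) by (intro exI[of _ "\<lambda>i. u (x ^ i)"] exI[of _ j]) simp
  qed
  then obtain u j where u: "j < n" "u j \<noteq> (0::rat)" "(\<Sum>i<n. of_rat (u i) * x ^ i) = 0" by blast
  define P :: "complex poly" where "P = (\<Sum>i<n. monom (of_rat (u i)) i)"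
  have co: "coeff P i = (if i < n then of_rat (u i) else 0)" for i by (simp add: P_def coeff_sum)
  show ?thesis
  proof (rule that[of P])
    show "poly P x = 0" using u(3) by (simp add: P_def poly_sum poly_monom)
    show "P \<noteq> 0" using co[of j] u by auto
    show "degree P < n" using u(1) by (intro degree_lessI) (auto simp: co)
  qed (simp add: co)
qed

text \<open>More than \<open>card S\<close> vectors in the span of S are dependent. With
  \<open>span_mult\<close> this gives closure under sums and products, since the powers of
  \<open>x + y\<close> and \<open>x * y\<close> lie in the span of finitely many pairwise
  products.\<close>

lemma algebraic_if_powers_in_span:
  assumes "finite S" "\<And>n. x ^ n \<in> rat_complex.span S"
  shows "algebraic x"
proof -
  let ?B = "(\<lambda>i. x ^ i) ` {..<Suc (card S)}"
  have "\<not> inj_on (\<lambda>i. x ^ i) {..<Suc (card S)} \<or> rat_complex.dependent ?B"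
  proof (rule ccontr)
    assume "\<not> ?thesis"
    then have "card ?B = Suc (card S)" "rat_complex.independent ?B" by (simp_all add: card_image)
    moreover have "card ?B \<le> card S" if "rat_complex.independent ?B"
      using rat_complex.independent_span_bound[OF assms(1) that] assms(2) by auto
    ultimately show False by simp
  qed
  then obtain P where "rat_coeffs P" "P \<noteq> 0" "poly P x = 0" by (rule rat_poly_of_dependent_powers)
  then show ?thesis unfolding algebraic_altdef by blast
qed

lemma algebraic_powers_span:
  assumes "algebraic x"
  obtains S where "finite S" "\<And>n. x ^ n \<in> rat_complex.span S"
proof -
  obtain p where p: "rat_coeffs p" "p \<noteq> 0" "poly p x = 0"
    using assms algebraic_altdef by blast
  then show ?thesis using powers_in_span[OF p] by (intro that[of "(\<lambda>i. x ^ i) ` {..<degree p}"]) auto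
qed

lemma algebraic_add [simp, intro]:
  fixes x y :: complex
  assumes "algebraic x" "algebraic y" shows "algebraic (x + y)"
proof -
  obtain S where S: "finite S" "\<And>n. x ^ n \<in> rat_complex.span S" using algebraic_powers_span assms by metis
  obtain T where T: "finite T" "\<And>n. y ^ n \<in> rat_complex.span T" using algebraic_powers_span assms by metis
  let ?R = "(\<lambda>(s,t). s * t) ` (S \<times> T)"
  have "(x + y) ^ n \<in> rat_complex.span ?R" for n
    unfolding binomial_ring
  proof (intro rat_complex.span_sum)
    fix k
    have "of_rat (of_nat (n choose k)) * (x ^ k * y ^ (n - k)) \<in> rat_complex.span ?R"
      using S T span_mult by (intro rat_complex.span_scale) blast
    then show "of_nat (n choose k) * x ^ k * y ^ (n - k) \<in> rat_complex.span ?R"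
      by (simp add: mult.assoc)
  qed
  then show ?thesis using S T by (intro algebraic_if_powers_in_span[of ?R]) auto
qed

lemma algebraic_mult [simp, intro]:
  fixes x y :: complex
  assumes "algebraic x" "algebraic y" shows "algebraic (x * y)"
proof -
  obtain S where S: "finite S" "\<And>n. x ^ n \<in> rat_complex.span S" using algebraic_powers_span assms by metis
  obtain T where T: "finite T" "\<And>n. y ^ n \<in> rat_complex.span T" using algebraic_powers_span assms by metis
  let ?R = "(\<lambda>(s,t). s * t) ` (S \<times> T)"
  have "(x * y) ^ n \<in> rat_complex.span ?R" for n
    unfolding power_mult_distrib using span_mult S T by blast
  then show ?thesis using S T by (intro algebraic_if_powers_in_span[of ?R]) auto
qed

lemma algebraic_1 [simp, intro]: "algebraic (1::complex)"
  by (rule rat_imp_algebraic) auto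

lemma algebraic_of_rat [simp]: "algebraic (of_rat q :: complex)"
  by (rule rat_imp_algebraic) auto

lemma algebraic_of_int [simp]: "algebraic (of_int q :: complex)"
  by (rule rat_imp_algebraic) auto

lemma algebraic_diff [simp, intro]:
  fixes x y :: complex
  shows "algebraic x \<Longrightarrow> algebraic y \<Longrightarrow> algebraic (x - y)"
  using algebraic_add[of x "-y"] by auto

lemma algebraic_power [simp, intro]: "algebraic (x::complex) \<Longrightarrow> algebraic (x ^ n)"
  by (induction n) auto

lemma algebraic_divide [simp, intro]:
  fixes x y :: complex
  shows "algebraic x \<Longrightarrow> algebraic y \<Longrightarrow> algebraic (x / y)"
  unfolding divide_inverse by auto

lemma algebraic_power_int [simp, intro]: "algebraic (x::complex) \<Longrightarrow> algebraic (x powi n)"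
  by (auto simp: power_int_def)

lemma algebraic_sum [simp, intro]:
  fixes f :: "'a \<Rightarrow> complex"
  shows "(\<And>i. i \<in> A \<Longrightarrow> algebraic (f i)) \<Longrightarrow> algebraic (sum f A)"
  by (induction A rule: infinite_finite_induct) auto

lemma algebraic_prod [simp, intro]:
  fixes f :: "'a \<Rightarrow> complex"
  shows "(\<And>i. i \<in> A \<Longrightarrow> algebraic (f i)) \<Longrightarrow> algebraic (prod f A)"
  by (induction A rule: infinite_finite_induct) auto

lemma algebraic_poly:
  fixes p :: "complex poly"
  assumes "\<And>i. algebraic (coeff p i)" "algebraic x"
  shows "algebraic (poly p x)"
  unfolding poly_altdef using assms by auto

lemma Rats_sum [intro]:
  fixes f :: "'a \<Rightarrow> complex"
  shows "(\<And>i. i \<in> A \<Longrightarrow> f i \<in> \<rat>) \<Longrightarrow> sum f A \<in> \<rat>"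
  by (induction A rule: infinite_finite_induct) auto

lemma rat_coeffs_mult: "rat_coeffs p \<Longrightarrow> rat_coeffs q \<Longrightarrow> rat_coeffs (p * q)"
  by (auto simp: coeff_mult)

lemma rat_coeffs_pcompose: "rat_coeffs p \<Longrightarrow> rat_coeffs q \<Longrightarrow> rat_coeffs (pcompose p q)"
proof (induction p)
  case (pCons a p)
  have "rat_coeffs p"
  proof
    fix i show "coeff p i \<in> \<rat>" using pCons(3)[rule_format, of "Suc i"] by simp
  qed
  moreover have "a \<in> \<rat>" using pCons(3)[rule_format, of 0] by simp
  ultimately show ?case using pCons rat_coeffs_mult[of q "pcompose p q"]
    by (auto simp: pcompose_pCons coeff_pCons split: nat.splits)
qed auto

lemma rat_coeffs_pderiv: "rat_coeffs p \<Longrightarrow> rat_coeffs (pderiv p)"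
  by (auto simp: coeff_pderiv simp del: of_nat_Suc)

text \<open>A relation with nonzero constant term is solved for 1/z. Rings of polynomial values are
  therefore fields, and a map that respects sums and products respects inverses.\<close>

lemma inverse_eq_poly:
  assumes "algebraic z" "z \<noteq> 0"
  obtains p where "rat_coeffs p" "inverse z = poly p z"
proof -
  obtain r :: "int poly" where r: "coeff r 0 \<noteq> 0" "poly (map_poly of_int r) z = 0"
    using algebraicE'_nonzero[OF assms] .
  define p :: "complex poly" where "p = map_poly of_int r"
  have p: "\<And>i. coeff p i \<in> \<int>" "coeff p 0 \<noteq> 0" "poly p z = 0"
    using r by (auto simp: p_def coeff_map_poly)
  obtain c q where pc: "p = pCons c q" by (cases p) auto
  have "c \<noteq> 0" "c \<in> \<int>" using p(1)[of 0] p(2) by (auto simp: pc)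
  have cq: "coeff q i \<in> \<int>" for i using p(1)[of "Suc i"] by (simp add: pc)
  have "c + z * poly q z = 0" using p(3) by (simp add: pc)
  then have "inverse z = - poly q z / c" using assms(2) \<open>c \<noteq> 0\<close> by (simp add: field_simps add_eq_0_iff)
  also have "\<dots> = poly (smult (- 1 / c) q) z" by simp
  finally show ?thesis
    using that[of "smult (- 1 / c) q"] cq \<open>c \<in> \<int>\<close> Ints_subset_Rats
    by (auto simp: subset_iff intro!: Rats_divide)
qed

section \<open>Extending embeddings to all algebraic numbers\<close>

text \<open>A partial embedding of the algebraic numbers, given by its graph.\<close>

definition emb_graph :: "(complex \<times> complex) set \<Rightarrow> bool" where
  "emb_graph G \<longleftrightarrow> (\<forall>q\<in>\<rat>. (q, q) \<in> G) \<and>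
     (\<forall>a b a' b'. (a,b) \<in> G \<longrightarrow> (a',b') \<in> G \<longrightarrow> (a + a', b + b') \<in> G \<and> (a * a', b * b') \<in> G) \<and>
     (\<forall>a b. (a,b) \<in> G \<longrightarrow> algebraic a) \<and> (\<forall>b. (0,b) \<in> G \<longrightarrow> b = 0)"

context
  fixes G assumes G: "emb_graph G"
begin

lemma graph_rat: "q \<in> \<rat> \<Longrightarrow> (q, q) \<in> G"
  and graph_add: "(a,b) \<in> G \<Longrightarrow> (a',b') \<in> G \<Longrightarrow> (a + a', b + b') \<in> G"
  and graph_mult: "(a,b) \<in> G \<Longrightarrow> (a',b') \<in> G \<Longrightarrow> (a * a', b * b') \<in> G"
  and graph_algebraic: "(a,b) \<in> G \<Longrightarrow> algebraic a"
  and graph_0: "(0,b) \<in> G \<Longrightarrow> b = 0"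
  using G unfolding emb_graph_def by blast+

lemma graph_minus: "(a,b) \<in> G \<Longrightarrow> (- a, - b) \<in> G"
  using graph_mult[OF graph_rat[of "-1"]] by force

lemma graph_diff: "(a,b) \<in> G \<Longrightarrow> (a',b') \<in> G \<Longrightarrow> (a - a', b - b') \<in> G"
  using graph_add[OF _ graph_minus] by force

lemma graph_unique: "(a,b) \<in> G \<Longrightarrow> (a,b') \<in> G \<Longrightarrow> b = b'"
  using graph_diff[of a b a b'] graph_0[of "b - b'"] by auto

lemma graph_power: "(a,b) \<in> G \<Longrightarrow> (a ^ n, b ^ n) \<in> G"
  by (induction n) (auto intro: graph_rat graph_mult)

lemma graph_sum: "(\<And>i. i \<in> A \<Longrightarrow> (f i, g i) \<in> G) \<Longrightarrow> (sum f A, sum g A) \<in> G"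
  by (induction A rule: infinite_finite_induct) (auto intro: graph_rat graph_add)

lemma graph_poly: "rat_coeffs p \<Longrightarrow> (a,b) \<in> G \<Longrightarrow> (poly p a, poly p b) \<in> G"
  unfolding poly_altdef by (intro graph_sum graph_mult graph_power graph_rat) auto

lemma graph_inverse:
  assumes "(a,b) \<in> G" "a \<noteq> 0"
  obtains b' where "(inverse a, b') \<in> G" "b * b' = 1"
proof -
  obtain p where p: "rat_coeffs p" "inverse a = poly p a"
    using inverse_eq_poly graph_algebraic assms by metis
  have 1: "(inverse a, poly p b) \<in> G" using graph_poly[OF p(1) assms(1)] p(2) by simp
  have "(1, b * poly p b) \<in> G" using graph_mult[OF assms(1) 1] assms(2) by simp
  then show ?thesis using that 1 graph_unique[OF _ graph_rat[of 1]] by auto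
qed

section \<open>Adjoining one algebraic number to a partial embedding\<close>

definition graph_pair where
  "graph_pair P Q \<longleftrightarrow> (\<forall>i. (coeff P i, coeff Q i) \<in> G)"

text \<open>\<open>graph_pair P Q\<close> says that Q is P with the embedding applied to its
  coefficients, so this relation is the only candidate for an extension sending a to b. It is
  single-valued as soon as b is a root of the image of the minimal polynomial of a.\<close>

definition graph_ext where
  "graph_ext a b = {(poly P a, poly Q b) | P Q. graph_pair P Q}"

lemma graph_extI: "graph_pair P Q \<Longrightarrow> u = poly P a \<Longrightarrow> v = poly Q b \<Longrightarrow> (u, v) \<in> graph_ext a b"
  unfolding graph_ext_def by blast

lemma graph_pair_add: "graph_pair P Q \<Longrightarrow> graph_pair P' Q' \<Longrightarrow> graph_pair (P + P') (Q + Q')"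
  and graph_pair_diff: "graph_pair P Q \<Longrightarrow> graph_pair P' Q' \<Longrightarrow> graph_pair (P - P') (Q - Q')"
  and graph_pair_mult: "graph_pair P Q \<Longrightarrow> graph_pair P' Q' \<Longrightarrow> graph_pair (P * P') (Q * Q')"
  and graph_pair_smult: "(c, c') \<in> G \<Longrightarrow> graph_pair P Q \<Longrightarrow> graph_pair (smult c P) (smult c' Q)"
  and graph_pair_rat: "rat_coeffs R \<Longrightarrow> graph_pair R R"
  unfolding graph_pair_def coeff_mult
  by (auto intro: graph_add graph_diff graph_mult graph_sum graph_rat)

lemma graph_pair_const: "(c,c') \<in> G \<Longrightarrow> graph_pair [:c:] [:c':]"
  using graph_rat[of 0] by (auto simp: graph_pair_def coeff_pCons split: nat.splits)

text \<open>P is the minimal polynomial of a over the domain of G, made monic by the inverse of its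
  leading coefficient; the partner of that inverse makes Q monic. Q has no higher degree than P
  because 0 is the only partner of 0.\<close>

lemma graph_min_pair:
  assumes "algebraic a"
  obtains P Q where "graph_pair P Q" "lead_coeff P = 1" "lead_coeff Q = 1" "degree Q = degree P"
    "degree P > 0" "poly P a = 0"
    "\<And>P' Q'. graph_pair P' Q' \<Longrightarrow> P' \<noteq> 0 \<Longrightarrow> poly P' a = 0 \<Longrightarrow> degree P \<le> degree P'"
proof -
  let ?P = "\<lambda>d. \<exists>P Q. graph_pair P Q \<and> P \<noteq> 0 \<and> poly P a = 0 \<and> degree P = d"
  obtain p where p: "rat_coeffs p" "p \<noteq> 0" "poly p a = 0"
    using assms algebraic_altdef by blast
  then have "?P (degree p)" using graph_pair_rat by blast
  then have "?P (LEAST d. ?P d)" by (rule LeastI)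
  then obtain P Q where PQ: "graph_pair P Q" "P \<noteq> 0" "poly P a = 0" "degree P = (LEAST d. ?P d)" by blast
  have least: "degree P \<le> degree P'" if "graph_pair P' Q'" "P' \<noteq> 0" "poly P' a = 0" for P' Q'
    unfolding PQ(4) by (rule Least_le) (use that in blast)
  define c where "c = lead_coeff P"
  have c: "(c, coeff Q (degree P)) \<in> G" "c \<noteq> 0" using PQ(1,2) by (auto simp: graph_pair_def c_def)
  obtain e where e: "(inverse c, e) \<in> G" "coeff Q (degree P) * e = 1" using graph_inverse[OF c] .
  define P1 Q1 where "P1 = smult (inverse c) P" and "Q1 = smult e Q"
  have gp: "graph_pair P1 Q1" unfolding P1_def Q1_def by (intro graph_pair_smult e PQ)
  have dP: "degree P1 = degree P" using c by (simp add: P1_def)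
  have 1: "lead_coeff P1 = 1" using c by (simp add: dP) (simp add: P1_def c_def)
  have 2: "coeff Q1 (degree P) = 1" using e by (simp add: Q1_def mult.commute)
  have "degree Q1 \<le> degree P"
  proof (rule degree_le, intro allI impI)
    fix i assume "degree P < i"
    then have "(0, coeff Q1 i) \<in> G" using gp coeff_eq_0[of P1 i] dP unfolding graph_pair_def by metis
    then show "coeff Q1 i = 0" by (rule graph_0)
  qed
  then have dQ: "degree Q1 = degree P" using 2 le_degree[of Q1 "degree P"] by auto
  have "degree P > 0"
  proof (rule ccontr)
    assume "\<not> degree P > 0"
    then obtain k where "P = [:k:]" using degree_eq_zeroE by auto
    then show False using PQ by auto
  qed
  then show ?thesis using that[of P1 Q1] gp 1 2 dQ dP PQ(3) least by (simp add: P1_def)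
qed

lemma graph_ext_emb_graph:
  assumes a: "algebraic a" and PQ: "graph_pair P Q" "lead_coeff P = 1" "lead_coeff Q = 1" "degree Q = degree P"
    "poly P a = 0"
    and least: "\<And>P' Q'. graph_pair P' Q' \<Longrightarrow> P' \<noteq> 0 \<Longrightarrow> poly P' a = 0 \<Longrightarrow> degree P \<le> degree P'"
    and b: "poly Q b = 0"
  shows "emb_graph (graph_ext a b)" "G \<subseteq> graph_ext a b" "(a,b) \<in> graph_ext a b"
proof -
  \<comment> \<open>Single-valuedness: division of R by the monic P, with the same steps performed
    on S and Q. Each round cancels the coefficients at index n, and minimality of P guarantees that
    a nonzero R is long enough for one more round.\<close>
  have 0: "poly S b = 0" if "graph_pair R S" "\<forall>i\<ge>n. coeff R i = 0" "poly R a = 0" for n R S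
    using that
  proof (induction n arbitrary: R S)
    case 0
    then have "coeff S i = 0" for i using graph_0[of "coeff S i"] by (simp add: graph_pair_def)
    then have "S = 0" by (simp add: poly_eq_iff)
    then show ?case by simp
  next
    case (Suc n)
    show ?case
    proof (cases "R = 0")
      case True
      then show ?thesis using Suc.IH[of R S] Suc.prems by simp
    next
      case False
      then have "degree P \<le> degree R" using least Suc.prems by blast
      moreover have "degree R \<le> n" using Suc.prems(2) by (intro degree_le) auto
      ultimately have dn: "degree P \<le> n" by simp
      define m where "m = n - degree P"
      have rm: "rat_coeffs (monom 1 m)" by simp
      let ?R = "R - smult (coeff R n) (monom 1 m * P)" and ?S = "S - smult (coeff S n) (monom 1 m * Q)"
      have "graph_pair ?R ?S"
        using Suc.prems(1) by (intro graph_pair_diff graph_pair_smult graph_pair_mult graph_pair_rat rm PQ)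
           (auto simp: graph_pair_def)
      moreover have "\<forall>i\<ge>n. coeff ?R i = 0"
      proof (intro allI impI)
        fix i assume i: "n \<le> i"
        show "coeff ?R i = 0"
        proof (cases "i = n")
          case True
          then show ?thesis using PQ(2) dn by (simp add: coeff_monom_mult m_def)
        next
          case False
          then have "coeff R i = 0" "i - m > degree P" using i Suc.prems(2) dn by (auto simp: m_def)
          then show ?thesis by (simp add: coeff_monom_mult coeff_eq_0)
        qed
      qed
      moreover have "poly ?R a = 0" using PQ(5) Suc.prems(3) by simp
      ultimately have "poly ?S b = 0" by (rule Suc.IH)
      then show ?thesis using b by simp
    qed
  qed
  show "emb_graph (graph_ext a b)"
    unfolding emb_graph_def
  proof (intro conjI allI impI ballI)
    fix q :: complex assume "q \<in> \<rat>"
    then have "graph_pair [:q:] [:q:]" by (intro graph_pair_const graph_rat)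
    then show "(q, q) \<in> graph_ext a b" by (rule graph_extI) simp_all
  next
    fix u v u' v' assume "(u, v) \<in> graph_ext a b" "(u', v') \<in> graph_ext a b"
    then obtain R S R' S' where *: "graph_pair R S" "graph_pair R' S'" "u = poly R a" "v = poly S b" "u' = poly R' a" "v' = poly S' b"
      by (auto simp: graph_ext_def)
    show "(u + u', v + v') \<in> graph_ext a b"
      by (rule graph_extI[OF graph_pair_add[OF *(1,2)]]) (simp_all add: *)
    show "(u * u', v * v') \<in> graph_ext a b"
      by (rule graph_extI[OF graph_pair_mult[OF *(1,2)]]) (simp_all add: *)
  next
    fix u v assume "(u, v) \<in> graph_ext a b"
    then obtain R S where *: "graph_pair R S" "u = poly R a" by (auto simp: graph_ext_def)
    show "algebraic u" unfolding *(2)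
      by (rule algebraic_poly[OF _ a]) (use *(1) graph_algebraic in \<open>simp add: graph_pair_def, blast\<close>)
  next
    fix v assume "(0, v) \<in> graph_ext a b"
    then obtain R S where *: "graph_pair R S" "0 = poly R a" "v = poly S b" by (auto simp: graph_ext_def)
    show "v = 0" using 0[OF *(1), of "Suc (degree R)"] * by (simp add: coeff_eq_0)
  qed
  show "G \<subseteq> graph_ext a b"
  proof
    fix z assume "z \<in> G"
    then have "graph_pair [:fst z:] [:snd z:]" by (intro graph_pair_const) simp
    then have "(fst z, snd z) \<in> graph_ext a b" by (rule graph_extI) simp_all
    then show "z \<in> graph_ext a b" by simp
  qed
  have "rat_coeffs [:0,1:]" by (auto simp: coeff_pCons split: nat.splits)
  then show "(a,b) \<in> graph_ext a b" by (intro graph_extI[OF graph_pair_rat]) auto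
qed

lemma graph_extend:
  assumes a: "algebraic a"
  obtains G' b where "emb_graph G'" "G \<subseteq> G'" "(a,b) \<in> G'"
proof -
  obtain P Q where PQ: "graph_pair P Q" "lead_coeff P = 1" "lead_coeff Q = 1" "degree Q = degree P"
    "degree P > 0" "poly P a = 0"
    "\<And>P' Q'. graph_pair P' Q' \<Longrightarrow> P' \<noteq> 0 \<Longrightarrow> poly P' a = 0 \<Longrightarrow> degree P \<le> degree P'"
    by (rule graph_min_pair[OF a]) blast
  obtain b where b: "poly Q b = 0"
    using fundamental_theorem_of_algebra[of Q] PQ(4,5) by (auto simp: constant_degree)
  have "emb_graph (graph_ext a b)" "G \<subseteq> graph_ext a b" "(a,b) \<in> graph_ext a b"
    by (rule graph_ext_emb_graph[OF a PQ(1-4,6)]; use PQ(7) b in blast)+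
  then show ?thesis by (rule that)
qed

end

text \<open>Total functions with arbitrary values off the algebraic numbers, so that they compose
  freely. Inverses come from the finiteness of orbits, see \<open>gal_periodic\<close>.\<close>

definition Gal :: "(complex \<Rightarrow> complex) set" where
  "Gal = {g. g 1 = 1 \<and> (\<forall>x y. algebraic x \<longrightarrow> algebraic y \<longrightarrow> g (x + y) = g x + g y \<and> g (x * y) = g x * g y)}"

text \<open>Zorn's lemma: any two pairs in the union of a chain lie in one member, and a maximal
  graph is defined on every algebraic number by \<open>graph_extend\<close>.\<close>

lemma emb_graph_extends_to_Gal:
  assumes G: "emb_graph G"
  obtains g where "g \<in> Gal" "\<And>a b. (a,b) \<in> G \<Longrightarrow> g a = b"
proof -
  let ?A = "{H. emb_graph H \<and> G \<subseteq> H}"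
  have "\<exists>M\<in>?A. \<forall>X\<in>?A. M \<subseteq> X \<longrightarrow> X = M"
  proof (rule subset_Zorn_nonempty)
    show "?A \<noteq> {}" using G by blast
    fix C assume C: "C \<noteq> {}" "subset.chain ?A C"
    have CA: "emb_graph H" "G \<subseteq> H" if "H \<in> C" for H using C that by (auto simp: subset.chain_def)
    have two: "\<exists>H\<in>C. z \<in> H \<and> z' \<in> H" if zz: "z \<in> \<Union>C" "z' \<in> \<Union>C" for z z'
    proof -
      obtain H H' where H: "H \<in> C" "z \<in> H" "H' \<in> C" "z' \<in> H'" using zz by blast
      then have "H \<subseteq> H' \<or> H' \<subseteq> H" using C(2) unfolding subset_chain_def by blast
      then show ?thesis using H by blast
    qed
    obtain H0 where H0: "H0 \<in> C" using C by blast
    have "emb_graph (\<Union>C)"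
      unfolding emb_graph_def
    proof (intro conjI allI impI ballI)
      fix q :: complex assume "q \<in> \<rat>"
      then show "(q,q) \<in> \<Union>C" using graph_rat[OF CA(1)] H0 by blast
    next
      fix a b a' b' assume "(a,b) \<in> \<Union>C" "(a',b') \<in> \<Union>C"
      then obtain H where H: "H \<in> C" "(a,b) \<in> H" "(a',b') \<in> H" using two by blast
      show "(a + a', b + b') \<in> \<Union>C" "(a * a', b * b') \<in> \<Union>C"
        using graph_add[OF CA(1) H(2,3)] graph_mult[OF CA(1) H(2,3)] H(1) by blast+
    next
      fix a b assume "(a,b) \<in> \<Union>C"
      then show "algebraic a" using graph_algebraic[OF CA(1)] by blast
    next
      fix b assume "(0,b) \<in> \<Union>C"
      then show "b = 0" using graph_0[OF CA(1)] by blast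
    qed
    then show "\<Union>C \<in> ?A" using CA H0 by blast
  qed
  then obtain M where M0: "M \<in> ?A" "\<forall>X\<in>?A. M \<subseteq> X \<longrightarrow> X = M" by (rule bexE)
  have M: "emb_graph M" "G \<subseteq> M" using M0(1) by simp_all
  have max: "X = M" if "emb_graph X" "M \<subseteq> X" for X using M0(2) M(2) that by simp
  define g where "g a = (THE b. (a,b) \<in> M)" for a
  have g: "g a = b" if "(a,b) \<in> M" for a b
    unfolding g_def using that graph_unique[OF M(1)] by blast
  have tot: "(a, g a) \<in> M" if a: "algebraic a" for a
  proof -
    obtain M' b where "emb_graph M'" "M \<subseteq> M'" "(a,b) \<in> M'" using graph_extend[OF M(1) a] .
    moreover from this have "M' = M" by (intro max)
    ultimately have "(a,b) \<in> M" by simp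
    then show ?thesis using g by simp
  qed
  have "g 1 = 1" using g graph_rat[OF M(1), of 1] by simp
  moreover have "g (x + y) = g x + g y" "g (x * y) = g x * g y" if "algebraic x" "algebraic y" for x y
    by (rule g, rule graph_add[OF M(1)], rule tot, fact, rule tot, fact)
       (rule g, rule graph_mult[OF M(1)], rule tot, fact, rule tot, fact)
  ultimately have "g \<in> Gal" by (simp add: Gal_def)
  then show ?thesis using g M(2) by (intro that) auto
qed

section \<open>Conjugates\<close>

lemma subfield_uminus: "is_subfield K \<Longrightarrow> x \<in> K \<Longrightarrow> - x \<in> K"
  and subfield_add: "is_subfield K \<Longrightarrow> x \<in> K \<Longrightarrow> y \<in> K \<Longrightarrow> x + y \<in> K"
  and subfield_mult: "is_subfield K \<Longrightarrow> x \<in> K \<Longrightarrow> y \<in> K \<Longrightarrow> x * y \<in> K"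
  and subfield_inverse: "is_subfield K \<Longrightarrow> x \<in> K \<Longrightarrow> inverse x \<in> K"
  and subfield_0: "is_subfield K \<Longrightarrow> 0 \<in> K"
  and subfield_1: "is_subfield K \<Longrightarrow> 1 \<in> K"
  unfolding is_subfield_def by blast+

lemma subfield_of_nat: "is_subfield K \<Longrightarrow> of_nat n \<in> K"
  by (induction n) (auto intro: subfield_0 subfield_1 subfield_add)

lemma subfield_of_int: "is_subfield K \<Longrightarrow> of_int n \<in> K"
  by (cases n) (auto intro: subfield_of_nat subfield_uminus simp del: of_nat_Suc)

lemma subfield_Rats: "is_subfield K \<Longrightarrow> q \<in> \<rat> \<Longrightarrow> q \<in> K"
  by (erule Rats_cases') (simp add: divide_inverse subfield_of_int subfield_mult subfield_inverse)

lemma subfield_sum: "is_subfield K \<Longrightarrow> (\<And>i. i \<in> A \<Longrightarrow> f i \<in> K) \<Longrightarrow> sum f A \<in> K"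
  by (induction A rule: infinite_finite_induct) (auto intro: subfield_0 subfield_add)

lemma subfield_power: "is_subfield K \<Longrightarrow> x \<in> K \<Longrightarrow> x ^ n \<in> K"
  by (induction n) (auto intro: subfield_1 subfield_mult)

lemma subfield_poly: "is_subfield K \<Longrightarrow> rat_coeffs p \<Longrightarrow> x \<in> K \<Longrightarrow> poly p x \<in> K"
  unfolding poly_altdef
  by (rule subfield_sum, assumption) (simp add: subfield_mult subfield_power subfield_Rats)

lemma subfield_algebraic: "is_subfield {x. algebraic x}"
  unfolding is_subfield_def by auto

lemma hom_Rats:
  assumes K: "is_subfield K" and 1: "\<sigma> 1 = 1"
    and hom: "\<And>x y. x \<in> K \<Longrightarrow> y \<in> K \<Longrightarrow> \<sigma> (x + y) = \<sigma> x + \<sigma> y \<and> \<sigma> (x * y) = \<sigma> x * (\<sigma> y :: complex)"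
    and q: "q \<in> \<rat>"
  shows "\<sigma> q = q"
proof -
  have 0: "\<sigma> 0 = 0" using hom[of 0 0] subfield_0[OF K] by simp
  have nat: "\<sigma> (of_nat n) = of_nat n" for n
    by (induction n) (use 0 1 hom[OF subfield_1[OF K] subfield_of_nat[OF K]] in auto)
  have int: "\<sigma> (of_int n) = of_int n" for n
  proof (cases n)
    case (neg m)
    have "0 = \<sigma> (of_nat (Suc m) + of_int n)" using neg 0 by simp
    also have "\<dots> = of_nat (Suc m) + \<sigma> (of_int n)"
      using hom[OF subfield_of_nat[OF K] subfield_of_int[OF K]] nat by presburger
    finally show ?thesis using neg by (simp add: add_eq_0_iff)
  qed (simp add: nat)
  obtain a b where ab: "b > 0" "q = of_int a / of_int b" using q by (rule Rats_cases')
  have "of_int a = \<sigma> (of_int b * q)" using ab int by simp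
  also have "\<dots> = of_int b * \<sigma> q"
    using hom[OF subfield_of_int[OF K] subfield_Rats[OF K q]] int by simp
  finally have "of_int b * \<sigma> q = of_int b * q" using ab by simp
  then show ?thesis using ab(1) by simp
qed

section \<open>Homomorphisms of the field of algebraic numbers and their orbits\<close>

lemma gal_add: "g \<in> Gal \<Longrightarrow> algebraic x \<Longrightarrow> algebraic y \<Longrightarrow> g (x + y) = g x + g y"
  and gal_mult: "g \<in> Gal \<Longrightarrow> algebraic x \<Longrightarrow> algebraic y \<Longrightarrow> g (x * y) = g x * g y"
  and gal_1: "g \<in> Gal \<Longrightarrow> g 1 = 1"
  unfolding Gal_def by auto

lemma gal_Rats: "g \<in> Gal \<Longrightarrow> q \<in> \<rat> \<Longrightarrow> g q = q"
  by (rule hom_Rats[OF subfield_algebraic]) (auto simp: gal_add gal_mult gal_1)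

lemma gal_0: "g \<in> Gal \<Longrightarrow> g 0 = 0"
  by (rule gal_Rats) auto

lemma gal_power: "g \<in> Gal \<Longrightarrow> algebraic x \<Longrightarrow> g (x ^ n) = g x ^ n"
  by (induction n) (simp_all add: gal_mult gal_1)

lemma gal_sum: "g \<in> Gal \<Longrightarrow> (\<And>i. i \<in> A \<Longrightarrow> algebraic (f i)) \<Longrightarrow> g (sum f A) = (\<Sum>i\<in>A. g (f i))"
  by (induction A rule: infinite_finite_induct) (simp_all add: gal_add gal_0)

lemma gal_prod: "g \<in> Gal \<Longrightarrow> (\<And>i. i \<in> A \<Longrightarrow> algebraic (f i)) \<Longrightarrow> g (prod f A) = (\<Prod>i\<in>A. g (f i))"
  by (induction A rule: infinite_finite_induct) (simp_all add: gal_mult gal_1)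

lemma algebraic_rat_coeffs: "rat_coeffs p \<Longrightarrow> algebraic x \<Longrightarrow> algebraic (poly p x)"
  by (rule algebraic_poly) (auto intro: rat_imp_algebraic)

lemma gal_poly: "g \<in> Gal \<Longrightarrow> rat_coeffs p \<Longrightarrow> algebraic x \<Longrightarrow> g (poly p x) = poly p (g x)"
  unfolding poly_altdef
  by (subst gal_sum) (auto simp: gal_mult gal_power gal_Rats rat_imp_algebraic)

lemma gal_diff: "g \<in> Gal \<Longrightarrow> algebraic x \<Longrightarrow> algebraic y \<Longrightarrow> g (x - y) = g x - g y"
  using gal_add[of g "x - y" y] by (auto simp: algebra_simps)

lemma gal_minus: "g \<in> Gal \<Longrightarrow> algebraic x \<Longrightarrow> g (- x) = - g x"
  using gal_diff[of g 0 x] gal_0[of g] by auto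

lemma gal_eq_0_iff: "g \<in> Gal \<Longrightarrow> algebraic x \<Longrightarrow> g x = 0 \<longleftrightarrow> x = 0"
  using gal_mult[of g x "inverse x"] gal_0[of g] gal_1[of g] by (cases "x = 0") (auto simp: algebraic_inverse)

lemma gal_inj: "g \<in> Gal \<Longrightarrow> algebraic x \<Longrightarrow> algebraic y \<Longrightarrow> g x = g y \<longleftrightarrow> x = y"
  using gal_eq_0_iff[of g "x - y"] gal_diff[of g x y] by auto

lemma gal_divide: "g \<in> Gal \<Longrightarrow> algebraic x \<Longrightarrow> algebraic y \<Longrightarrow> g (x / y) = g x / g y"
  using gal_mult[of g "x / y" y] by (cases "y = 0") (auto simp: gal_0 gal_eq_0_iff field_simps)

lemma gal_algebraic:
  assumes "g \<in> Gal" "algebraic x" shows "algebraic (g x)"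
proof -
  obtain p where p: "rat_coeffs p" "p \<noteq> 0" "poly p x = 0" using assms algebraic_altdef by blast
  then have "poly p (g x) = 0" using gal_poly[OF assms(1) p(1) assms(2)] gal_0[OF assms(1)] by simp
  then show ?thesis using p algebraic_altdef by blast
qed

lemma gal_id: "(\<lambda>x. x) \<in> Gal"
  by (simp add: Gal_def)

lemma gal_comp:
  assumes g: "g \<in> Gal" and h: "h \<in> Gal" shows "(\<lambda>x. g (h x)) \<in> Gal"
  using gal_1[OF g] gal_1[OF h] gal_add[OF g] gal_add[OF h] gal_mult[OF g] gal_mult[OF h] gal_algebraic[OF h]
  by (subst Gal_def) simp

lemma gal_funpow: "g \<in> Gal \<Longrightarrow> (g ^^ n) \<in> Gal"
proof (induction n)
  case (Suc n)
  then show ?case using gal_comp[of g "g ^^ n"] by (simp add: comp_def)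
qed (simp add: gal_id id_def)

definition orb :: "complex \<Rightarrow> complex set" where
  "orb x = (\<lambda>g. g x) ` Gal"

lemma orb_self [simp]: "x \<in> orb x"
  unfolding orb_def using gal_id by force

lemma gal_orb: "g \<in> Gal \<Longrightarrow> y \<in> orb x \<Longrightarrow> g y \<in> orb x"
  unfolding orb_def by (auto intro: image_eqI[OF _ gal_comp[of g]])

lemma orb_algebraic: "algebraic x \<Longrightarrow> y \<in> orb x \<Longrightarrow> algebraic y"
  unfolding orb_def using gal_algebraic by auto

lemma rat_poly_orb_root:
  "algebraic x \<Longrightarrow> rat_coeffs p \<Longrightarrow> poly p x = 0 \<Longrightarrow> y \<in> orb x \<Longrightarrow> poly p y = 0"
  unfolding orb_def using gal_poly[of _ p x] gal_0 by auto

lemma finite_orb: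
  assumes "algebraic x" shows "finite (orb x)"
proof -
  obtain p where p: "rat_coeffs p" "p \<noteq> 0" "poly p x = 0" using assms algebraic_altdef by blast
  have "orb x \<subseteq> {y. poly p y = 0}" using rat_poly_orb_root[OF assms p(1,3)] by auto
  then show ?thesis using poly_roots_finite[OF p(2)] finite_subset by blast
qed

lemma card_orb_pos: "algebraic x \<Longrightarrow> card (orb x) > 0"
  using finite_orb orb_self by (metis card_gt_0_iff empty_iff)

lemma gal_bij_orb:
  assumes "algebraic x" "g \<in> Gal"
  shows "bij_betw g (orb x) (orb x)"
proof -
  have "inj_on g (orb x)" using gal_inj[OF assms(2)] orb_algebraic[OF assms(1)] by (auto simp: inj_on_def)
  moreover have "g ` orb x \<subseteq> orb x" using gal_orb[OF assms(2)] by blast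
  ultimately show ?thesis using endo_inj_surj[OF finite_orb[OF assms(1)]] by (simp add: bij_betw_def)
qed

text \<open>The iterates of x stay in a finite orbit, so two of them agree, and injectivity cancels
  the common part. An iterate of g thus undoes g at x, which makes conjugacy symmetric.\<close>

lemma gal_periodic:
  assumes x: "algebraic x" and g: "g \<in> Gal"
  obtains n where "n > 0" "(g ^^ n) x = x"
proof -
  have "\<not> inj_on (\<lambda>n. (g ^^ n) x) (UNIV :: nat set)"
  proof
    assume "inj_on (\<lambda>n. (g ^^ n) x) (UNIV :: nat set)"
    moreover have "range (\<lambda>n. (g ^^ n) x) \<subseteq> orb x" unfolding orb_def using gal_funpow[OF g] by auto
    ultimately show False using finite_orb[OF x] finite_subset finite_imageD infinite_UNIV_nat by blast
  qed
  then obtain i j where ij: "i < j" "(g ^^ i) x = (g ^^ j) x"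
    unfolding inj_on_def by (metis linorder_neqE_nat)
  then have "(g ^^ i) x = (g ^^ i) ((g ^^ (j - i)) x)"
    by (metis comp_apply funpow_add le_add_diff_inverse less_imp_le)
  then have "(g ^^ (j - i)) x = x"
    using gal_inj[OF gal_funpow[OF g] x gal_algebraic[OF gal_funpow[OF g] x]] by metis
  then show ?thesis using ij by (intro that[of "j - i"]) auto
qed

lemma orb_sym:
  assumes x: "algebraic x" and "y \<in> orb x" shows "x \<in> orb y"
proof -
  obtain g where g: "g \<in> Gal" "y = g x" using assms(2) by (auto simp: orb_def)
  obtain n where n: "n > 0" "(g ^^ n) x = x" using gal_periodic[OF x g(1)] .
  have "x = (g ^^ (n - 1)) y" using n g(2) by (metis comp_apply funpow_Suc_right Suc_pred' )
  then show ?thesis using gal_funpow[OF g(1)] by (auto simp: orb_def)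
qed

lemma orb_trans: "y \<in> orb x \<Longrightarrow> orb y \<subseteq> orb x"
  using gal_orb by (auto simp: orb_def[of y])

lemma orb_eq: "algebraic x \<Longrightarrow> y \<in> orb x \<Longrightarrow> orb y = orb x"
  using orb_trans orb_sym by blast

lemma degree_1_root_rat:
  assumes "rat_coeffs f" "degree f = 1" "poly f x = 0" shows "x \<in> \<rat>"
proof -
  obtain a p where p: "f = pCons a p" by (cases f) auto
  then have "degree p = 0" "p \<noteq> 0" using assms(2) by (auto split: if_splits)
  then obtain b where b: "p = [:b:]" using degree_eq_zeroE by blast
  then have "b \<noteq> 0" using \<open>p \<noteq> 0\<close> by auto
  have "a \<in> \<rat>" "b \<in> \<rat>" using assms(1)[rule_format, of 0] assms(1)[rule_format, of 1] p b by auto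
  moreover have "x = - a / b"
    using assms(3) p b \<open>b \<noteq> 0\<close> by (simp add: field_simps add_eq_0_iff2)
  ultimately show ?thesis by simp
qed

text \<open>The minimal polynomial P of x has degree above 1. A root y of the cofactor S differs
  from x, since a double root would be a root of the derivative, whose degree is too small. Starting
  from the identity on the rationals, x is sent to y and the embedding extended to all algebraic
  numbers.\<close>

lemma gal_moves:
  assumes x: "algebraic x" "x \<notin> \<rat>"
  obtains g where "g \<in> Gal" "g x \<noteq> x"
proof -
  define G :: "(complex \<times> complex) set" where "G = {(q, q) | q. q \<in> \<rat>}"
  have G: "emb_graph G" unfolding emb_graph_def G_def by (auto intro: rat_imp_algebraic)
  obtain P Q where PQ: "graph_pair G P Q" "lead_coeff P = 1" "lead_coeff Q = 1" "degree Q = degree P"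
    "degree P > 0" "poly P x = 0"
    and least: "\<And>P' Q'. graph_pair G P' Q' \<Longrightarrow> P' \<noteq> 0 \<Longrightarrow> poly P' x = 0 \<Longrightarrow> degree P \<le> degree P'"
    by (rule graph_min_pair[OF G x(1)]) blast
  have gp: "graph_pair G R S \<longleftrightarrow> rat_coeffs R \<and> R = S" for R S
    unfolding graph_pair_def[OF G] by (auto simp: G_def poly_eq_iff)
  have Q: "Q = P" and P: "rat_coeffs P" using PQ(1) gp by auto
  have least': "degree P \<le> degree R" if "rat_coeffs R" "R \<noteq> 0" "poly R x = 0" for R
    using least[of R R] gp that by blast
  have d1: "degree P \<noteq> 1" using degree_1_root_rat[OF P _ PQ(6)] x(2) by blast
  obtain S where S: "P = [:-x, 1:] * S" using PQ(6) by (auto simp: poly_eq_0_iff_dvd)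
  have "S \<noteq> 0" using S PQ(5) by auto
  then have "degree P = Suc (degree S)" unfolding S by (subst degree_mult_eq) auto
  then have "degree S \<noteq> 0" using d1 by simp
  then obtain y where y: "poly S y = 0"
    using fundamental_theorem_of_algebra[of S] by (auto simp: constant_degree)
  have "y \<noteq> x"
  proof
    assume "y = x"
    then have "poly (pderiv P) x = 0" using y unfolding S pderiv_mult by simp
    moreover have "pderiv P \<noteq> 0" using PQ(5) by (simp add: pderiv_eq_0_iff)
    ultimately have "degree P \<le> degree (pderiv P)"
      using least' rat_coeffs_pderiv[OF P] by blast
    then show False using PQ(5) by (simp add: degree_pderiv)
  qed
  have Py: "poly Q y = 0" using y by (simp add: Q S)
  have ext: "emb_graph (graph_ext G x y)" "(x,y) \<in> graph_ext G x y"
    by (rule graph_ext_emb_graph[OF G x(1) PQ(1-4,6)]; use least Py in blast)+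
  obtain g where "g \<in> Gal" "\<And>a b. (a,b) \<in> graph_ext G x y \<Longrightarrow> g a = b"
    using emb_graph_extends_to_Gal[OF ext(1)] by blast
  then show ?thesis using that ext(2) \<open>y \<noteq> x\<close> by auto
qed

lemma gal_fixed_Rats:
  assumes "algebraic z" "\<And>g. g \<in> Gal \<Longrightarrow> g z = z" shows "z \<in> \<rat>"
  using gal_moves[OF assms(1)] assms(2) by blast

lemma prod_orb_Rats:
  assumes x: "algebraic x" and alg: "\<And>y. y \<in> orb x \<Longrightarrow> algebraic (\<phi> y)"
    and equiv: "\<And>g y. g \<in> Gal \<Longrightarrow> y \<in> orb x \<Longrightarrow> g (\<phi> y) = \<phi> (g y)"
  shows "(\<Prod>y\<in>orb x. \<phi> y) \<in> \<rat>"
proof (rule gal_fixed_Rats)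
  fix g assume g: "g \<in> Gal"
  have "g (\<Prod>y\<in>orb x. \<phi> y) = (\<Prod>y\<in>orb x. \<phi> (g y))"
    using alg equiv[OF g] by (simp add: gal_prod[OF g])
  also have "\<dots> = (\<Prod>y\<in>orb x. \<phi> y)" by (rule prod.reindex_bij_betw[OF gal_bij_orb[OF x g]])
  finally show "g (\<Prod>y\<in>orb x. \<phi> y) = (\<Prod>y\<in>orb x. \<phi> y)" .
qed (use alg in auto)

text \<open>As a product over the orbit it shows its degree and roots at once; that its coefficients
  are rational is then Galois invariance, through \<open>gal_fixed_Rats\<close>.\<close>

definition min_poly :: "complex \<Rightarrow> complex poly" where
  "min_poly x = (\<Prod>y\<in>orb x. [:-y, 1:])"

lemma coeff_prod_linear:
  assumes g: "g \<in> Gal" and fin: "finite A" and alg: "\<And>y. y \<in> A \<Longrightarrow> algebraic y"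
  shows "algebraic (coeff (\<Prod>y\<in>A. [:-y, 1:]) i) \<and> g (coeff (\<Prod>y\<in>A. [:-y, 1:]) i) = coeff (\<Prod>y\<in>A. [:- g y, 1:]) i"
  using fin alg
proof (induction A arbitrary: i rule: finite_induct)
  case empty
  then show ?case using gal_0[OF g] gal_1[OF g] by (auto simp: coeff_1)
next
  case (insert a A)
  then show ?case using g gal_0[OF g]
    by (auto simp: coeff_pCons gal_add gal_minus gal_mult gal_diff split: nat.splits)
qed

lemma degree_prod_linear: "finite A \<Longrightarrow> degree (\<Prod>y\<in>A. [:- (y::complex), 1:]) = card A"
  by (subst degree_prod_eq_sum_degree) auto

lemma lead_coeff_prod_linear: "lead_coeff (\<Prod>y\<in>A. [:- (y::complex), 1:]) = 1"
  by (simp add: lead_coeff_prod)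

lemma min_poly_rat_coeffs:
  assumes x: "algebraic x" shows "rat_coeffs (min_poly x)"
proof
  fix i
  show "coeff (min_poly x) i \<in> \<rat>"
  proof (rule gal_fixed_Rats)
    show "algebraic (coeff (min_poly x) i)"
      unfolding min_poly_def using coeff_prod_linear[OF gal_id finite_orb[OF x]] orb_algebraic[OF x] by blast
    fix g assume g: "g \<in> Gal"
    have "g (coeff (min_poly x) i) = coeff (\<Prod>y\<in>orb x. [:- g y, 1:]) i"
      unfolding min_poly_def using coeff_prod_linear[OF g finite_orb[OF x]] orb_algebraic[OF x] by blast
    also have "(\<Prod>y\<in>orb x. [:- g y, 1:]) = min_poly x"
      unfolding min_poly_def by (rule prod.reindex_bij_betw[OF gal_bij_orb[OF x g], of "\<lambda>y. [:-y, 1:]"])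
    finally show "g (coeff (min_poly x) i) = coeff (min_poly x) i" .
  qed
qed

lemma degree_min_poly: "algebraic x \<Longrightarrow> degree (min_poly x) = card (orb x)"
  unfolding min_poly_def by (simp add: degree_prod_linear finite_orb)

lemma lead_coeff_min_poly: "lead_coeff (min_poly x) = 1"
  unfolding min_poly_def by (rule lead_coeff_prod_linear)

lemma min_poly_nz: "min_poly x \<noteq> 0"
  using lead_coeff_min_poly[of x] by auto

lemma min_poly_root: "algebraic x \<Longrightarrow> y \<in> orb x \<Longrightarrow> poly (min_poly x) y = 0"
  unfolding min_poly_def using finite_orb by (auto simp: poly_prod)

lemma degree_ge_card_orb:
  assumes "algebraic x" "rat_coeffs p" "p \<noteq> 0" "poly p x = 0"
  shows "card (orb x) \<le> degree p"
proof -
  have "card (orb x) \<le> card {y. poly p y = 0}"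
    using rat_poly_orb_root[OF assms(1,2,4)] poly_roots_finite[OF assms(3)] by (intro card_mono) auto
  also have "\<dots> \<le> degree p" by (rule card_poly_roots_bound[OF assms(3)])
  finally show ?thesis .
qed

section \<open>Degree and embeddings of a simple extension\<close>

lemma adjoin_eq:
  assumes x: "algebraic x" shows "adjoin x = {poly p x | p. rat_coeffs p}"
proof
  let ?K = "{poly p x | p. rat_coeffs p}"
  have mem: "poly p x \<in> ?K" if "rat_coeffs p" for p using that by blast
  have "is_subfield ?K"
    unfolding is_subfield_def
  proof (intro conjI ballI)
    show "0 \<in> ?K" "1 \<in> ?K" using mem[of 0] mem[of 1] by (auto simp: coeff_1)
  next
    fix a b assume "a \<in> ?K" "b \<in> ?K"
    then obtain p q where pq: "rat_coeffs p" "a = poly p x" "rat_coeffs q" "b = poly q x" by blast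
    show "a + b \<in> ?K" using mem[of "p + q"] pq by auto
    show "a * b \<in> ?K" using mem[of "p * q"] rat_coeffs_mult[OF pq(1,3)] pq(2,4) by auto
  next
    fix a assume "a \<in> ?K"
    then obtain p where p: "rat_coeffs p" "a = poly p x" by blast
    show "- a \<in> ?K" using mem[of "- p"] p by auto
    show "inverse a \<in> ?K"
    proof (cases "a = 0")
      case True
      then show ?thesis using mem[of 0] by auto
    next
      case False
      have "algebraic a" unfolding p(2) by (rule algebraic_rat_coeffs[OF p(1) x])
      then obtain q where q: "rat_coeffs q" "inverse a = poly q a" using inverse_eq_poly False by blast
      then show ?thesis using mem[OF rat_coeffs_pcompose[OF q(1) p(1)]] p(2) by (simp add: poly_pcompose)
    qed
  qed
  moreover have "x \<in> ?K" using mem[of "[:0,1:]"] by (auto simp: coeff_pCons split: nat.splits)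
  ultimately show "adjoin x \<subseteq> ?K" unfolding adjoin_def by blast
  show "?K \<subseteq> adjoin x" unfolding adjoin_def using subfield_poly by blast
qed

lemma subfield_adjoin: "is_subfield (adjoin x)"
  unfolding adjoin_def is_subfield_def by blast

lemma adjoin_self: "x \<in> adjoin x"
  unfolding adjoin_def by blast

text \<open>The powers of x with exponent below the number of conjugates form a basis: independent
  by \<open>degree_ge_card_orb\<close>, spanning by reduction modulo
  \<open>min_poly x\<close>.\<close>

lemma field_degree_adjoin:
  assumes x: "algebraic x" shows "field_degree (adjoin x) = card (orb x)"
proof -
  let ?D = "card (orb x)" and ?B = "(\<lambda>i. x ^ i) ` {..<card (orb x)}"
  have "\<not> (\<not> inj_on (\<lambda>i. x ^ i) {..<?D} \<or> rat_complex.dependent ?B)"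
  proof
    assume "\<not> inj_on (\<lambda>i. x ^ i) {..<?D} \<or> rat_complex.dependent ?B"
    then obtain P where "rat_coeffs P" "P \<noteq> 0" "poly P x = 0" "degree P < ?D"
      by (rule rat_poly_of_dependent_powers)
    then show False using degree_ge_card_orb[OF x, of P] by simp
  qed
  then have inj: "inj_on (\<lambda>i. x ^ i) {..<?D}" and "rat_complex.independent ?B" by blast+
  note \<open>rat_complex.independent ?B\<close>
  moreover have "?B \<subseteq> adjoin x" using subfield_power[OF subfield_adjoin adjoin_self] by auto
  moreover have "adjoin x \<subseteq> rat_complex.span ?B"
  proof
    fix a assume "a \<in> adjoin x"
    then obtain p where p: "rat_coeffs p" "a = poly p x" using adjoin_eq[OF x] by blast
    have "x ^ n \<in> rat_complex.span ?B" for n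
      using powers_in_span[OF min_poly_rat_coeffs[OF x] min_poly_nz min_poly_root[OF x orb_self]]
      by (simp add: degree_min_poly[OF x])
    then show "a \<in> rat_complex.span ?B" unfolding p(2) by (rule poly_in_span_powers[OF p(1)])
  qed
  ultimately have "rat_complex.dim (adjoin x) = ?D"
    using card_image[OF inj] by (intro rat_complex.dim_unique[of ?B]) auto
  then show ?thesis by (simp add: field_degree_def)
qed

lemma embedding_extends_to_Gal:
  assumes x: "algebraic x" and s: "\<sigma> \<in> embeddings (adjoin x)"
  shows "\<exists>g\<in>Gal. \<forall>a\<in>adjoin x. \<sigma> a = g a"
proof -
  let ?K = "adjoin x"
  have hom: "\<sigma> 1 = 1" "\<And>x y. x \<in> ?K \<Longrightarrow> y \<in> ?K \<Longrightarrow> \<sigma> (x + y) = \<sigma> x + \<sigma> y \<and> \<sigma> (x * y) = \<sigma> x * \<sigma> y"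
    using s unfolding embeddings_def by auto
  have rat: "\<sigma> q = q" if "q \<in> \<rat>" for q by (rule hom_Rats[OF subfield_adjoin hom that])
  define G where "G = {(a, \<sigma> a) | a. a \<in> ?K}"
  have "emb_graph G"
    unfolding emb_graph_def
  proof (intro conjI allI impI ballI)
    fix q :: complex assume q: "q \<in> \<rat>"
    then show "(q, q) \<in> G" unfolding G_def using rat[OF q] subfield_Rats[OF subfield_adjoin q, of x] by auto
  next
    fix a b a' b' assume "(a,b) \<in> G" "(a',b') \<in> G"
    then have *: "a \<in> ?K" "a' \<in> ?K" "b = \<sigma> a" "b' = \<sigma> a'" by (auto simp: G_def)
    show "(a + a', b + b') \<in> G" "(a * a', b * b') \<in> G"
      unfolding G_def * using hom(2)[OF *(1,2)] subfield_add[OF subfield_adjoin *(1,2)] subfield_mult[OF subfield_adjoin *(1,2)] by auto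
  next
    fix a b assume "(a,b) \<in> G"
    then show "algebraic a" using adjoin_eq[OF x] algebraic_rat_coeffs x by (auto simp: G_def)
  next
    fix b assume "(0,b) \<in> G"
    then show "b = 0" using rat[of 0] by (auto simp: G_def)
  qed
  then obtain g where "g \<in> Gal" "\<And>a b. (a,b) \<in> G \<Longrightarrow> g a = b" using emb_graph_extends_to_Gal by blast
  then show ?thesis by (intro bexI[of _ g]) (auto simp: G_def)
qed

text \<open>An embedding is determined by the image of x and comes from an element of
  \<open>Gal\<close>, so evaluation at x is a bijection from the embeddings onto the orbit.\<close>

lemma sum_embeddings:
  assumes x: "algebraic x"
  shows "(\<Sum>\<sigma>\<in>embeddings (adjoin x). F (\<sigma> x)) = (\<Sum>y\<in>orb x. F y)"
proof (rule sum.reindex_bij_betw)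
  show "bij_betw (\<lambda>\<sigma>. \<sigma> x) (embeddings (adjoin x)) (orb x)"
  proof (rule bij_betw_imageI)
    show "inj_on (\<lambda>\<sigma>. \<sigma> x) (embeddings (adjoin x))"
    proof (rule inj_onI)
      fix \<sigma> \<tau> assume st: "\<sigma> \<in> embeddings (adjoin x)" "\<tau> \<in> embeddings (adjoin x)" "\<sigma> x = \<tau> x"
      obtain g where g: "g \<in> Gal" "\<And>a. a \<in> adjoin x \<Longrightarrow> \<sigma> a = g a" using embedding_extends_to_Gal[OF x st(1)] by blast
      obtain h where h: "h \<in> Gal" "\<And>a. a \<in> adjoin x \<Longrightarrow> \<tau> a = h a" using embedding_extends_to_Gal[OF x st(2)] by blast
      have gh: "g x = h x" using st(3) g(2)[OF adjoin_self] h(2)[OF adjoin_self] by simp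
      have "\<sigma> a = \<tau> a" if a: "a \<in> adjoin x" for a
      proof -
        obtain p where p: "rat_coeffs p" "a = poly p x" using a adjoin_eq[OF x] by blast
        show ?thesis using g(2)[OF a] h(2)[OF a] gal_poly[OF g(1) p(1) x] gal_poly[OF h(1) p(1) x] gh p(2) by simp
      qed
      moreover have "\<sigma> \<in> extensional (adjoin x)" "\<tau> \<in> extensional (adjoin x)" using st by (auto simp: embeddings_def)
      ultimately show "\<sigma> = \<tau>" by (intro extensionalityI)
    qed
    show "(\<lambda>\<sigma>. \<sigma> x) ` embeddings (adjoin x) = orb x"
    proof
      show "(\<lambda>\<sigma>. \<sigma> x) ` embeddings (adjoin x) \<subseteq> orb x"
      proof
        fix y assume "y \<in> (\<lambda>\<sigma>. \<sigma> x) ` embeddings (adjoin x)"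
        then obtain \<sigma> where s: "\<sigma> \<in> embeddings (adjoin x)" "y = \<sigma> x" by blast
        obtain g where g: "g \<in> Gal" "\<And>a. a \<in> adjoin x \<Longrightarrow> \<sigma> a = g a" using embedding_extends_to_Gal[OF x s(1)] by blast
        then show "y \<in> orb x" using g(2)[OF adjoin_self] s(2) by (auto simp: orb_def)
      qed
      show "orb x \<subseteq> (\<lambda>\<sigma>. \<sigma> x) ` embeddings (adjoin x)"
      proof
        fix y assume "y \<in> orb x"
        then obtain g where g: "g \<in> Gal" "y = g x" by (auto simp: orb_def)
        have alg: "algebraic a" if "a \<in> adjoin x" for a
          using that adjoin_eq[OF x] algebraic_rat_coeffs x by auto
        have "restrict g (adjoin x) \<in> embeddings (adjoin x)"
          unfolding embeddings_def
          using subfield_1[OF subfield_adjoin, of x] g(1) alg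
          by (auto simp: gal_1 gal_add gal_mult subfield_add[OF subfield_adjoin] subfield_mult[OF subfield_adjoin])
        then show "y \<in> (\<lambda>\<sigma>. \<sigma> x) ` embeddings (adjoin x)" 
          using g(2) adjoin_self[of x] by (intro image_eqI[of _ _ "restrict g (adjoin x)"]) auto
      qed
    qed
  qed
qed

section \<open>Averages over conjugates\<close>

definition conj_avg :: "(complex \<Rightarrow> real) \<Rightarrow> complex \<Rightarrow> real" where
  "conj_avg F x = (\<Sum>y\<in>orb x. F y) / card (orb x)"

text \<open>The orbits of x, y and x * y can have different sizes. The joint orbit maps onto each of
  them, and there the averages can be compared term by term.\<close>

definition orb2 :: "complex \<Rightarrow> complex \<Rightarrow> (complex \<times> complex) set" where
  "orb2 x y = (\<lambda>g. (g x, g y)) ` Gal"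

lemma finite_orb2:
  assumes "algebraic x" "algebraic y" shows "finite (orb2 x y)"
proof (rule finite_subset)
  show "orb2 x y \<subseteq> orb x \<times> orb y" unfolding orb2_def orb_def by auto
qed (use assms finite_orb in auto)

text \<open>\<open>Gal\<close> carries any fibre of \<pi> over the orbit of z injectively into any
  other, so all fibres have the same size and the two averages agree.\<close>

lemma conj_avg_orb2:
  assumes x: "algebraic x" and y: "algebraic y" and z: "algebraic z"
    and equiv: "\<And>g. g \<in> Gal \<Longrightarrow> \<pi> (g x, g y) = g z"
  shows "conj_avg F z = (\<Sum>s\<in>orb2 x y. F (\<pi> s)) / card (orb2 x y)"
proof -
  define fib where "fib w = {s \<in> orb2 x y. \<pi> s = w}" for w
  have fin: "finite (fib w)" for w unfolding fib_def using finite_orb2[OF x y] by simp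
  have img: "\<pi> ` orb2 x y = orb z"
    unfolding orb2_def orb_def image_image using equiv by auto
  have le: "card (fib w) \<le> card (fib (g w))" if g: "g \<in> Gal" for g w
  proof (rule card_inj_on_le[OF _ _ fin])
    have comp: "(g (fst s), g (snd s)) \<in> orb2 x y \<and> \<pi> (g (fst s), g (snd s)) = g (\<pi> s)" if s: "s \<in> orb2 x y" for s
    proof -
      obtain h where h: "h \<in> Gal" "s = (h x, h y)" using s by (auto simp: orb2_def)
      have "(g (fst s), g (snd s)) \<in> orb2 x y"
        unfolding orb2_def by (rule image_eqI[of _ _ "\<lambda>u. g (h u)"]) (use h gal_comp[OF g h(1)] in auto)
      moreover have "\<pi> (g (fst s), g (snd s)) = g (\<pi> s)"
        using equiv[OF gal_comp[OF g h(1)]] equiv[OF h(1)] h(2) by simp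
      ultimately show ?thesis by blast
    qed
    show "(\<lambda>s. (g (fst s), g (snd s))) ` fib w \<subseteq> fib (g w)"
      unfolding fib_def using comp by auto
    have alg: "algebraic (fst s)" "algebraic (snd s)" if "s \<in> fib w" for s
      using that x y gal_algebraic by (auto simp: fib_def orb2_def)
    show "inj_on (\<lambda>s. (g (fst s), g (snd s))) (fib w)"
      using gal_inj[OF g] alg by (auto simp: inj_on_def prod_eq_iff)
  qed
  have eq: "card (fib w) = card (fib z)" if wz: "w \<in> orb z" for w
  proof -
    obtain g where g: "g \<in> Gal" "w = g z" using wz by (auto simp: orb_def)
    obtain h where h: "h \<in> Gal" "z = h w" using orb_sym[OF z wz] unfolding orb_def by blast
    show ?thesis using le[OF g(1), of z, folded g(2)] le[OF h(1), of w, folded h(2)] by simp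
  qed
  have sum: "(\<Sum>s\<in>orb2 x y. G (\<pi> s)) = real (card (fib z)) * (\<Sum>w\<in>orb z. G w)" for G :: "complex \<Rightarrow> real"
  proof -
    have "(\<Sum>s\<in>orb2 x y. G (\<pi> s)) = (\<Sum>w\<in>orb z. \<Sum>s\<in>fib w. G (\<pi> s))"
      using sum.image_gen[OF finite_orb2[OF x y], of "\<lambda>s. G (\<pi> s)" \<pi>] img by (simp add: fib_def)
    also have "\<dots> = (\<Sum>w\<in>orb z. real (card (fib z)) * G w)"
    proof (rule sum.cong[OF refl])
      fix w assume w: "w \<in> orb z"
      have "(\<Sum>s\<in>fib w. G (\<pi> s)) = (\<Sum>s\<in>fib w. G w)" by (rule sum.cong) (auto simp: fib_def)
      then show "(\<Sum>s\<in>fib w. G (\<pi> s)) = real (card (fib z)) * G w" by (simp add: eq[OF w])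
    qed
    finally show ?thesis by (simp add: sum_distrib_left)
  qed
  have "card (orb2 x y) = real (card (fib z)) * card (orb z)" using sum[of "\<lambda>_. 1"] by simp
  moreover have "card (orb2 x y) > 0" using finite_orb2[OF x y] gal_id by (auto simp: card_gt_0_iff orb2_def)
  ultimately show ?thesis unfolding conj_avg_def sum using card_orb_pos[OF z] by (auto simp: field_simps)
qed

lemma conj_avg_mult_le:
  assumes x: "algebraic x" and y: "algebraic y"
    and F: "\<And>a b. a \<in> orb x \<Longrightarrow> b \<in> orb y \<Longrightarrow> F (a * b) \<le> F a + F b"
  shows "conj_avg F (x * y) \<le> conj_avg F x + conj_avg F y"
proof -
  have "conj_avg F (x * y) = (\<Sum>s\<in>orb2 x y. F (fst s * snd s)) / card (orb2 x y)"
    by (rule conj_avg_orb2) (use x y in \<open>auto simp: gal_mult\<close>)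
  moreover have "conj_avg F x = (\<Sum>s\<in>orb2 x y. F (fst s)) / card (orb2 x y)"
    by (rule conj_avg_orb2) (use x y in auto)
  moreover have "conj_avg F y = (\<Sum>s\<in>orb2 x y. F (snd s)) / card (orb2 x y)"
    by (rule conj_avg_orb2) (use x y in auto)
  moreover have "(\<Sum>s\<in>orb2 x y. F (fst s * snd s)) \<le> (\<Sum>s\<in>orb2 x y. F (fst s) + F (snd s))"
    by (intro sum_mono F) (auto simp: orb2_def orb_def)
  ultimately show ?thesis
    by (simp add: add_divide_distrib[symmetric] sum.distrib divide_right_mono)
qed

lemma conj_avg_power:
  assumes x: "algebraic x" and F: "\<And>a. a \<in> orb x \<Longrightarrow> F (a ^ n) = real n * F a"
  shows "conj_avg F (x ^ n) = real n * conj_avg F x"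
proof -
  have "conj_avg F (x ^ n) = (\<Sum>s\<in>orb2 x x. F (fst s ^ n)) / card (orb2 x x)"
    by (rule conj_avg_orb2) (use x in \<open>auto simp: gal_power\<close>)
  moreover have "conj_avg F x = (\<Sum>s\<in>orb2 x x. F (fst s)) / card (orb2 x x)"
    by (rule conj_avg_orb2) (use x in auto)
  moreover have "(\<Sum>s\<in>orb2 x x. F (fst s ^ n)) = (\<Sum>s\<in>orb2 x x. real n * F (fst s))"
    by (intro sum.cong F refl) (auto simp: orb2_def orb_def)
  ultimately show ?thesis by (simp add: sum_distrib_left)
qed

lemma card_orb_mult_le:
  assumes "algebraic x" "algebraic y" shows "card (orb (x * y)) \<le> card (orb x) * card (orb y)"
proof -
  have "orb (x * y) \<subseteq> (\<lambda>(a,b). a * b) ` (orb x \<times> orb y)"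
  proof
    fix w assume "w \<in> orb (x * y)"
    then obtain g where "g \<in> Gal" "w = g x * g y" using assms by (auto simp: orb_def gal_mult)
    then show "w \<in> (\<lambda>(a,b). a * b) ` (orb x \<times> orb y)"
      by (intro image_eqI[of _ _ "(g x, g y)"]) (auto simp: orb_def)
  qed
  then show ?thesis
    using surj_card_le[of "orb x \<times> orb y"] finite_orb assms by (simp add: card_cartesian_product)
qed

lemma card_orb_power_le:
  assumes "algebraic x" shows "card (orb (x ^ n)) \<le> card (orb x)"
proof -
  have "orb (x ^ n) \<subseteq> (\<lambda>a. a ^ n) ` orb x"
    using assms by (auto simp: orb_def gal_power)
  then show ?thesis using surj_card_le finite_orb assms by blast
qed

lemma card_orb_inverse_le:
  assumes "algebraic x" shows "card (orb (inverse x)) \<le> card (orb x)"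
proof -
  have "orb (inverse x) \<subseteq> inverse ` orb x"
  proof
    fix w assume "w \<in> orb (inverse x)"
    then obtain g where g: "g \<in> Gal" "w = g (1 / x)"
      by (auto simp: orb_def inverse_eq_divide)
    then have "w = inverse (g x)"
      using assms gal_divide[OF g(1), of 1 x] gal_1[OF g(1)] by (simp add: inverse_eq_divide)
    with g(1) show "w \<in> inverse ` orb x" by (auto simp: orb_def)
  qed
  then show ?thesis using surj_card_le finite_orb assms by blast
qed

section \<open>The \<open>p\<close>-adic absolute value of a rational number\<close>

text \<open>\<open>padic_abs\<close> reads its exponent off the fraction in lowest terms;
  cross-multiplication shows that every representing fraction gives the same exponent.\<close>

lemma padic_abs_divide:
  assumes p: "prime p" and ab: "a \<noteq> 0" "b \<noteq> 0"
  shows "padic_abs p (of_int a / of_int b) = real p powi (int (multiplicity (int p) b) - int (multiplicity (int p) a))"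
proof -
  define q :: rat where "q = of_int a / of_int b"
  obtain c d where cd: "quotient_of q = (c, d)" by (cases "quotient_of q")
  have d: "d > 0" using quotient_of_denom_pos[OF cd] .
  have q: "q = of_int c / of_int d" using quotient_of_div[OF cd] .
  have "q \<noteq> 0" using ab by (simp add: q_def)
  then have c: "c \<noteq> 0" using q by auto
  have "(of_int (a * d) :: rat) = of_int (c * b)"
    using q ab d unfolding q_def by (simp add: field_simps)
  then have "a * d = c * b" by (simp only: of_int_eq_iff)
  then have "multiplicity (int p) a + multiplicity (int p) d = multiplicity (int p) c + multiplicity (int p) b"
    using p ab c d by (metis prime_elem_multiplicity_mult_distrib prime_imp_prime_elem prime_nat_int_transfer less_irrefl)
  then have "int (multiplicity (int p) d) - int (multiplicity (int p) c) = int (multiplicity (int p) b) - int (multiplicity (int p) a)"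
    by linarith
  then show ?thesis using \<open>q \<noteq> 0\<close> by (simp add: padic_abs_def cd q_def[symmetric])
qed

lemma padic_abs_of_int:
  assumes "prime p" "a \<noteq> 0"
  shows "padic_abs p (of_int a) = real p powi (- int (multiplicity (int p) a))"
  using padic_abs_divide[OF assms, of 1] by simp

lemma padic_abs_of_int_le: "prime p \<Longrightarrow> padic_abs p (of_int a) \<le> 1"
  by (cases "a = 0")
     (auto simp: padic_abs_of_int power_int_minus inverse_eq_divide field_simps prime_gt_0_nat padic_abs_def
        intro: one_le_power dest: prime_ge_1_nat)

text \<open>The exponent is an integer, so no value lies strictly between 1 and p. This gap is the
  source of \<open>ln 2\<close> in \<open>weil_height_not_integral\<close>; the divisibility of the
  denominator serves \<open>finite_bad_primes\<close>.\<close>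

lemma padic_abs_gt_1:
  assumes p: "prime p" and "padic_abs p q > 1"
  shows "padic_abs p q \<ge> p" "p dvd nat (snd (quotient_of q))"
proof -
  obtain a b where ab: "quotient_of q = (a, b)" by (cases "quotient_of q")
  have b: "b > 0" using quotient_of_denom_pos[OF ab] .
  have q: "q \<noteq> 0" using assms by (auto simp: padic_abs_def)
  define k where "k = int (multiplicity (int p) b) - int (multiplicity (int p) a)"
  have v: "padic_abs p q = real p powi k" using q by (simp add: padic_abs_def ab k_def)
  have p1: "real p > 1" using prime_gt_1_nat[OF p] by simp
  have k: "k \<ge> 1"
  proof (rule ccontr)
    assume "\<not> k \<ge> 1"
    then have "real p powi k \<le> real p powi 0" using p1 by (intro power_int_increasing) auto
    then show False using assms(2) v by simp
  qed
  then have "real p powi 1 \<le> real p powi k" using p1 by (intro power_int_increasing) auto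
  then show "padic_abs p q \<ge> p" using v by simp
  have "multiplicity (int p) b > 0" using k by (simp add: k_def)
  then have "int p dvd b" by (metis dvd_0_right multiplicity_eq_zero_iff not_dvd_imp_multiplicity_0 neq0_conv)
  then have "nat (int p) dvd nat b" using b by (subst nat_dvd_iff) auto
  then show "p dvd nat (snd (quotient_of q))" by (simp add: ab)
qed

lemma padic_abs_le_1_imp_Ints:
  assumes "\<And>p. prime p \<Longrightarrow> padic_abs p q \<le> 1" shows "q \<in> \<int>"
proof -
  obtain a b where ab: "quotient_of q = (a, b)" by (cases "quotient_of q")
  have b: "b > 0" and cop: "coprime a b" and q: "q = of_int a / of_int b"
    using quotient_of_denom_pos[OF ab] quotient_of_coprime[OF ab] quotient_of_div[OF ab] by auto
  have "b = 1"
  proof (rule ccontr)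
    assume "b \<noteq> 1"
    then have "nat b \<noteq> 1" using b by simp
    then obtain r where r: "prime r" "r dvd nat b" using prime_factor_nat by blast
    then have rb: "int r dvd b" using b by (metis int_dvd_int_iff int_nat_eq less_imp_le)
    have "\<not> int r dvd a"
      using cop rb r(1) by (metis coprime_common_divisor not_prime_unit prime_nat_int_transfer)
    then have ma: "multiplicity (int r) a = 0" by (rule not_dvd_imp_multiplicity_0)
    have mb: "multiplicity (int r) b > 0"
      using rb b r(1) by (metis less_irrefl multiplicity_gt_zero_iff not_prime_unit prime_nat_int_transfer)
    have "a \<noteq> 0" using \<open>\<not> int r dvd a\<close> by auto
    then have "padic_abs r q = real r powi int (multiplicity (int r) b)"
      using padic_abs_divide[OF r(1), of a b] b ma q by simp
    moreover have "real r ^ multiplicity (int r) b > 1"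
      using mb prime_gt_1_nat[OF r(1)] by (intro one_less_power) auto
    ultimately show False using assms[OF r(1)] by (simp)
  qed
  then show ?thesis using q by simp
qed

section \<open>Existence of extensions to the algebraic numbers\<close>

text \<open>The valuation ring is a subring of the algebraic numbers that is maximal among those not
  containing the inverse of \<open>p\<close>.\<close>

definition alg_ring :: "complex set \<Rightarrow> bool" where
  "alg_ring R \<longleftrightarrow> 1 \<in> R \<and> - 1 \<in> R \<and> (\<forall>x\<in>R. \<forall>y\<in>R. x + y \<in> R \<and> x * y \<in> R) \<and> (\<forall>x\<in>R. algebraic x)"

lemma alg_ring_1: "alg_ring R \<Longrightarrow> 1 \<in> R"
  and alg_ring_add: "alg_ring R \<Longrightarrow> x \<in> R \<Longrightarrow> y \<in> R \<Longrightarrow> x + y \<in> R"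
  and alg_ring_mult: "alg_ring R \<Longrightarrow> x \<in> R \<Longrightarrow> y \<in> R \<Longrightarrow> x * y \<in> R"
  and alg_ring_algebraic: "alg_ring R \<Longrightarrow> x \<in> R \<Longrightarrow> algebraic x"
  unfolding alg_ring_def by blast+

lemma alg_ring_uminus: "alg_ring R \<Longrightarrow> x \<in> R \<Longrightarrow> - x \<in> R"
  using alg_ring_mult[of R "-1" x] by (simp add: alg_ring_def)

lemma alg_ring_0: "alg_ring R \<Longrightarrow> 0 \<in> R"
  using alg_ring_add[of R 1 "-1"] by (simp add: alg_ring_def)

lemma alg_ring_diff: "alg_ring R \<Longrightarrow> x \<in> R \<Longrightarrow> y \<in> R \<Longrightarrow> x - y \<in> R"
  using alg_ring_add[of R x "-y"] alg_ring_uminus[of R y] by simp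

lemma alg_ring_of_nat: "alg_ring R \<Longrightarrow> of_nat n \<in> R"
  by (induction n) (auto intro: alg_ring_0 alg_ring_1 alg_ring_add)

lemma alg_ring_of_int: "alg_ring R \<Longrightarrow> of_int n \<in> R"
  by (cases n) (auto intro: alg_ring_of_nat alg_ring_uminus simp del: of_nat_Suc)

lemma alg_ring_sum: "alg_ring R \<Longrightarrow> (\<And>i. i \<in> A \<Longrightarrow> f i \<in> R) \<Longrightarrow> sum f A \<in> R"
  by (induction A rule: infinite_finite_induct) (auto intro: alg_ring_0 alg_ring_add)

lemma alg_ring_power: "alg_ring R \<Longrightarrow> x \<in> R \<Longrightarrow> x ^ n \<in> R"
  by (induction n) (auto intro: alg_ring_1 alg_ring_mult)

lemma alg_ring_adjoin:
  assumes R: "alg_ring R" and x: "algebraic x"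
  defines "S \<equiv> {poly P x | P. \<forall>i. coeff P i \<in> R}"
  shows "alg_ring S" "R \<subseteq> S" "x \<in> S"
proof -
  have mem: "poly P x \<in> S" if "\<forall>i. coeff P i \<in> R" for P using that unfolding S_def by blast
  have const: "c \<in> S" if "c \<in> R" for c
    using mem[of "[:c:]"] that alg_ring_0[OF R] by (auto simp: coeff_pCons split: nat.splits)
  show "R \<subseteq> S" using const by blast
  show "x \<in> S" using mem[of "[:0,1:]"] alg_ring_0[OF R] alg_ring_1[OF R]
    by (auto simp: coeff_pCons split: nat.splits)
  show "alg_ring S"
    unfolding alg_ring_def
  proof (intro conjI ballI)
    show "1 \<in> S" "- 1 \<in> S" using const alg_ring_1[OF R] alg_ring_uminus[OF R] by auto
    fix a b assume "a \<in> S" "b \<in> S"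
    then obtain P Q where PQ: "a = poly P x" "b = poly Q x" "\<forall>i. coeff P i \<in> R" "\<forall>i. coeff Q i \<in> R"
      unfolding S_def by blast
    show "a + b \<in> S" using mem[of "P + Q"] PQ alg_ring_add[OF R] by auto
    have "\<forall>i. coeff (P * Q) i \<in> R"
      unfolding coeff_mult using PQ by (auto intro!: alg_ring_sum[OF R] alg_ring_mult[OF R])
    then show "a * b \<in> S" using mem[of "P * Q"] PQ by auto
  next
    fix a assume "a \<in> S"
    then obtain P where P: "a = poly P x" "\<forall>i. coeff P i \<in> R" unfolding S_def by blast
    show "algebraic a" unfolding P(1) by (rule algebraic_poly) (use P(2) alg_ring_algebraic[OF R] x in auto)
  qed
qed

lemma exists_maximal_alg_ring:
  assumes p: "prime (p::nat)"
  obtains R where "alg_ring R" "1 / of_nat p \<notin> R"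
    "\<And>S. alg_ring S \<Longrightarrow> R \<subseteq> S \<Longrightarrow> 1 / of_nat p \<notin> S \<Longrightarrow> S = R"
proof -
  let ?A = "{R. alg_ring R \<and> 1 / of_nat p \<notin> R}"
  have "\<exists>M\<in>?A. \<forall>X\<in>?A. M \<subseteq> X \<longrightarrow> X = M"
  proof (rule subset_Zorn_nonempty)
    have "(1 / of_nat p :: complex) \<notin> \<int>"
    proof
      assume "(1 / of_nat p :: complex) \<in> \<int>"
      then obtain k where k: "(1 / of_nat p :: complex) = of_int k" by (rule Ints_cases)
      then have "(1::complex) = of_int (k * int p)" using prime_gt_0_nat[OF p] by (simp add: field_simps)
      then have "k * int p = 1" by (metis of_int_1 of_int_eq_iff)
      then have "int p dvd 1" by (metis dvd_triv_right)
      then show False using p by simp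
    qed
    moreover have "alg_ring \<int>" unfolding alg_ring_def by (auto elim!: Ints_cases)
    ultimately show "?A \<noteq> {}" by blast
    fix C assume C: "C \<noteq> {}" "subset.chain ?A C"
    have CA: "alg_ring H" "1 / of_nat p \<notin> H" if "H \<in> C" for H using C that by (auto simp: subset.chain_def)
    have two: "\<exists>H\<in>C. z \<in> H \<and> z' \<in> H" if zz: "z \<in> \<Union>C" "z' \<in> \<Union>C" for z z'
    proof -
      obtain H H' where H: "H \<in> C" "z \<in> H" "H' \<in> C" "z' \<in> H'" using zz by blast
      then have "H \<subseteq> H' \<or> H' \<subseteq> H" using C(2) unfolding subset_chain_def by blast
      then show ?thesis using H by blast
    qed
    obtain H0 where H0: "H0 \<in> C" using C by blast
    have "alg_ring (\<Union>C)"
      unfolding alg_ring_def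
    proof (intro conjI ballI)
      show "1 \<in> \<Union>C" "- 1 \<in> \<Union>C" using CA(1)[OF H0] H0 by (auto simp: alg_ring_def)
      fix a b assume "a \<in> \<Union>C" "b \<in> \<Union>C"
      then obtain H where H: "H \<in> C" "a \<in> H" "b \<in> H" using two by blast
      show "a + b \<in> \<Union>C" "a * b \<in> \<Union>C"
        using alg_ring_add[OF CA(1)[OF H(1)] H(2,3)] alg_ring_mult[OF CA(1)[OF H(1)] H(2,3)] H(1) by blast+
    next
      fix a assume "a \<in> \<Union>C"
      then show "algebraic a" using alg_ring_algebraic[OF CA(1)] by blast
    qed
    then show "\<Union>C \<in> ?A" using CA(2) by blast
  qed
  then obtain M where M0: "M \<in> ?A" "\<forall>X\<in>?A. M \<subseteq> X \<longrightarrow> X = M" by (rule bexE)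
  show ?thesis by (rule that[of M]) (use M0 in auto)
qed

section \<open>A maximal ring without 1/p is a valuation ring\<close>

context
  fixes p :: nat and R :: "complex set"
  assumes p: "prime p" and R: "alg_ring R" and noninv: "1 / of_nat p \<notin> R"
    and maximal: "\<And>S. alg_ring S \<Longrightarrow> R \<subseteq> S \<Longrightarrow> 1 / of_nat p \<notin> S \<Longrightarrow> S = R"
begin

lemma p_nz: "(of_nat p :: complex) \<noteq> 0"
  using prime_gt_0_nat[OF p] by simp

text \<open>If x is outside R, maximality puts 1/p into the ring generated by R and x. Writing 1/p
  as a polynomial in x gives the relation on which the descent below (Chevalley's argument)
  operates.\<close>

lemma adjoin_contains_inverse:
  assumes x: "algebraic x" "x \<notin> R"
  obtains n a where "\<And>i. a i \<in> R" "of_nat p * (\<Sum>i\<le>n. a i * x ^ i) = 1"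
proof -
  let ?S = "{poly P x | P. \<forall>i. coeff P i \<in> R}"
  have S: "alg_ring ?S" "R \<subseteq> ?S" "x \<in> ?S" by (rule alg_ring_adjoin[OF R x(1)])+
  have "1 / of_nat p \<in> ?S"
  proof (rule ccontr)
    assume "1 / of_nat p \<notin> ?S"
    then have "?S = R" by (rule maximal[OF S(1,2)])
    then show False using S(3) x(2) by simp
  qed
  then obtain P where P: "1 / of_nat p = poly P x" "\<forall>i. coeff P i \<in> R" by blast
  have "of_nat p * poly P x = 1" unfolding P(1)[symmetric] using p_nz by simp
  then show ?thesis using P(2) by (intro that[of "coeff P" "degree P"]) (auto simp: poly_altdef)
qed

text \<open>Every power of u = 1 - p b is congruent to 1 modulo p R. Were 1/u outside R, the
  relation from \<open>adjoin_contains_inverse\<close>, multiplied by u^n, would put u^n into p R,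
  hence 1 into p R, although 1/p is not in R.\<close>

lemma one_minus_p_unit:
  assumes b: "b \<in> R"
  shows "1 - of_nat p * b \<noteq> 0" "inverse (1 - of_nat p * b) \<in> R"
proof -
  define u where "u = 1 - of_nat p * b"
  have uR: "u \<in> R" unfolding u_def
    by (intro alg_ring_diff[OF R] alg_ring_1[OF R] alg_ring_mult[OF R] alg_ring_of_nat[OF R] b)
  show u0: "1 - of_nat p * b \<noteq> 0"
  proof
    assume "1 - of_nat p * b = 0"
    then have "1 / of_nat p = b" using p_nz by (simp add: field_simps)
    then show False using noninv b by simp
  qed
  have pow: "\<exists>c\<in>R. u ^ n = 1 - of_nat p * c" for n
  proof (induction n)
    case 0
    then show ?case using alg_ring_0[OF R] by (intro bexI[of _ 0]) auto
  next
    case (Suc n)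
    then obtain c where c: "c \<in> R" "u ^ n = 1 - of_nat p * c" by blast
    have "u ^ Suc n = 1 - of_nat p * (c + b * u ^ n)"
      using c(2) by (simp add: u_def algebra_simps)
    moreover have "c + b * u ^ n \<in> R"
      by (intro alg_ring_add[OF R] alg_ring_mult[OF R] alg_ring_power[OF R] c b uR)
    ultimately show ?case by blast
  qed
  show "inverse (1 - of_nat p * b) \<in> R"
  proof (rule ccontr)
    assume nin: "inverse (1 - of_nat p * b) \<notin> R"
    have "algebraic (inverse u)" using alg_ring_algebraic[OF R uR] by auto
    then obtain n a where a: "\<And>i. a i \<in> R" "of_nat p * (\<Sum>i\<le>n. a i * inverse u ^ i) = 1"
      using adjoin_contains_inverse nin unfolding u_def[symmetric] by blast
    have "u ^ n = of_nat p * (\<Sum>i\<le>n. a i * inverse u ^ i) * u ^ n" using a by simp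
    also have "\<dots> = of_nat p * (\<Sum>i\<le>n. a i * (inverse u ^ i * u ^ n))"
      by (simp add: sum_distrib_right mult.assoc)
    also have "(\<Sum>i\<le>n. a i * (inverse u ^ i * u ^ n)) = (\<Sum>i\<le>n. a i * u ^ (n - i))"
      using u0 unfolding u_def[symmetric] by (intro sum.cong) (auto simp: power_diff field_simps)
    finally have 1: "u ^ n = of_nat p * (\<Sum>i\<le>n. a i * u ^ (n - i))" .
    obtain c where c: "c \<in> R" "u ^ n = 1 - of_nat p * c" using pow by blast
    have "of_nat p * ((\<Sum>i\<le>n. a i * u ^ (n - i)) + c) = 1" using 1 c(2) by (simp add: algebra_simps)
    then have "1 / of_nat p = (\<Sum>i\<le>n. a i * u ^ (n - i)) + c" using p_nz by (simp add: field_simps)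
    also have "\<dots> \<in> R"
      by (intro alg_ring_add[OF R] alg_ring_sum[OF R] alg_ring_mult[OF R] alg_ring_power[OF R] a(1) c(1) uR)
    finally show False using noninv by simp
  qed
qed

definition rep_degree :: "complex \<Rightarrow> nat \<Rightarrow> bool" where
  "rep_degree x n \<longleftrightarrow> (\<exists>a. (\<forall>i. a i \<in> R) \<and> of_nat p * (\<Sum>i\<le>n. a i * x ^ i) = 1)"

text \<open>In the relation for 1/x the constant term is moved to the other side, where 1 - p b_0 is
  a unit. Multiplied by x^n, the relation then expresses x^n by lower powers of x, nonnegative
  because \<open>m \<le> n\<close>, and this replaces the top term of the relation for x.\<close>

lemma rep_degree_reduce:
  assumes x: "x \<noteq> 0" and n: "rep_degree x n" and m: "rep_degree (inverse x) m" and mn: "m \<le> n" "n > 0"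
  shows "rep_degree x (n - 1)"
proof -
  obtain a where a: "\<And>i. a i \<in> R" "of_nat p * (\<Sum>i\<le>n. a i * x ^ i) = 1" using n unfolding rep_degree_def by blast
  obtain b where b: "\<And>i. b i \<in> R" "of_nat p * (\<Sum>i\<le>m. b i * inverse x ^ i) = 1" using m unfolding rep_degree_def by blast
  define u where "u = inverse (1 - of_nat p * b 0)"
  have u: "u \<in> R" "u * (1 - of_nat p * b 0) = 1"
    unfolding u_def using one_minus_p_unit[OF b(1)] by auto
  define b' where "b' j = (if j \<le> m then b j else 0)" for j
  have b'R: "b' j \<in> R" for j using b(1) alg_ring_0[OF R] by (simp add: b'_def)
  have "(\<Sum>i\<le>m. b i * inverse x ^ i) = (\<Sum>i\<le>n. b' i * inverse x ^ i)"
    using mn(1) by (intro sum.mono_neutral_cong_left) (auto simp: b'_def)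
  also have "\<dots> = b 0 + (\<Sum>i=1..n. b' i * inverse x ^ i)"
    by (simp add: atMost_atLeast0 sum.atLeast_Suc_atMost b'_def)
  finally have "1 - of_nat p * b 0 = of_nat p * (\<Sum>i=1..n. b' i * inverse x ^ i)"
    using b(2) by (simp add: algebra_simps)
  then have "1 = u * (of_nat p * (\<Sum>i=1..n. b' i * inverse x ^ i))" using u(2) by simp
  then have "x ^ n = u * of_nat p * (\<Sum>i=1..n. b' i * (inverse x ^ i * x ^ n))"
    by (metis (no_types, lifting) mult.assoc mult_1 sum.cong sum_distrib_right)
  also have "(\<Sum>i=1..n. b' i * (inverse x ^ i * x ^ n)) = (\<Sum>i=1..n. b' i * x ^ (n - i))"
    using x by (intro sum.cong) (auto simp: power_diff field_simps)
  also have "\<dots> = (\<Sum>i<n. b' (n - i) * x ^ i)"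
    by (rule sum.reindex_bij_witness[of _ "\<lambda>i. n - i" "\<lambda>i. n - i"]) auto
  finally have xn: "x ^ n = (\<Sum>i<n. u * of_nat p * b' (n - i) * x ^ i)"
    by (simp add: sum_distrib_left mult.assoc)
  define c where "c i = a i + a n * (u * of_nat p * b' (n - i))" for i
  have "(\<Sum>i\<le>n. a i * x ^ i) = (\<Sum>i<n. a i * x ^ i) + a n * x ^ n"
    by (simp add: lessThan_Suc_atMost[symmetric])
  also have "\<dots> = (\<Sum>i<n. c i * x ^ i)"
    unfolding xn by (simp add: c_def sum_distrib_left sum.distrib algebra_simps)
  also have "{..<n} = {..n - 1}" using mn(2) by auto
  finally have "of_nat p * (\<Sum>i\<le>n - 1. c i * x ^ i) = 1" using a(2) by simp
  moreover have "c i \<in> R" for i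
    unfolding c_def by (intro alg_ring_add[OF R] alg_ring_mult[OF R] alg_ring_of_nat[OF R] a(1) u b'R)
  ultimately show ?thesis unfolding rep_degree_def by blast
qed

text \<open>Otherwise both x and 1/x have relations; of two with least degrees n and m,
  \<open>rep_degree_reduce\<close> would shorten the longer one.\<close>

lemma valuation_ring:
  assumes x: "algebraic x" "x \<noteq> 0"
  shows "x \<in> R \<or> inverse x \<in> R"
proof (rule ccontr)
  assume "\<not> (x \<in> R \<or> inverse x \<in> R)"
  then have nin: "x \<notin> R" "inverse x \<notin> R" by auto
  have ex: "\<exists>n. rep_degree x n" "\<exists>n. rep_degree (inverse x) n"
    using adjoin_contains_inverse[OF x(1) nin(1)] adjoin_contains_inverse[OF algebraic_inverse[OF x(1)] nin(2)]
    unfolding rep_degree_def by metis+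
  define n where "n = (LEAST n. rep_degree x n)"
  define m where "m = (LEAST n. rep_degree (inverse x) n)"
  have n: "rep_degree x n" unfolding n_def using ex(1) by (rule LeastI_ex)
  have m: "rep_degree (inverse x) m" unfolding m_def using ex(2) by (rule LeastI_ex)
  have pos: "\<not> rep_degree y 0" for y
  proof
    assume "rep_degree y 0"
    then obtain a where "\<forall>i. a i \<in> R" "of_nat p * (\<Sum>i\<le>(0::nat). a i * y ^ i) = 1" unfolding rep_degree_def by blast
    then have "a 0 \<in> R" "of_nat p * a 0 = 1" by auto
    then show False using noninv p_nz by (metis nonzero_mult_div_cancel_left)
  qed
  have np: "n > 0" "m > 0" using n m pos by (metis neq0_conv)+
  show False
  proof (cases "m \<le> n")
    case True
    have "rep_degree x (n - 1)" by (rule rep_degree_reduce[OF x(2) n m True np(1)])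
    then have "n \<le> n - 1" unfolding n_def by (rule Least_le)
    then show False using np by simp
  next
    case False
    have "rep_degree (inverse x) (m - 1)"
      by (rule rep_degree_reduce[OF _ m _ _ np(2)]) (use x n False in auto)
    then have "m \<le> m - 1" unfolding m_def by (rule Least_le)
    then show False using np by simp
  qed
qed

section \<open>The absolute value attached to the valuation ring\<close>

definition runit :: "complex \<Rightarrow> bool" where
  "runit x \<longleftrightarrow> x \<noteq> 0 \<and> x \<in> R \<and> inverse x \<in> R"

lemma runit_mult: "runit x \<Longrightarrow> runit y \<Longrightarrow> runit (x * y)"
  and runit_inverse: "runit x \<Longrightarrow> runit (inverse x)"
  and runit_1: "runit 1"
  unfolding runit_def using alg_ring_mult[OF R] alg_ring_1[OF R] by (auto simp: inverse_mult_distrib)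

lemma runit_power: "runit x \<Longrightarrow> runit (x ^ n)"
  by (induction n) (auto intro: runit_1 runit_mult)

lemma runit_divide: "runit x \<Longrightarrow> runit y \<Longrightarrow> runit (x / y)"
  unfolding divide_inverse by (intro runit_mult runit_inverse)

lemma runit_of_int:
  assumes "\<not> int p dvd a" shows "runit (of_int a)"
proof -
  have "coprime (int p) a" using p assms by (metis prime_imp_coprime prime_nat_int_transfer)
  then obtain s t where st: "s * int p + t * a = 1" using bezout_int[of "int p" a] by auto
  have "(of_int a * of_int t :: complex) = of_int (1 - int p * s)"
    unfolding of_int_mult[symmetric] of_int_eq_iff using st by (simp add: algebra_simps)
  also have "\<dots> = 1 - of_nat p * of_int s" by simp
  finally have at: "(of_int a * of_int t :: complex) = 1 - of_nat p * of_int s" .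
  note u = one_minus_p_unit[OF alg_ring_of_int[OF R, of s]]
  have "inverse (of_int a :: complex) = of_int t * inverse (of_int a * of_int t)"
    using u(1) at by (auto simp: field_simps)
  also have "\<dots> \<in> R" unfolding at by (intro alg_ring_mult[OF R] alg_ring_of_int[OF R] u(2))
  finally show ?thesis using assms alg_ring_of_int[OF R] by (auto simp: runit_def)
qed

lemma runit_int_p_power:
  assumes "a \<noteq> 0" shows "runit (of_int a * of_nat p powi (- int (multiplicity (int p) a)))"
proof -
  let ?e = "multiplicity (int p) a"
  have "\<not> is_unit (int p)" using p by auto
  then obtain c where c: "a = int p ^ ?e * c" "\<not> int p dvd c"
    using multiplicity_decompose'[of a "int p"] assms by blast
  have "of_int a * of_nat p powi (- int ?e) = (of_int c :: complex)"
    by (subst c(1)) (use p_nz in \<open>simp add: power_int_minus\<close>)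
  then show ?thesis using runit_of_int[OF c(2)] by simp
qed

lemma runit_p_power_int:
  assumes "runit (of_nat p powi k)" shows "k = 0"
proof -
  have pos: "j \<le> 0" if "inverse (of_nat p powi j) \<in> R" for j :: int
  proof (rule ccontr)
    assume "\<not> j \<le> 0"
    then have j: "j = int (nat j - 1) + 1" by simp
    have "of_nat p ^ (nat j - 1) * inverse (of_nat p powi j) \<in> R"
      by (intro alg_ring_mult[OF R] alg_ring_power[OF R] alg_ring_of_nat[OF R] that)
    moreover have "of_nat p ^ (nat j - 1) * inverse (of_nat p powi j) = (1 / of_nat p :: complex)"
      by (subst j) (use p_nz in \<open>simp add: power_int_add field_simps\<close>)
    ultimately show False using noninv by simp
  qed
  have "inverse (of_nat p powi (- k)) \<in> R" "inverse (of_nat p powi k) \<in> R"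
    using assms by (auto simp: runit_def power_int_minus)
  then have "- k \<le> 0" "k \<le> 0" using pos by blast+
  then show ?thesis by simp
qed

lemma ring_max:
  assumes "finite I" "I \<noteq> {}" "\<And>i. i \<in> I \<Longrightarrow> algebraic (t i) \<and> t i \<noteq> 0"
  shows "\<exists>j\<in>I. \<forall>i\<in>I. t i / t j \<in> R"
  using assms
proof (induction I rule: finite_ne_induct)
  case (singleton x)
  then show ?case using alg_ring_1[OF R] by simp
next
  case (insert k I)
  then obtain j where j: "j \<in> I" "\<forall>i\<in>I. t i / t j \<in> R" by auto
  have nz: "t j \<noteq> 0" "t k \<noteq> 0" "algebraic (t k / t j)" using insert j by auto
  have "t k / t j \<in> R \<or> inverse (t k / t j) \<in> R" by (rule valuation_ring) (use nz in auto)
  then show ?case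
  proof
    assume "t k / t j \<in> R"
    then show ?thesis using j by auto
  next
    assume "inverse (t k / t j) \<in> R"
    then have jk: "t j / t k \<in> R" using nz by (simp add: field_simps)
    have "t i / t k \<in> R" if "i \<in> I" for i
    proof -
      have "t i / t j * (t j / t k) \<in> R" using j that jk by (intro alg_ring_mult[OF R]) auto
      then show ?thesis using nz by simp
    qed
    then show ?thesis using alg_ring_1[OF R] nz by (intro bexI[of _ k]) auto
  qed
qed

text \<open>R is a local ring: of two nonzero elements one divides the other in R, so it also
  divides their sum, and a divisor of a unit is a unit.\<close>

lemma nonunit_sum:
  assumes "finite I" "\<And>i. i \<in> I \<Longrightarrow> t i \<in> R \<and> \<not> runit (t i)"
  shows "sum t I \<in> R \<and> \<not> runit (sum t I)"
  using assms
proof (induction I rule: finite_induct)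
  case empty
  then show ?case using alg_ring_0[OF R] by (simp add: runit_def)
next
  case (insert k I)
  define y z where "y = t k" and "z = sum t I"
  have yz: "y \<in> R" "\<not> runit y" "z \<in> R" "\<not> runit z" using insert by (auto simp: y_def z_def)
  have *: "\<not> runit (y + z)" if h: "y / z \<in> R" "z \<noteq> 0" "z \<in> R" "\<not> runit z" for y z
  proof
    assume ru: "runit (y + z)"
    have "inverse z = (1 + y / z) * inverse (y + z)" using h(2) ru by (simp add: runit_def field_simps)
    also have "\<dots> \<in> R"
      using h(1) ru by (intro alg_ring_mult[OF R] alg_ring_add[OF R] alg_ring_1[OF R]) (auto simp: runit_def)
    finally show False using h by (simp add: runit_def)
  qed
  have "\<not> runit (y + z)"
  proof (cases "y = 0 \<or> z = 0")
    case True
    then show ?thesis using yz by auto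
  next
    case False
    then have "y / z \<in> R \<or> inverse (y / z) \<in> R"
      using yz alg_ring_algebraic[OF R] by (intro valuation_ring) auto
    then show ?thesis using *[of y z] *[of z y] False yz by (auto simp: add.commute)
  qed
  then show ?case using insert yz alg_ring_add[OF R] by (simp add: y_def z_def)
qed

text \<open>The Newton polygon argument. In an integer relation for x the largest term t_j is
  cancelled by the rest, and since nonunits are closed under addition, some other t_i / t_j is a
  unit. Up to units its coefficients are powers of p, which leaves a power of x times a power of
  p.\<close>

lemma exists_runit_power:
  assumes x: "algebraic x" "x \<noteq> 0"
  obtains n k where "n > (0::nat)" "runit (x ^ n * of_nat p powi k)"
proof -
  obtain P :: "int poly" where P: "P \<noteq> 0" "poly (map_poly of_int P) x = 0" using algebraicE'[OF x(1)] .
  define t where "t i = (of_int (coeff P i) * x ^ i :: complex)" for i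
  define I where "I = {i. i \<le> degree P \<and> coeff P i \<noteq> 0}"
  have fin: "finite I" "I \<noteq> {}" using P(1) by (auto simp: I_def intro!: exI[of _ "degree P"])
  have t: "algebraic (t i)" "t i \<noteq> 0" if "i \<in> I" for i using that x by (auto simp: t_def I_def)
  obtain j where j: "j \<in> I" "\<forall>i\<in>I. t i / t j \<in> R" using ring_max[OF fin] t by metis
  have "0 = (\<Sum>i\<le>degree P. t i)"
    using P(2) by (simp add: poly_altdef t_def coeff_map_poly degree_map_poly)
  also have "\<dots> = (\<Sum>i\<in>I. t i)"
    by (rule sum.mono_neutral_right) (auto simp: I_def t_def)
  also have "\<dots> = t j + (\<Sum>i\<in>I - {j}. t i)" using fin j by (simp add: sum.remove)
  finally have "(\<Sum>i\<in>I - {j}. t i / t j) = - 1"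
    using t(2)[OF j(1)] by (simp add: sum_divide_distrib[symmetric] field_simps add_eq_0_iff)
  moreover have "runit (- 1)" using alg_ring_1[OF R] alg_ring_uminus[OF R] by (auto simp: runit_def)
  ultimately have "\<exists>i\<in>I - {j}. runit (t i / t j)"
    using nonunit_sum[of "I - {j}" "\<lambda>i. t i / t j"] fin j by force
  then obtain i where i: "i \<in> I" "i \<noteq> j" "runit (t i / t j)" by blast
  have main: "\<exists>k. runit (x ^ (i - j) * of_nat p powi k)" if h: "i \<in> I" "j \<in> I" "j < i" "runit (t i / t j)" for i j
  proof -
    define a b where "a = coeff P i" and "b = coeff P j"
    have nz: "a \<noteq> 0" "b \<noteq> 0" using h by (auto simp: a_def b_def I_def)
    define ea eb where "ea = int (multiplicity (int p) a)" and "eb = int (multiplicity (int p) b)"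
    have U: "runit ((of_int b * of_nat p powi (- eb)) / (of_int a * of_nat p powi (- ea)))"
      unfolding ea_def eb_def by (intro runit_divide runit_int_p_power nz)
    have "t i / t j * ((of_int b * of_nat p powi (- eb)) / (of_int a * of_nat p powi (- ea)))
      = x ^ (i - j) * of_nat p powi (ea - eb)"
      using h(3) nz x(2) p_nz unfolding t_def a_def[symmetric] b_def[symmetric]
      by (simp add: power_diff power_int_diff power_int_minus field_simps)
    then show ?thesis using runit_mult[OF h(4) U] by auto
  qed
  show ?thesis
  proof (cases "j < i")
    case True
    then show ?thesis using main[OF i(1) j(1) True i(3)] that[of "i - j"] by auto
  next
    case False
    then have ij: "i < j" using i by simp
    have "runit (t j / t i)" using runit_inverse[OF i(3)] by simp
    then show ?thesis using main[OF j(1) i(1) ij] that[of "j - i"] ij by auto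
  qed
qed

lemma power_powi: "(x ^ n * of_nat p powi k) ^ m = x ^ (n * m) * (of_nat p :: complex) powi (k * int m)"
  by (simp add: power_mult_distrib power_mult power_int_mult)

lemma runit_exponent_unique:
  assumes "n > (0::nat)" "m > (0::nat)" "runit (x ^ n * of_nat p powi k)" "runit (x ^ m * of_nat p powi l)"
  shows "real_of_int k / real n = real_of_int l / real m"
proof -
  have x: "x \<noteq> 0" using assms(1,3) by (auto simp: runit_def zero_power)
  have "runit ((x ^ n * of_nat p powi k) ^ m / (x ^ m * of_nat p powi l) ^ n)"
    by (intro runit_divide runit_power assms)
  also have "(x ^ n * of_nat p powi k) ^ m / (x ^ m * of_nat p powi l) ^ n = of_nat p powi (k * int m - l * int n)"
    unfolding power_powi using x p_nz by (simp add: mult.commute power_int_diff)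
  finally have "k * int m - l * int n = 0" by (rule runit_p_power_int)
  then have "real_of_int (k * int m) = real_of_int (l * int n)" by simp
  then show ?thesis using assms(1,2) by (simp add: field_simps)
qed

text \<open>An absolute value that is 1 on units and 1/p at p must take the value p^(k/n) at x when
  x^n p^k is a unit.\<close>

definition rval :: "complex \<Rightarrow> real" where
  "rval x = (if x = 0 then 0 else
     (THE r. \<exists>n k. n > (0::nat) \<and> runit (x ^ n * of_nat p powi k) \<and> r = real p powr (real_of_int k / real n)))"

lemma rval_eq:
  assumes "n > (0::nat)" "runit (x ^ n * of_nat p powi k)"
  shows "rval x = real p powr (real_of_int k / real n)"
proof -
  have x: "x \<noteq> 0" using assms by (auto simp: runit_def zero_power)
  have "(THE r. \<exists>n k. n > (0::nat) \<and> runit (x ^ n * of_nat p powi k) \<and> r = real p powr (real_of_int k / real n))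
     = real p powr (real_of_int k / real n)"
  proof (rule the_equality)
    show "\<exists>na ka. na > (0::nat) \<and> runit (x ^ na * of_nat p powi ka) \<and> real p powr (real_of_int k / real n) = real p powr (real_of_int ka / real na)"
      using assms by blast
    fix r assume "\<exists>n k. n > (0::nat) \<and> runit (x ^ n * of_nat p powi k) \<and> r = real p powr (real_of_int k / real n)"
    then obtain m l where ml: "m > (0::nat)" "runit (x ^ m * of_nat p powi l)" "r = real p powr (real_of_int l / real m)" by blast
    show "r = real p powr (real_of_int k / real n)"
      using runit_exponent_unique[OF ml(1) assms(1) ml(2) assms(2)] ml(3) by simp
  qed
  then show ?thesis using x by (simp add: rval_def)
qed

lemma rval_mult:
  assumes "algebraic x" "algebraic y" shows "rval (x * y) = rval x * rval y"
proof (cases "x = 0 \<or> y = 0")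
  case False
  obtain n k where n: "n > (0::nat)" "runit (x ^ n * of_nat p powi k)" using exists_runit_power[of x] assms False by blast
  obtain m l where m: "m > (0::nat)" "runit (y ^ m * of_nat p powi l)" using exists_runit_power[of y] assms False by blast
  have "runit ((x ^ n * of_nat p powi k) ^ m * (y ^ m * of_nat p powi l) ^ n)"
    by (intro runit_mult runit_power n m)
  also have "(x ^ n * of_nat p powi k) ^ m * (y ^ m * of_nat p powi l) ^ n = (x * y) ^ (n * m) * of_nat p powi (k * int m + l * int n)"
    unfolding power_powi using p_nz by (simp add: power_mult_distrib mult.commute power_int_add)
  finally have "rval (x * y) = real p powr (real_of_int (k * int m + l * int n) / real (n * m))"
    using n m by (intro rval_eq) auto
  also have "real_of_int (k * int m + l * int n) / real (n * m) = real_of_int k / real n + real_of_int l / real m"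
    using n(1) m(1) by (simp add: field_simps)
  finally show ?thesis using rval_eq[OF n] rval_eq[OF m] by (simp add: powr_add)
qed (auto simp: rval_def)

lemma rval_pos: "algebraic x \<Longrightarrow> x \<noteq> 0 \<Longrightarrow> rval x > 0"
  using exists_runit_power[of x] rval_eq p_nz by (metis of_nat_0_eq_iff powr_gt_zero of_nat_eq_0_iff)

lemma rval_ring_le_1:
  assumes "x \<in> R" shows "rval x \<le> 1"
proof (cases "x = 0")
  case False
  obtain n k where n: "n > (0::nat)" "runit (x ^ n * of_nat p powi k)"
    using exists_runit_power[of x] alg_ring_algebraic[OF R assms] False by blast
  have "k \<le> 0"
  proof (rule ccontr)
    assume "\<not> k \<le> 0"
    then have k: "k = int (nat k - 1) + 1" by simp
    have "of_nat p ^ (nat k - 1) * (x ^ n * inverse (x ^ n * of_nat p powi k)) \<in> R"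
      by (intro alg_ring_mult[OF R] alg_ring_power[OF R] alg_ring_of_nat[OF R] assms)
         (use n in \<open>simp add: runit_def\<close>)
    moreover have "of_nat p ^ (nat k - 1) * (x ^ n * inverse (x ^ n * of_nat p powi k)) = (1 / of_nat p :: complex)"
      by (subst k) (use p_nz False in \<open>simp add: power_int_add field_simps\<close>)
    ultimately show False using noninv by simp
  qed
  then have "real p powr (real_of_int k / real n) \<le> real p powr 0"
    using prime_gt_1_nat[OF p] n(1) by (intro powr_mono) (auto simp: divide_nonpos_nonneg)
  then show ?thesis using rval_eq[OF n] prime_gt_1_nat[OF p] by simp
qed (simp add: rval_def)

lemma rval_add:
  assumes "algebraic x" "algebraic y" shows "rval (x + y) \<le> rval x + rval y"
proof (cases "x = 0 \<or> y = 0")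
  case False
  have *: "rval (x + y) \<le> rval y" if h: "x / y \<in> R" "y \<noteq> 0" "algebraic x" "algebraic y" for x y
  proof -
    have "y * (1 + x / y) = x + y" using h(2) by (simp add: field_simps)
    then have "rval (x + y) = rval (y * (1 + x / y))" by simp
    also have "\<dots> = rval y * rval (1 + x / y)" using h by (intro rval_mult) auto
    also have "\<dots> \<le> rval y * 1"
      using rval_ring_le_1[OF alg_ring_add[OF R alg_ring_1[OF R] h(1)]] rval_pos[OF h(4,2)] by (intro mult_left_mono) auto
    finally show ?thesis by simp
  qed
  have "x / y \<in> R \<or> inverse (x / y) \<in> R" using False assms by (intro valuation_ring) auto
  then show ?thesis using *[of x y] *[of y x] False assms rval_pos[of x] rval_pos[of y]
    by (auto simp: add.commute)
qed (auto simp: rval_def)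

lemma rval_extends_padic: "extends_padic p rval"
  unfolding extends_padic_def
proof (intro conjI allI impI)
  fix x :: complex assume "algebraic x"
  then show "0 \<le> rval x" "(rval x = 0) = (x = 0)" using rval_pos[of x] by (cases "x = 0"; force simp: rval_def)+
next
  fix x y :: complex assume "algebraic x \<and> algebraic y"
  then show "rval (x * y) = rval x * rval y" "rval (x + y) \<le> rval x + rval y" using rval_mult rval_add by auto
next
  fix q :: rat
  show "rval (of_rat q) = padic_abs p q"
  proof (cases "q = 0")
    case False
    obtain a b where ab: "quotient_of q = (a, b)" by (cases "quotient_of q")
    have q: "q = of_int a / of_int b" and b: "b \<noteq> 0"
      using quotient_of_denom_pos[OF ab] quotient_of_div[OF ab] by auto
    have a: "a \<noteq> 0" using False q by auto
    define ea eb where "ea = int (multiplicity (int p) a)" and "eb = int (multiplicity (int p) b)"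
    have "runit ((of_int a * of_nat p powi (- ea)) / (of_int b * of_nat p powi (- eb)))"
      unfolding ea_def eb_def by (intro runit_divide runit_int_p_power a b)
    also have "(of_int a * of_nat p powi (- ea)) / (of_int b * of_nat p powi (- eb)) = (of_rat q :: complex) ^ 1 * of_nat p powi (eb - ea)"
      using p_nz b by (simp add: q of_rat_divide power_int_diff power_int_minus field_simps)
    finally have "rval (of_rat q) = real p powr (real_of_int (eb - ea) / real 1)" by (intro rval_eq) auto
    also have "\<dots> = real p powi (eb - ea)" using prime_gt_0_nat[OF p] by (simp add: powr_real_of_int' del: of_int_diff)
    finally show ?thesis using padic_abs_divide[OF p a b] q by (simp add: ea_def eb_def)
  qed (simp add: rval_def padic_abs_def)
qed

end

lemma extends_padic_exists: "prime p \<Longrightarrow> \<exists>v. extends_padic p v"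
  using exists_maximal_alg_ring rval_extends_padic by metis

lemma Qbar_padic_abs_extends: "prime p \<Longrightarrow> extends_padic p (Qbar_padic_abs p)"
  unfolding Qbar_padic_abs_def using extends_padic_exists by (rule someI_ex)

section \<open>Ultrametric estimates and integrality\<close>

abbreviation vp :: "nat \<Rightarrow> complex \<Rightarrow> real" where "vp \<equiv> Qbar_padic_abs"

lemma pow_le_Suc_imp_le_1:
  assumes "\<And>n. (r::real) ^ n \<le> real n + 1" shows "r \<le> 1"
proof (rule ccontr)
  assume "\<not> r \<le> 1"
  then have r: "r > 1" by simp
  have "filterlim (\<lambda>n. r ^ n / (real n + 1)) at_top at_top" using r by real_asymp
  then have "eventually (\<lambda>n. r ^ n / (real n + 1) > 1) at_top"
    unfolding filterlim_at_top_dense by blast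
  then obtain n where "r ^ n / (real n + 1) > 1" by (meson eventually_happens trivial_limit_sequentially)
  then show False using assms[of n] by (simp add: field_simps)
qed

context
  fixes p :: nat assumes p: "prime p"
begin

lemma vp_nonneg: "algebraic x \<Longrightarrow> vp p x \<ge> 0"
  and vp_eq_0: "algebraic x \<Longrightarrow> vp p x = 0 \<longleftrightarrow> x = 0"
  and vp_mult: "algebraic x \<Longrightarrow> algebraic y \<Longrightarrow> vp p (x * y) = vp p x * vp p y"
  and vp_add: "algebraic x \<Longrightarrow> algebraic y \<Longrightarrow> vp p (x + y) \<le> vp p x + vp p y"
  and vp_of_rat: "vp p (of_rat q) = padic_abs p q"
  using Qbar_padic_abs_extends[OF p] unfolding extends_padic_def by blast+

lemma vp_0: "vp p 0 = 0" using vp_eq_0[of 0] by simp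

lemma vp_1: "vp p 1 = 1"
proof -
  have "vp p 1 * vp p 1 = vp p 1" using vp_mult[of 1 1] by simp
  then show ?thesis using vp_eq_0[of 1] by simp
qed

lemma vp_of_int_le: "vp p (of_int a) \<le> 1"
  using vp_of_rat[of "of_int a"] padic_abs_of_int_le[OF p, of a] by simp

lemma vp_of_nat_le: "vp p (of_nat a) \<le> 1"
  using vp_of_int_le[of "int a"] by simp

lemma vp_minus:
  assumes x: "algebraic x" shows "vp p (- x) = vp p x"
proof -
  have "vp p (-1) * vp p (-1) = 1" using vp_mult[of "-1" "-1"] vp_1 by simp
  moreover have "vp p (-1) \<ge> 0" by (rule vp_nonneg) simp
  ultimately have "vp p (-1) = 1" by (metis abs_of_nonneg abs_1 square_eq_1_iff abs_neg_one)
  then show ?thesis using vp_mult[of "-1" x] x by simp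
qed

lemma vp_power: "algebraic x \<Longrightarrow> vp p (x ^ n) = vp p x ^ n"
  by (induction n) (auto simp: vp_1 vp_mult)

lemma vp_sum_le_sum: "(\<And>i. i \<in> A \<Longrightarrow> algebraic (f i)) \<Longrightarrow> vp p (sum f A) \<le> (\<Sum>i\<in>A. vp p (f i))"
proof (induction A rule: infinite_finite_induct)
  case (insert a A)
  then have "vp p (f a + sum f A) \<le> vp p (f a) + vp p (sum f A)" by (intro vp_add) auto
  then show ?case using insert by simp
qed (auto simp: vp_0)

text \<open>The triangle inequality and boundedness on the integers imply the ultrametric inequality:
  expand \<open>(x + y)^n\<close> and take \<open>n\<close>-th roots.\<close>

lemma vp_ultrametric:
  assumes x: "algebraic x" and y: "algebraic y" and B: "vp p x \<le> B" "vp p y \<le> B"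
  shows "vp p (x + y) \<le> B"
proof (cases "B = 0")
  case True
  then have "x = 0" "y = 0" using x y B vp_nonneg[of x] vp_nonneg[of y] vp_eq_0[of x] vp_eq_0[of y] by auto
  then show ?thesis using True vp_0 by simp
next
  case False
  then have B0: "B > 0" using B vp_nonneg[OF x] by linarith
  have "(vp p (x + y) / B) ^ n \<le> real n + 1" for n
  proof -
    have "vp p (x + y) ^ n = vp p ((x + y) ^ n)" using x y by (simp add: vp_power)
    also have "\<dots> \<le> (\<Sum>k\<le>n. vp p (of_nat (n choose k) * x ^ k * y ^ (n - k)))"
      unfolding binomial_ring using x y by (intro vp_sum_le_sum) (auto intro!: algebraic_mult rat_imp_algebraic)
    also have "\<dots> \<le> (\<Sum>k\<le>n. B ^ n)"
    proof (intro sum_mono)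
      fix k assume k: "k \<in> {..n}"
      have "vp p (of_nat (n choose k) * x ^ k * y ^ (n - k)) = vp p (of_nat (n choose k)) * (vp p x ^ k * vp p y ^ (n - k))"
        using x y by (simp add: vp_mult vp_power rat_imp_algebraic)
      also have "\<dots> \<le> 1 * (B ^ k * B ^ (n - k))"
        using B vp_nonneg x y B0 vp_of_nat_le by (intro mult_mono power_mono) (auto intro!: mult_nonneg_nonneg)
      also have "\<dots> = B ^ n" using k by (simp add: power_add[symmetric])
      finally show "vp p (of_nat (n choose k) * x ^ k * y ^ (n - k)) \<le> B ^ n" .
    qed
    finally have "vp p (x + y) ^ n \<le> (real n + 1) * B ^ n" by (simp add: algebra_simps)
    then show ?thesis using B0 by (simp add: power_divide field_simps)
  qed
  then have "vp p (x + y) / B \<le> 1" by (rule pow_le_Suc_imp_le_1)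
  then show ?thesis using B0 by (simp add: field_simps)
qed

lemma vp_diff_le:
  assumes "algebraic x" "algebraic y" "vp p x \<le> B" "vp p y \<le> B" shows "vp p (x - y) \<le> B"
  using vp_ultrametric[of x "- y" B] assms by (simp add: vp_minus)

lemma vp_sum_le:
  assumes "B \<ge> 0" "\<And>i. i \<in> A \<Longrightarrow> algebraic (f i) \<and> vp p (f i) \<le> B"
  shows "vp p (sum f A) \<le> B"
  using assms(2)
proof (induction A rule: infinite_finite_induct)
  case (insert a A)
  then have "vp p (f a + sum f A) \<le> B" by (intro vp_ultrametric) auto
  then show ?case using insert by simp
qed (use assms(1) in \<open>auto simp: vp_0\<close>)

text \<open>The half of Gauss's lemma that bounds coefficients by roots: multiplication by a factor
  X - a enlarges the maximum of the coefficients at most by max(1, |a|). \<open>vp_root_gt_1\<close>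
  supplies the opposite direction.\<close>

lemma vp_coeff_prod_linear:
  assumes "finite A" "\<And>y. y \<in> A \<Longrightarrow> algebraic y"
  shows "vp p (coeff (\<Prod>y\<in>A. [:-y, 1:]) i) \<le> (\<Prod>y\<in>A. max 1 (vp p y))"
  using assms
proof (induction A arbitrary: i rule: finite_induct)
  case empty
  then show ?case by (auto simp: coeff_1 vp_0 vp_1)
next
  case (insert a A)
  define q where "q = (\<Prod>y\<in>A. [:-y, 1:])"
  define M where "M = (\<Prod>y\<in>A. max 1 (vp p y))"
  have q: "algebraic (coeff q j)" for j
    unfolding q_def using coeff_prod_linear[OF gal_id insert(1)] insert(4) by blast
  have IH: "vp p (coeff q j) \<le> M" for j unfolding q_def M_def using insert by blast
  have a: "algebraic a" using insert by auto
  have M: "M \<ge> 1" unfolding M_def by (rule prod_ge_1) auto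
  have le1: "vp p (coeff q j) \<le> max 1 (vp p a) * M" for j
    using IH[of j] M mult_right_mono[of 1 "max 1 (vp p a)" M] by linarith
  have le2: "vp p (a * coeff q j) \<le> max 1 (vp p a) * M" for j
    unfolding vp_mult[OF a q] using IH[of j] M vp_nonneg[OF q] by (intro mult_mono) auto
  have "vp p (coeff ([:-a, 1:] * q) i) \<le> max 1 (vp p a) * M"
  proof (cases i)
    case 0
    then show ?thesis using le2[of 0] vp_minus[of "a * coeff q 0"] a q by simp
  next
    case (Suc j)
    have "vp p (coeff q j - a * coeff q (Suc j)) \<le> max 1 (vp p a) * M"
      by (rule vp_diff_le) (use q a le1 le2 in auto)
    then show ?thesis using Suc by (simp add: algebra_simps)
  qed
  then show ?case using insert by (simp add: q_def M_def)
qed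

text \<open>With all coefficients of absolute value at most 1, the leading term y^D would strictly
  exceed every other term, and the ultrametric inequality excludes cancellation.\<close>

lemma vp_root_gt_1:
  assumes x: "algebraic x" and y: "y \<in> orb x" "vp p y > 1"
  shows "\<exists>i. vp p (coeff (min_poly x) i) > 1"
proof (rule ccontr)
  assume "\<not> ?thesis"
  then have le: "vp p (coeff (min_poly x) i) \<le> 1" for i by (meson not_le)
  define D where "D = card (orb x)"
  have D: "D > 0" using card_orb_pos[OF x] by (simp add: D_def)
  have ya: "algebraic y" using orb_algebraic[OF x y(1)] .
  have ca: "algebraic (coeff (min_poly x) i)" for i using min_poly_rat_coeffs[OF x] rat_imp_algebraic by blast
  have "0 = (\<Sum>i<D. coeff (min_poly x) i * y ^ i) + y ^ D"
    using min_poly_root[OF x y(1)] degree_min_poly[OF x] lead_coeff_min_poly[of x]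
    by (simp add: poly_altdef D_def lessThan_Suc_atMost[symmetric])
  then have "y ^ D = - (\<Sum>i<D. coeff (min_poly x) i * y ^ i)" by (simp add: add_eq_0_iff2)
  then have "vp p y ^ D = vp p (\<Sum>i<D. coeff (min_poly x) i * y ^ i)"
    using ya ca by (simp add: vp_power[symmetric] vp_minus)
  also have "\<dots> \<le> vp p y ^ (D - 1)"
  proof (rule vp_sum_le)
    fix i assume i: "i \<in> {..<D}"
    have "vp p (coeff (min_poly x) i * y ^ i) = vp p (coeff (min_poly x) i) * vp p y ^ i"
      using ya ca by (simp add: vp_mult vp_power)
    also have "\<dots> \<le> 1 * vp p y ^ (D - 1)"
      using le i y(2) by (intro mult_mono power_increasing) auto
    finally show "algebraic (coeff (min_poly x) i * y ^ i) \<and> vp p (coeff (min_poly x) i * y ^ i) \<le> vp p y ^ (D - 1)"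
      using ya ca by simp
  qed (use y(2) in auto)
  finally have "vp p y ^ D \<le> vp p y ^ (D - 1)" .
  moreover have "vp p y ^ (D - 1) < vp p y ^ D" using y(2) D by (intro power_strict_increasing) auto
  ultimately show False by simp
qed

end

text \<open>A bad prime divides the denominator of one of the finitely many nonzero coefficients of
  \<open>min_poly x\<close>.\<close>

lemma finite_bad_primes:
  assumes x: "algebraic x" shows "finite {p. prime p \<and> (\<exists>y\<in>orb x. vp p y > 1)}"
proof -
  have "\<exists>q. coeff (min_poly x) i = of_rat q" for i
    using min_poly_rat_coeffs[OF x] Rats_cases by metis
  then obtain q where q: "\<And>i. coeff (min_poly x) i = of_rat (q i)" by metis
  let ?S = "\<Union>i\<le>card (orb x). {p. p dvd nat (snd (quotient_of (q i)))}"
  show ?thesis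
  proof (rule finite_subset)
    show "{p. prime p \<and> (\<exists>y\<in>orb x. vp p y > 1)} \<subseteq> ?S"
    proof
      fix p assume "p \<in> {p. prime p \<and> (\<exists>y\<in>orb x. vp p y > 1)}"
      then obtain y where y: "prime p" "y \<in> orb x" "vp p y > 1" by blast
      obtain i where i: "vp p (coeff (min_poly x) i) > 1" using vp_root_gt_1[OF y(1) x y(2,3)] by blast
      then have "padic_abs p (q i) > 1" using vp_of_rat[OF y(1), of "q i"] by (simp add: q)
      then have "p dvd nat (snd (quotient_of (q i)))" by (rule padic_abs_gt_1(2)[OF y(1)])
      moreover have "i \<le> card (orb x)"
      proof (rule ccontr)
        assume "\<not> i \<le> card (orb x)"
        then have "coeff (min_poly x) i = 0" using degree_min_poly[OF x] by (intro coeff_eq_0) simp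
        then show False using i vp_0[OF y(1)] by simp
      qed
      ultimately show "p \<in> ?S" by blast
    qed
    show "finite ?S"
    proof (intro finite_UN_I finite_atMost)
      fix i
      have "snd (quotient_of (q i)) > 0" by (rule quotient_of_denom_pos')
      then show "finite {p. p dvd nat (snd (quotient_of (q i)))}" by (intro finite_divisors_nat) simp
    qed
  qed
qed

text \<open>A root of absolute value above 1 forces a coefficient above 1. That coefficient is
  rational, hence at least p in absolute value, and the product dominates it.\<close>

lemma prod_vp_conjugates_ge:
  assumes x: "algebraic x" and p: "prime p" and y: "y \<in> orb x" "vp p y > 1"
  shows "(\<Prod>y\<in>orb x. max 1 (vp p y)) \<ge> real p"
proof -
  obtain i where i: "vp p (coeff (min_poly x) i) > 1" using vp_root_gt_1[OF p x y] by blast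
  obtain q where q: "coeff (min_poly x) i = of_rat q" using min_poly_rat_coeffs[OF x] Rats_cases by metis
  have "real p \<le> vp p (coeff (min_poly x) i)"
    using padic_abs_gt_1(1)[OF p, of q] i vp_of_rat[OF p, of q] by (simp add: q)
  also have "\<dots> \<le> (\<Prod>y\<in>orb x. max 1 (vp p y))"
    unfolding min_poly_def by (rule vp_coeff_prod_linear[OF p finite_orb[OF x]]) (rule orb_algebraic[OF x])
  finally show ?thesis .
qed

section \<open>Integrality tested at all primes\<close>

definition padic_integral :: "complex \<Rightarrow> bool" where
  "padic_integral z \<longleftrightarrow> algebraic z \<and> (\<forall>p. prime p \<longrightarrow> vp p z \<le> 1)"

lemma padic_integral_mult: "padic_integral x \<Longrightarrow> padic_integral y \<Longrightarrow> padic_integral (x * y)"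
  unfolding padic_integral_def by (auto simp: vp_mult intro!: mult_le_one vp_nonneg)

lemma padic_integral_add: "padic_integral x \<Longrightarrow> padic_integral y \<Longrightarrow> padic_integral (x + y)"
  unfolding padic_integral_def by (auto intro: vp_ultrametric)

lemma padic_integral_of_int: "padic_integral (of_int a)"
  unfolding padic_integral_def by (auto intro: vp_of_int_le)

lemma padic_integral_power: "padic_integral x \<Longrightarrow> padic_integral (x ^ n)"
  by (induction n) (use padic_integral_of_int[of 1] in \<open>auto intro: padic_integral_mult\<close>)

lemma padic_integral_sum: "(\<And>i. i \<in> A \<Longrightarrow> padic_integral (f i)) \<Longrightarrow> padic_integral (sum f A)"
  by (induction A rule: infinite_finite_induct)
     (use padic_integral_of_int[of 0] in \<open>auto intro: padic_integral_add\<close>)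

lemma padic_integral_prod: "(\<And>i. i \<in> A \<Longrightarrow> padic_integral (f i)) \<Longrightarrow> padic_integral (prod f A)"
  by (induction A rule: infinite_finite_induct)
     (use padic_integral_of_int[of 1] in \<open>auto intro: padic_integral_mult\<close>)

lemma padic_integral_Rats_imp_Ints:
  assumes "padic_integral z" "z \<in> \<rat>" shows "z \<in> \<int>"
proof -
  obtain q where q: "z = of_rat q" using assms(2) Rats_cases by blast
  have "q \<in> \<int>" by (rule padic_abs_le_1_imp_Ints) (use assms(1) q vp_of_rat in \<open>auto simp: padic_integral_def\<close>)
  then show ?thesis using q by (auto elim!: Ints_cases)
qed

definition ipoly :: "int poly \<Rightarrow> complex \<Rightarrow> complex" where
  "ipoly F z = poly (map_poly of_int F) z"

lemma ipoly_altdef: "ipoly F z = (\<Sum>i\<le>degree F. of_int (coeff F i) * z ^ i)"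
  by (simp add: ipoly_def poly_altdef coeff_map_poly degree_map_poly)

lemma map_poly_of_int_add: "map_poly of_int (F + G) = (map_poly of_int F + map_poly of_int G :: complex poly)"
  by (simp add: poly_eq_iff coeff_map_poly)

lemma map_poly_of_int_mult: "map_poly of_int (F * G) = (map_poly of_int F * map_poly of_int G :: complex poly)"
  by (simp add: poly_eq_iff coeff_map_poly coeff_mult)

lemma map_poly_of_int_1: "map_poly of_int 1 = (1 :: complex poly)"
  by (simp add: poly_eq_iff coeff_map_poly coeff_1)

lemma map_poly_of_int_power: "map_poly of_int (F ^ n) = (map_poly of_int F ^ n :: complex poly)"
  by (induction n) (simp_all add: map_poly_of_int_mult map_poly_of_int_1)

lemma map_poly_of_int_smult: "map_poly of_int (smult c F) = (smult (of_int c) (map_poly of_int F) :: complex poly)"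
  by (simp add: poly_eq_iff coeff_map_poly)

lemma ipoly_add: "ipoly (F + G) z = ipoly F z + ipoly G z"
  and ipoly_mult: "ipoly (F * G) z = ipoly F z * ipoly G z"
  and ipoly_power: "ipoly (F ^ n) z = ipoly F z ^ n"
  and ipoly_smult: "ipoly (smult c F) z = of_int c * ipoly F z"
  by (simp_all add: ipoly_def map_poly_of_int_add map_poly_of_int_mult map_poly_of_int_power map_poly_of_int_smult)

lemma gal_ipoly: "g \<in> Gal \<Longrightarrow> algebraic x \<Longrightarrow> g (ipoly F x) = ipoly F (g x)"
  unfolding ipoly_def by (rule gal_poly) (auto simp: coeff_map_poly)

lemma algebraic_ipoly: "algebraic x \<Longrightarrow> algebraic (ipoly F x)"
  unfolding ipoly_def by (rule algebraic_rat_coeffs) (auto simp: coeff_map_poly)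

lemma padic_integral_ipoly: "padic_integral z \<Longrightarrow> padic_integral (ipoly F z)"
  unfolding ipoly_altdef
  by (intro padic_integral_sum padic_integral_mult padic_integral_of_int padic_integral_power)

text \<open>Integrality is imposed at all conjugates because only one extension of each \<open>p\<close>-adic absolute
  value is at hand.\<close>

definition integral_conj :: "complex \<Rightarrow> bool" where
  "integral_conj x \<longleftrightarrow> (\<forall>y\<in>orb x. padic_integral y)"

lemma integral_conj_algebraic: "integral_conj x \<Longrightarrow> algebraic x"
  unfolding integral_conj_def padic_integral_def using orb_self by blast

text \<open>The product is fixed by \<open>Gal\<close>, hence rational, and it is integral at every
  prime. The exponent m admits values at the p-th powers of the conjugates.\<close>

lemma norm_ipoly_Ints:
  assumes x: "integral_conj x"
  shows "(\<Prod>y\<in>orb x. ipoly F (y ^ m)) \<in> \<int>"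
proof (rule padic_integral_Rats_imp_Ints)
  have xa: "algebraic x" using integral_conj_algebraic[OF x] .
  show "padic_integral (\<Prod>y\<in>orb x. ipoly F (y ^ m))"
    using x unfolding integral_conj_def by (intro padic_integral_prod padic_integral_ipoly padic_integral_power) auto
  show "(\<Prod>y\<in>orb x. ipoly F (y ^ m)) \<in> \<rat>"
  proof (rule prod_orb_Rats[OF xa])
    fix y assume y: "y \<in> orb x"
    then have ya: "algebraic y" using orb_algebraic[OF xa] by blast
    then show "algebraic (ipoly F (y ^ m))" by (intro algebraic_ipoly) auto
    fix g assume g: "g \<in> Gal"
    show "g (ipoly F (y ^ m)) = ipoly F (g y ^ m)"
      using gal_ipoly[OF g, of "y ^ m"] gal_power[OF g ya] ya by simp
  qed
qed

lemma integral_min_poly: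
  assumes x: "integral_conj x"
  obtains f :: "int poly" where "map_poly of_int f = min_poly x" "lead_coeff f = 1" "degree f = card (orb x)"
proof -
  have xa: "algebraic x" using integral_conj_algebraic[OF x] .
  have "coeff (min_poly x) i \<in> \<int>" for i
  proof (rule padic_integral_Rats_imp_Ints)
    show "coeff (min_poly x) i \<in> \<rat>" using min_poly_rat_coeffs[OF xa] by blast
    have "vp p (coeff (min_poly x) i) \<le> 1" if p: "prime p" for p
    proof -
      have "vp p (coeff (min_poly x) i) \<le> (\<Prod>y\<in>orb x. max 1 (vp p y))"
        unfolding min_poly_def by (rule vp_coeff_prod_linear[OF p finite_orb[OF xa]]) (rule orb_algebraic[OF xa])
      also have "\<dots> = 1"
        by (rule prod.neutral) (use x p in \<open>auto simp: integral_conj_def padic_integral_def\<close>)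
      finally show ?thesis .
    qed
    then show "padic_integral (coeff (min_poly x) i)"
      unfolding padic_integral_def using min_poly_rat_coeffs[OF xa] rat_imp_algebraic by blast
  qed
  then obtain f :: "int poly" where f: "min_poly x = map_poly of_int f" by (rule intpolyE) blast
  have d: "degree f = card (orb x)" using degree_min_poly[OF xa] f by (simp add: degree_map_poly)
  have "(of_int (lead_coeff f) :: complex) = 1"
    using lead_coeff_min_poly[of x] unfolding f by (simp add: coeff_map_poly degree_map_poly)
  then have "lead_coeff f = 1" by simp
  then show ?thesis using that f d by simp
qed

section \<open>The Weil height as an average over conjugates\<close>

lemma log_plus_nonneg: "log_plus t \<ge> 0"
  by (simp add: log_plus_def)

lemma log_plus_eq_0: "t \<le> 1 \<Longrightarrow> log_plus t = 0"
  by (simp add: log_plus_def)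

lemma log_plus_mult_le:
  assumes "s \<ge> 0" "t \<ge> 0" shows "log_plus (s * t) \<le> log_plus s + log_plus t"
proof -
  have "s * t \<le> max 1 s * max 1 t" using assms by (intro mult_mono) auto
  moreover have "1 * 1 \<le> max 1 s * max 1 t" by (intro mult_mono) auto
  ultimately have "max 1 (s * t) \<le> max 1 s * max 1 t" by simp
  then have "ln (max 1 (s * t)) \<le> ln (max 1 s * max 1 t)"
    by (intro ln_mono) auto
  also have "\<dots> = ln (max 1 s) + ln (max 1 t)" by (rule ln_mult_pos) auto
  finally show ?thesis by (simp add: log_plus_def)
qed

lemma log_plus_power:
  assumes "t \<ge> 0" shows "log_plus (t ^ n) = real n * log_plus t"
proof (cases "t \<le> 1")
  case True
  then show ?thesis using assms by (simp add: log_plus_eq_0 power_le_one)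
next
  case False
  then have "max 1 (t ^ n) = t ^ n" by (simp add: one_le_power max_def)
  then show ?thesis using False by (simp add: log_plus_def ln_realpow max_def)
qed

definition bad_primes :: "complex \<Rightarrow> nat set" where
  "bad_primes y = {p. prime p \<and> vp p y > 1}"

text \<open>This uses one fixed extension of each place of the rationals, the archimedean one
  included. The other extensions are reached by averaging over the conjugates of y.\<close>

definition place_sum :: "complex \<Rightarrow> real" where
  "place_sum y = log_plus (norm y) + (\<Sum>p\<in>bad_primes y. log_plus (vp p y))"

lemma bad_primes_finite: "algebraic y \<Longrightarrow> finite (bad_primes y)"
  unfolding bad_primes_def by (rule finite_subset[OF _ finite_bad_primes[of y]]) auto

lemma place_sum_eq:
  assumes "finite S" "bad_primes y \<subseteq> S" "S \<subseteq> {p. prime p}"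
  shows "place_sum y = log_plus (norm y) + (\<Sum>p\<in>S. log_plus (vp p y))"
proof -
  have "(\<Sum>p\<in>bad_primes y. log_plus (vp p y)) = (\<Sum>p\<in>S. log_plus (vp p y))"
    by (rule sum.mono_neutral_left) (use assms in \<open>auto simp: bad_primes_def log_plus_eq_0 not_less intro!: log_plus_eq_0\<close>)
  then show ?thesis by (simp add: place_sum_def)
qed

lemma weil_height_eq:
  assumes x: "algebraic x" shows "weil_height x = conj_avg place_sum x"
proof -
  define S where "S = {p. prime p \<and> (\<exists>y\<in>orb x. vp p y > 1)}"
  have fin: "finite S" unfolding S_def by (rule finite_bad_primes[OF x])
  have "(\<Sum>\<^sub>\<infinity>p\<in>{p. prime p}. \<Sum>\<sigma>\<in>embeddings (adjoin x). log_plus (vp p (\<sigma> x)))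
     = (\<Sum>\<^sub>\<infinity>p\<in>{p. prime p}. \<Sum>y\<in>orb x. log_plus (vp p y))"
    by (simp add: sum_embeddings[OF x, where F = "\<lambda>y. log_plus (vp _ y)"])
  also have "\<dots> = (\<Sum>\<^sub>\<infinity>p\<in>S. \<Sum>y\<in>orb x. log_plus (vp p y))"
  proof (rule infsum_cong_neutral)
    fix p assume p: "p \<in> {p. prime p} - S"
    then have "log_plus (vp p y) = 0" if "y \<in> orb x" for y
      using that by (intro log_plus_eq_0) (force simp: S_def)
    then show "(\<Sum>y\<in>orb x. log_plus (vp p y)) = 0" by simp
  qed (auto simp: S_def)
  also have "\<dots> = (\<Sum>p\<in>S. \<Sum>y\<in>orb x. log_plus (vp p y))" by (rule infsum_finite[OF fin])
  also have "\<dots> = (\<Sum>y\<in>orb x. \<Sum>p\<in>S. log_plus (vp p y))" by (rule sum.swap)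
  finally have 1: "(\<Sum>\<^sub>\<infinity>p\<in>{p. prime p}. \<Sum>\<sigma>\<in>embeddings (adjoin x). log_plus (vp p (\<sigma> x)))
    = (\<Sum>y\<in>orb x. \<Sum>p\<in>S. log_plus (vp p y))" .
  have "(\<Sum>y\<in>orb x. place_sum y) = (\<Sum>y\<in>orb x. log_plus (norm y) + (\<Sum>p\<in>S. log_plus (vp p y)))"
    by (intro sum.cong refl place_sum_eq fin) (auto simp: S_def bad_primes_def)
  then show ?thesis
    unfolding weil_height_def conj_avg_def field_degree_adjoin[OF x] 1
    by (simp add: sum_embeddings[OF x, where F = "\<lambda>y. log_plus (norm y)"] sum.distrib)
qed

lemma place_sum_nonneg: "place_sum y \<ge> 0"
  unfolding place_sum_def by (intro add_nonneg_nonneg sum_nonneg log_plus_nonneg)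

lemma place_sum_mult_le:
  assumes "algebraic a" "algebraic b" shows "place_sum (a * b) \<le> place_sum a + place_sum b"
proof -
  let ?S = "bad_primes a \<union> bad_primes b \<union> bad_primes (a * b)"
  have S: "finite ?S" "?S \<subseteq> {p. prime p}" using assms bad_primes_finite by (auto simp: bad_primes_def)
  have eq: "place_sum y = log_plus (norm y) + (\<Sum>p\<in>?S. log_plus (vp p y))" if "bad_primes y \<subseteq> ?S" for y
    using place_sum_eq[OF S(1) that S(2)] .
  have "(\<Sum>p\<in>?S. log_plus (vp p (a * b))) \<le> (\<Sum>p\<in>?S. log_plus (vp p a) + log_plus (vp p b))"
  proof (rule sum_mono)
    fix p assume "p \<in> ?S"
    then have p: "prime p" by (auto simp: bad_primes_def)
    show "log_plus (vp p (a * b)) \<le> log_plus (vp p a) + log_plus (vp p b)"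
      unfolding vp_mult[OF p assms] by (intro log_plus_mult_le vp_nonneg[OF p] assms)
  qed
  moreover have "log_plus (norm (a * b)) \<le> log_plus (norm a) + log_plus (norm b)"
    unfolding norm_mult by (rule log_plus_mult_le) auto
  moreover have "place_sum a = log_plus (norm a) + (\<Sum>p\<in>?S. log_plus (vp p a))"
    "place_sum b = log_plus (norm b) + (\<Sum>p\<in>?S. log_plus (vp p b))"
    "place_sum (a * b) = log_plus (norm (a * b)) + (\<Sum>p\<in>?S. log_plus (vp p (a * b)))"
    by (rule eq; blast)+
  ultimately show ?thesis by (simp add: sum.distrib)
qed

lemma place_sum_power:
  assumes a: "algebraic a" shows "place_sum (a ^ n) = real n * place_sum a"
proof -
  let ?S = "bad_primes a \<union> bad_primes (a ^ n)"
  have S: "finite ?S" "?S \<subseteq> {p. prime p}" using assms bad_primes_finite by (auto simp: bad_primes_def)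
  have "(\<Sum>p\<in>?S. log_plus (vp p (a ^ n))) = (\<Sum>p\<in>?S. real n * log_plus (vp p a))"
  proof (rule sum.cong[OF refl])
    fix p assume "p \<in> ?S"
    then have p: "prime p" by (auto simp: bad_primes_def)
    show "log_plus (vp p (a ^ n)) = real n * log_plus (vp p a)"
      unfolding vp_power[OF p a] by (intro log_plus_power vp_nonneg[OF p] a)
  qed
  moreover have "log_plus (norm (a ^ n)) = real n * log_plus (norm a)"
    unfolding norm_power by (rule log_plus_power) auto
  moreover have "place_sum a = log_plus (norm a) + (\<Sum>p\<in>?S. log_plus (vp p a))"
    "place_sum (a ^ n) = log_plus (norm (a ^ n)) + (\<Sum>p\<in>?S. log_plus (vp p (a ^ n)))"
    by (rule place_sum_eq[OF S(1) _ S(2)]; blast)+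
  ultimately show ?thesis by (simp add: sum_distrib_left algebra_simps)
qed

lemma weil_height_nonneg: "algebraic x \<Longrightarrow> weil_height x \<ge> 0"
  by (simp add: weil_height_eq conj_avg_def place_sum_nonneg sum_nonneg)

lemma weil_height_mult_le:
  assumes "algebraic x" "algebraic y" shows "weil_height (x * y) \<le> weil_height x + weil_height y"
  using assms orb_algebraic
  by (simp add: weil_height_eq) (intro conj_avg_mult_le place_sum_mult_le; blast)

lemma weil_height_power: "algebraic x \<Longrightarrow> weil_height (x ^ n) = real n * weil_height x"
  using orb_algebraic
  by (simp add: weil_height_eq) (intro conj_avg_power place_sum_power; blast)

lemma weil_height_ge_log_plus:
  assumes x: "algebraic x"
  shows "weil_height x * card (orb x) \<ge> (\<Sum>y\<in>orb x. log_plus (norm y))"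
proof -
  have "(\<Sum>y\<in>orb x. log_plus (norm y)) \<le> (\<Sum>y\<in>orb x. place_sum y)"
    unfolding place_sum_def by (intro sum_mono) (simp add: sum_nonneg log_plus_nonneg)
  then show ?thesis using card_orb_pos[OF x] by (simp add: weil_height_eq[OF x] conj_avg_def)
qed

lemma weil_height_not_integral:
  assumes x: "algebraic x" and "\<not> integral_conj x"
  shows "weil_height x * card (orb x) \<ge> ln 2"
proof -
  obtain y p where yp: "y \<in> orb x" "prime p" "vp p y > 1"
    using assms orb_algebraic[OF x] unfolding integral_conj_def padic_integral_def by (meson not_le)
  have "ln 2 \<le> ln (real p)" using prime_ge_2_nat[OF yp(2)] by simp
  also have "\<dots> \<le> ln (\<Prod>y\<in>orb x. max 1 (vp p y))"
    using prod_vp_conjugates_ge[OF x yp(2,1,3)] prime_gt_0_nat[OF yp(2)] by (intro ln_mono) auto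
  also have "\<dots> = (\<Sum>y\<in>orb x. log_plus (vp p y))"
    unfolding log_plus_def using finite_orb[OF x] by (intro ln_prod) auto
  also have "\<dots> \<le> (\<Sum>y\<in>orb x. place_sum y)"
  proof (rule sum_mono)
    fix z assume z: "z \<in> orb x"
    let ?S = "insert p (bad_primes z)"
    have fin: "finite ?S" using bad_primes_finite orb_algebraic[OF x z] by simp
    have "log_plus (vp p z) \<le> (\<Sum>p\<in>?S. log_plus (vp p z))"
      using fin by (intro member_le_sum) (auto intro: log_plus_nonneg)
    also have "\<dots> \<le> place_sum z"
    proof -
      have "place_sum z = log_plus (norm z) + (\<Sum>p\<in>?S. log_plus (vp p z))"
        by (rule place_sum_eq[OF fin]) (use yp(2) in \<open>auto simp: bad_primes_def\<close>)
      then show ?thesis using log_plus_nonneg[of "norm z"] by linarith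
    qed
    finally show "log_plus (vp p z) \<le> place_sum z" .
  qed
  finally show ?thesis using card_orb_pos[OF x] by (simp add: weil_height_eq[OF x] conj_avg_def)
qed

section \<open>Polynomial congruences and orders of vanishing\<close>

lemma add_power_prime:
  fixes u v :: "'a::comm_ring_1"
  assumes p: "prime p" shows "\<exists>w. (u + v) ^ p = u ^ p + v ^ p + of_nat p * w"
proof -
  have p0: "p > 0" using prime_gt_0_nat[OF p] .
  have "\<exists>c. p choose k = p * c" if "k \<in> {1..<p}" for k
    using dvd_choose_prime[of k p] p that by (auto elim!: dvdE)
  then obtain c where c: "\<And>k. k \<in> {1..<p} \<Longrightarrow> p choose k = p * c k" by metis
  have "(u + v) ^ p = (\<Sum>k\<in>{0..p}. of_nat (p choose k) * u ^ k * v ^ (p - k))"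
    by (simp add: binomial_ring atMost_atLeast0)
  also have "{0..p} = insert 0 (insert p {1..<p})" using p0 by auto
  also have "(\<Sum>k\<in>insert 0 (insert p {1..<p}). of_nat (p choose k) * u ^ k * v ^ (p - k))
    = v ^ p + u ^ p + (\<Sum>k\<in>{1..<p}. of_nat (p choose k) * u ^ k * v ^ (p - k))"
    using p0 by (subst sum.insert) (auto simp: add.assoc)
  also have "(\<Sum>k\<in>{1..<p}. of_nat (p choose k) * u ^ k * v ^ (p - k)) = of_nat p * (\<Sum>k\<in>{1..<p}. of_nat (c k) * u ^ k * v ^ (p - k))"
    unfolding sum_distrib_left by (rule sum.cong) (auto simp: c mult.assoc)
  finally show ?thesis by (auto simp: add.commute)
qed

lemma int_power_prime:
  assumes p: "prime p" shows "\<exists>t. (a::int) ^ p = a + int p * t"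
proof -
  have nat: "\<exists>t. int n ^ p = int n + int p * t" for n
  proof (induction n)
    case 0
    then show ?case using prime_gt_0_nat[OF p] by (auto simp: zero_power intro: exI[of _ 0])
  next
    case (Suc n)
    then obtain t where t: "int n ^ p = int n + int p * t" by blast
    obtain w where "(int n + 1) ^ p = int n ^ p + 1 ^ p + int p * w" using add_power_prime[OF p, of "int n" 1] by auto
    then have "int (Suc n) ^ p = int (Suc n) + int p * (t + w)" using t by (simp add: algebra_simps)
    then show ?case by blast
  qed
  have pos: "int p > 0" using prime_gt_0_nat[OF p] by simp
  obtain t where t: "(a mod int p) ^ p = a mod int p + int p * t"
    using nat[of "nat (a mod int p)"] pos by auto
  have "a ^ p mod int p = (a mod int p) ^ p mod int p" by (simp add: power_mod)
  also have "\<dots> = a mod int p" using t by simp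
  finally have "int p dvd a ^ p - a" by (simp add: mod_eq_dvd_iff)
  then obtain s where "a ^ p - a = int p * s" by (elim dvdE)
  then show ?thesis by (intro exI[of _ s]) simp
qed

text \<open>Frobenius modulo p. At a root y of f it reads f(y^p) = p h(y), which is where the
  divisibility of F(y^p) by p^k comes from.\<close>

lemma pcompose_power_prime:
  fixes f :: "int poly"
  assumes p: "prime p" shows "\<exists>h. pcompose f (monom 1 p) = f ^ p + of_nat p * h"
proof (induction f)
  case 0
  then show ?case using prime_gt_0_nat[OF p] by (auto simp: zero_power intro: exI[of _ 0])
next
  case (pCons a f)
  then obtain h where h: "pcompose f (monom 1 p) = f ^ p + of_nat p * h" by blast
  obtain t where t: "a ^ p = a + int p * t" using int_power_prime[OF p] by blast
  define X :: "int poly" where "X = [:0, 1:]"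
  have Xp: "X ^ p = monom 1 p" unfolding X_def by (simp add: monom_altdef)
  have pc: "pCons a f = [:a:] + X * f" by (simp add: X_def)
  obtain w where w: "([:a:] + X * f) ^ p = [:a:] ^ p + (X * f) ^ p + of_nat p * w" using add_power_prime[OF p] by blast
  have ap: "[:a:] ^ p = [:a:] + of_nat p * [:t:]"
    using t by (simp add: poly_const_pow of_nat_poly)
  have "pcompose (pCons a f) (monom 1 p) = [:a:] + X ^ p * (f ^ p + of_nat p * h)"
    by (simp add: pcompose_pCons h Xp)
  also have "\<dots> = (pCons a f) ^ p + of_nat p * (X ^ p * h - [:t:] - w)"
    unfolding pc w ap by (simp add: power_mult_distrib algebra_simps)
  finally show ?case by blast
qed

lemma power_dvd_pderiv_funpow:
  fixes f :: "int poly"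
  assumes "f ^ k dvd P" "j \<le> k" shows "f ^ (k - j) dvd (pderiv ^^ j) P"
  using assms(2)
proof (induction j)
  case 0
  then show ?case using assms by simp
next
  case (Suc j)
  define m where "m = k - Suc j"
  have km: "k - j = Suc m" using Suc.prems by (simp add: m_def)
  obtain S where S: "(pderiv ^^ j) P = f ^ Suc m * S" using Suc km by (auto elim!: dvdE)
  have "(pderiv ^^ Suc j) P = pderiv (f ^ Suc m * S)" by (simp add: S)
  also have "\<dots> = f ^ m * (f * pderiv S + S * (smult (of_nat (Suc m)) (pderiv f)))"
    unfolding pderiv_mult[of "f ^ Suc m"] pderiv_power_Suc
    by (simp add: algebra_simps smult_add_right del: of_nat_Suc)
  finally show ?case unfolding m_def by (metis dvd_triv_left)
qed

lemma pderiv_funpow_add: "(pderiv ^^ j) (P + Q) = (pderiv ^^ j) P + (pderiv ^^ j) Q"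
  by (induction j) (simp_all add: pderiv_add)

lemma pderiv_funpow_smult: "(pderiv ^^ j) (smult c P) = smult c ((pderiv ^^ j) P)"
  by (induction j) (simp_all add: pderiv_smult)

lemma pderiv_map_of_int: "pderiv (map_poly of_int F :: complex poly) = map_poly of_int (pderiv F)"
  by (simp add: poly_eq_iff coeff_pderiv coeff_map_poly)

lemma pderiv_funpow_map_of_int: "(pderiv ^^ j) (map_poly of_int F :: complex poly) = map_poly of_int ((pderiv ^^ j) F)"
  by (induction j) (simp_all add: pderiv_map_of_int)

lemma linear_power_dvd_if_derivs:
  fixes P :: "complex poly"
  assumes "\<And>j. j < k \<Longrightarrow> poly ((pderiv ^^ j) P) y = 0"
  shows "[:-y, 1:] ^ k dvd P"
  using assms
proof (induction k arbitrary: P)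
  case (Suc k)
  show ?case
  proof (cases "P = 0")
    case False
    have P0: "poly P y = 0" using Suc.prems[of 0] by simp
    have "poly ((pderiv ^^ j) (pderiv P)) y = 0" if "j < k" for j
      using Suc.prems[of "Suc j"] that by (simp add: funpow_Suc_right del: funpow.simps)
    then have dv: "[:-y, 1:] ^ k dvd pderiv P" by (rule Suc.IH)
    have od: "order y P = Suc (order y (pderiv P))" by (rule order_pderiv[OF False P0])
    have "pderiv P \<noteq> 0"
    proof
      assume "pderiv P = 0"
      then obtain c where "P = [:c:]" using pderiv_iszero by blast
      then show False using P0 False by simp
    qed
    then have "Suc k \<le> order y P" using dv od by (simp add: order_divides)
    then show ?thesis using order_divides by blast
  qed simp
qed simp

lemma prod_linear_power_dvd:
  fixes P :: "complex poly"
  assumes "finite A" "\<And>y. y \<in> A \<Longrightarrow> [:-y, 1:] ^ k dvd P" "P \<noteq> 0"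
  shows "(\<Prod>y\<in>A. [:-y, 1:]) ^ k dvd P"
  using assms(1,2)
proof (induction A rule: finite_induct)
  case (insert a A)
  define Q where "Q = (\<Prod>y\<in>A. [:-y, 1:])"
  obtain S where S: "P = Q ^ k * S" unfolding Q_def using insert by (auto elim!: dvdE)
  have Qa: "poly (Q ^ k) a \<noteq> 0"
    using insert(1,2) by (auto simp: Q_def poly_prod poly_power)
  have "k \<le> order a P" using insert.prems[of a] assms(3) by (simp add: order_divides)
  also have "order a P = order a (Q ^ k) + order a S" using assms(3) unfolding S by (rule order_mult)
  also have "order a (Q ^ k) = 0" using Qa by (rule order_0I)
  finally have "[:-a, 1:] ^ k dvd S" by (simp add: order_divides)
  then have "Q ^ k * [:-a, 1:] ^ k dvd P" unfolding S by (intro mult_dvd_mono) auto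
  moreover have "(\<Prod>y\<in>insert a A. [:-y, 1:]) ^ k = Q ^ k * [:-a, 1:] ^ k"
    unfolding Q_def prod.insert[OF insert(1,2)] power_mult_distrib by (rule mult.commute)
  ultimately show ?case by simp
qed simp

lemma coeff_pderiv_funpow_bound:
  fixes F :: "int poly"
  assumes "\<And>i. i \<ge> N \<Longrightarrow> coeff F i = 0" "\<And>i. \<bar>coeff F i\<bar> \<le> int H"
  shows "(\<forall>i\<ge>N. coeff ((pderiv ^^ j) F) i = 0) \<and> (\<forall>i. \<bar>coeff ((pderiv ^^ j) F) i\<bar> \<le> int (H * N ^ j))"
proof (induction j)
  case (Suc j)
  define G where "G = (pderiv ^^ j) F"
  have IH: "coeff G i = 0" if "i \<ge> N" for i using Suc that by (simp add: G_def)
  have IH': "\<bar>coeff G i\<bar> \<le> int (H * N ^ j)" for i using Suc by (simp add: G_def)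
  have "\<bar>coeff (pderiv G) i\<bar> \<le> int (H * N ^ Suc j)" for i
  proof (cases "Suc i < N")
    case True
    have "\<bar>coeff (pderiv G) i\<bar> = int (Suc i) * \<bar>coeff G (Suc i)\<bar>" by (simp add: coeff_pderiv abs_mult)
    also have "\<dots> \<le> int N * int (H * N ^ j)" using True IH' by (intro mult_mono) auto
    finally show ?thesis by (simp add: algebra_simps)
  next
    case False
    then show ?thesis using IH[of "Suc i"] by (simp add: coeff_pderiv)
  qed
  then show ?case using IH by (simp add: G_def[symmetric] coeff_pderiv)
qed (use assms in auto)

lemma norm_ipoly_le:
  fixes F :: "int poly"
  assumes "\<And>i. i \<ge> N \<Longrightarrow> coeff F i = 0" "\<And>i. \<bar>coeff F i\<bar> \<le> int H"
  shows "norm (ipoly F z) \<le> real (N * H) * max 1 (norm z) ^ N"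
proof -
  have "ipoly F z = (\<Sum>i\<in>{..<N}. of_int (coeff F i) * z ^ i)"
    unfolding ipoly_altdef
  proof (rule sum.mono_neutral_cong)
    fix i assume "i \<in> {..<N} - {..degree F}"
    then show "of_int (coeff F i) * z ^ i = 0" by (simp add: coeff_eq_0)
  qed (use assms(1) in auto)
  also have "norm \<dots> \<le> (\<Sum>i\<in>{..<N}. real H * max 1 (norm z) ^ N)"
  proof (rule sum_norm_le)
    fix i assume i: "i \<in> {..<N}"
    have "\<bar>real_of_int (coeff F i)\<bar> \<le> real H" using assms(2)[of i] by linarith
    moreover have "norm z ^ i \<le> max 1 (norm z) ^ N"
      using i power_mono[of "norm z" "max 1 (norm z)" i] power_increasing[of i N "max 1 (norm z)"] by auto
    ultimately show "norm (of_int (coeff F i) * z ^ i) \<le> real H * max 1 (norm z) ^ N"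
      by (simp add: norm_mult norm_power mult_mono)
  qed
  finally show ?thesis by simp
qed

section \<open>The auxiliary polynomial\<close>

text \<open>For integral x the polynomial \<open>min_poly x\<close> is monic with integer
  coefficients, and this is its Mahler measure.\<close>

definition mahler :: "complex \<Rightarrow> real" where
  "mahler x = (\<Prod>y\<in>orb x. max 1 (norm y))"

lemma mahler_ge_1: "mahler x \<ge> 1"
  unfolding mahler_def by (rule prod_ge_1) simp

text \<open>If the integer z were nonzero, the product would have absolute value at least B^D,
  whereas the estimates give at most A^D M^E < (2 A)^D \<le> B^D for A > 0, with M the Mahler
  measure. The factor 2 pays for M^E.\<close>

lemma exists_zero_conjugate:
  fixes A :: real and B :: nat
  assumes x: "algebraic x" and z: "z \<in> \<int>" "(\<Prod>y\<in>orb x. \<phi> y) = of_nat B ^ card (orb x) * z"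
    and bound: "\<And>y. y \<in> orb x \<Longrightarrow> norm (\<phi> y) \<le> A * max 1 (norm y) ^ E"
    and A: "0 \<le> A" "2 * A \<le> real B" "B > 0" and E: "mahler x ^ E < 2 ^ card (orb x)"
  shows "\<exists>y\<in>orb x. \<phi> y = (0::complex)"
proof -
  let ?D = "card (orb x)"
  obtain k where k: "z = of_int k" using z(1) by (rule Ints_cases)
  have "real B ^ ?D * \<bar>real_of_int k\<bar> = norm (\<Prod>y\<in>orb x. \<phi> y)" unfolding z(2) k by (simp add: norm_mult norm_power)
  also have "\<dots> = (\<Prod>y\<in>orb x. norm (\<phi> y))" by (rule prod_norm[symmetric])
  also have "\<dots> \<le> (\<Prod>y\<in>orb x. A * max 1 (norm y) ^ E)" by (intro prod_mono) (use bound in auto)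
  also have "\<dots> = A ^ ?D * mahler x ^ E" by (simp add: prod.distrib mahler_def prod_power_distrib)
  finally have 1: "real B ^ ?D * \<bar>real_of_int k\<bar> \<le> A ^ ?D * mahler x ^ E" .
  have "k = 0"
  proof (rule ccontr)
    assume "k \<noteq> 0"
    then have "\<bar>real_of_int k\<bar> \<ge> 1" by linarith
    then have "real B ^ ?D * 1 \<le> real B ^ ?D * \<bar>real_of_int k\<bar>" by (intro mult_left_mono) auto
    then have 2: "real B ^ ?D \<le> A ^ ?D * mahler x ^ E" using 1 by linarith
    show False
    proof (cases "A = 0")
      case True
      then have "real B ^ ?D \<le> 0" using 2 card_orb_pos[OF x] by (simp add: zero_power)
      moreover have "real B ^ ?D > 0" using A(3) by simp
      ultimately show False by linarith
    next
      case False
      then have "A ^ ?D * mahler x ^ E < A ^ ?D * 2 ^ ?D" using E A by (intro mult_strict_left_mono) auto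
      also have "\<dots> = (2 * A) ^ ?D" by (simp add: power_mult_distrib)
      also have "\<dots> \<le> real B ^ ?D" using A by (intro power_mono) auto
      finally show False using 2 by simp
    qed
  qed
  then have "(\<Prod>y\<in>orb x. \<phi> y) = 0" using z(2) k by simp
  then show ?thesis using finite_orb[OF x] by simp
qed

lemma ipoly_zero_all_conjugates:
  assumes x: "algebraic x" and "y \<in> orb x" "ipoly F (y ^ m) = 0" and z: "z \<in> orb x"
  shows "ipoly F (z ^ m) = 0"
proof -
  have ya: "algebraic y" using orb_algebraic[OF x assms(2)] .
  have "z \<in> orb y" using orb_eq[OF x assms(2)] z by simp
  then obtain g where g: "g \<in> Gal" "z = g y" by (auto simp: orb_def)
  have "ipoly F (z ^ m) = g (ipoly F (y ^ m))"
    using gal_ipoly[OF g(1), of "y ^ m"] gal_power[OF g(1) ya] ya g(2) by simp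
  then show ?thesis using assms(3) gal_0[OF g(1)] by simp
qed

lemma monic_division:
  fixes F g :: "int poly"
  assumes "lead_coeff g = 1"
  obtains q r where "F = g * q + r" "\<And>i. i \<ge> degree g \<Longrightarrow> coeff r i = 0"
proof -
  obtain q r where qr: "pseudo_divmod F g = (q, r)" by (cases "pseudo_divmod F g")
  have g: "g \<noteq> 0" using assms by auto
  have "F = g * q + r" using pseudo_divmod(1)[OF g qr] assms by simp
  moreover have "coeff r i = 0" if "i \<ge> degree g" for i
    using pseudo_divmod(2)[OF g qr] that by (auto intro: coeff_eq_0)
  ultimately show ?thesis using that by blast
qed

text \<open>Siegel's lemma in congruence form. Two polynomials with coefficients in {0..H} agree
  modulo g and l, and F is their difference. As g is monic, the classes are given by remainders with
  coefficients modulo l, so there are at most l^(degree g) of them. Exact vanishing is forced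
  afterwards by size.\<close>

lemma box_congruence:
  fixes g :: "int poly"
  assumes g: "lead_coeff g = 1" and l: "l > 0" and big: "l ^ degree g < (H + 1) ^ N"
  obtains F S R :: "int poly" where "F \<noteq> 0" "\<And>i. i \<ge> N \<Longrightarrow> coeff F i = 0" "\<And>i. \<bar>coeff F i\<bar> \<le> int H"
    "F = g * S + smult (int l) R"
proof -
  let ?C = "PiE {..<N} (\<lambda>_. {0..int H})"
  define P where "P c = (\<Sum>i<N. monom (c i) i)" for c :: "nat \<Rightarrow> int"
  have coP: "coeff (P c) i = (if i < N then c i else 0)" for c i by (simp add: P_def coeff_sum)
  have "\<forall>c. \<exists>w. P c = g * fst w + snd w \<and> (\<forall>i\<ge>degree g. coeff (snd w) i = 0)"
  proof
    fix c
    obtain q r where "P c = g * q + r" "\<And>i. i \<ge> degree g \<Longrightarrow> coeff r i = 0"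
      using monic_division[OF g] by blast
    then show "\<exists>w. P c = g * fst w + snd w \<and> (\<forall>i\<ge>degree g. coeff (snd w) i = 0)"
      by (intro exI[of _ "(q, r)"]) simp
  qed
  then obtain w where w: "\<And>c. P c = g * fst (w c) + snd (w c)" "\<And>c i. i \<ge> degree g \<Longrightarrow> coeff (snd (w c)) i = 0"
    using choice by metis
  define q r where "q c = fst (w c)" and "r c = snd (w c)" for c
  have qr: "P c = g * q c + r c" for c using w(1) by (simp add: q_def r_def)
  have qr2: "coeff (r c) i = 0" if "i \<ge> degree g" for c i using w(2) that by (simp add: r_def)
  define \<Phi> where "\<Phi> c = restrict (\<lambda>j. coeff (r c) j mod int l) {..<degree g}" for c
  have "\<Phi> c \<in> PiE {..<degree g} (\<lambda>_. {0..<int l})" for c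
    unfolding \<Phi>_def restrict_PiE_iff using l by simp
  then have "\<Phi> ` ?C \<subseteq> PiE {..<degree g} (\<lambda>_. {0..<int l})" by (rule image_subsetI)
  then have "card (\<Phi> ` ?C) \<le> card (PiE {..<degree g} (\<lambda>_. {0..<int l}))" by (intro card_mono finite_PiE) auto
  also have "\<dots> = l ^ degree g" by (simp add: card_PiE)
  also have "\<dots> < (H + 1) ^ N" by (rule big)
  also have "\<dots> = card ?C" by (simp add: card_PiE nat_add_distrib)
  finally have "\<not> inj_on \<Phi> ?C" by (rule pigeonhole)
  then obtain c d where cd: "c \<in> ?C" "d \<in> ?C" "c \<noteq> d" "\<Phi> c = \<Phi> d" unfolding inj_on_def by blast
  define F where "F = P c - P d"
  have coF: "coeff F i = (if i < N then c i - d i else 0)" for i by (simp add: F_def coP)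
  obtain i where i: "i < N" "c i \<noteq> d i"
    using PiE_ext[OF cd(1,2)] cd(3) by blast
  then have "coeff F i \<noteq> 0" by (simp add: coF)
  then have "F \<noteq> 0" by auto
  moreover have "\<bar>coeff F i\<bar> \<le> int H" for i
  proof (cases "i < N")
    case True
    then have "c i \<in> {0..int H}" "d i \<in> {0..int H}"
      using PiE_mem[OF cd(1), of i] PiE_mem[OF cd(2), of i] by simp_all
    then show ?thesis using True by (auto simp: coF)
  qed (simp add: coF)
  moreover have "[:int l:] dvd r c - r d"
    unfolding const_poly_dvd_iff
  proof
    fix n
    show "int l dvd coeff (r c - r d) n"
    proof (cases "n < degree g")
      case True
      then have "coeff (r c) n mod int l = coeff (r d) n mod int l" using fun_cong[OF cd(4), of n] by (simp add: \<Phi>_def)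
      then show ?thesis by (simp add: mod_eq_dvd_iff)
    qed (simp add: qr2)
  qed
  then obtain R where R: "r c - r d = smult (int l) R" by (auto elim!: dvdE)
  have "F = g * (q c - q d) + smult (int l) R" unfolding R[symmetric] F_def using qr[of c] qr[of d] by (simp add: algebra_simps)
  moreover have "coeff F i = 0" if "i \<ge> N" for i using that by (simp add: coF)
  ultimately show ?thesis by (intro that[of F "q c - q d" R])
qed

text \<open>The left side is at most 21 N^(k + 1), and k + 1 \<ge> 2 factors 10 exceed 21. This is
  where the 10 in the coefficient bound 10 N comes from.\<close>

lemma siegel_bound:
  fixes k N :: nat
  assumes k: "k \<ge> 1" and N: "N \<ge> 1"
  shows "2 * (10 * N) * N ^ k + 1 < (10 * N + 1) ^ (k + 1)"
proof -
  have "2 * (10 * N) * N ^ k + 1 \<le> 2 * (10 * N) * N ^ k + N * N ^ k" using N by (simp add: Suc_leI)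
  also have "\<dots> = 21 * N ^ (k + 1)" by simp
  also have "21 * N ^ (k + 1) < 10 ^ 2 * N ^ (k + 1)"
    using N by (intro mult_strict_right_mono) auto
  also have "10 ^ 2 * N ^ (k + 1) \<le> 10 ^ (k + 1) * N ^ (k + 1)" using k by (intro mult_right_mono power_increasing) auto
  also have "\<dots> = (10 * N) ^ (k + 1)" by (rule power_mult_distrib[symmetric])
  also have "\<dots> \<le> (10 * N + 1) ^ (k + 1)" by (intro power_mono) auto
  finally show ?thesis .
qed

text \<open>There are k D residues modulo l to match and (k + 1) k D coefficients to choose, so the
  box principle asks for \<open>l < (H + 1) ^ (k + 1)\<close>. The derivatives of F of order below k
  are then multiples of l at the conjugates, and their norms are too small to be anything but
  zero.\<close>

lemma auxiliary_polynomial: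
  fixes k :: nat
  assumes x: "integral_conj x" and k: "k \<ge> 1" and f: "map_poly of_int f = min_poly x" "lead_coeff f = 1" "degree f = card (orb x)"
  defines "N \<equiv> k * (k + 1) * card (orb x)"
  assumes M: "mahler x ^ N < 2 ^ card (orb x)"
  obtains F G :: "int poly" where "F \<noteq> 0" "\<And>i. i \<ge> N \<Longrightarrow> coeff F i = 0" "\<And>i. \<bar>coeff F i\<bar> \<le> int (10 * N)"
    "F = f ^ k * G"
proof -
  let ?D = "card (orb x)"
  have xa: "algebraic x" using integral_conj_algebraic[OF x] .
  have D: "?D > 0" using card_orb_pos[OF xa] .
  then have N: "N \<ge> 1" using k by (simp add: N_def Suc_le_eq)
  define H where "H = 10 * N"
  \<comment> \<open>Above twice H N^k, which bounds N times the coefficients of the derivatives of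
    order below k, as \<open>exists_zero_conjugate\<close> requires.\<close>
  define l where "l = 2 * H * N ^ k + 1"
  have "f \<noteq> 0" using f(2) by auto
  then have fk2: "degree (f ^ k) = k * ?D"
    using f(3) by (simp add: degree_power_eq)
  moreover have "lead_coeff (f ^ k) = 1" by (simp only: lead_coeff_power f(2) power_one)
  ultimately have fk: "lead_coeff (f ^ k) = 1" "degree (f ^ k) = k * ?D" by blast+
  have "l < (H + 1) ^ (k + 1)" unfolding l_def H_def by (rule siegel_bound[OF k N])
  then have "l ^ (k * ?D) < ((H + 1) ^ (k + 1)) ^ (k * ?D)" using D k by (intro power_strict_mono) auto
  then have big: "l ^ degree (f ^ k) < (H + 1) ^ N" 
    unfolding fk(2) N_def power_mult[symmetric] by (simp add: algebra_simps)
  obtain F S R :: "int poly" where F: "F \<noteq> 0" "\<And>i. i \<ge> N \<Longrightarrow> coeff F i = 0" "\<And>i. \<bar>coeff F i\<bar> \<le> int H"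
    "F = f ^ k * S + smult (int l) R"
    by (rule box_congruence[OF fk(1) _ big]) (auto simp: l_def)
  have root: "ipoly f y = 0" if "y \<in> orb x" for y
    using min_poly_root[OF xa that] f(1) by (simp add: ipoly_def)
  have vanish: "ipoly ((pderiv ^^ j) F) y = 0" if j: "j < k" and y: "y \<in> orb x" for j y
  proof -
    let ?F = "(pderiv ^^ j) F" and ?R = "(pderiv ^^ j) R"
    have "f dvd f ^ (k - j)" using j by (intro dvd_power) auto
    also have "f ^ (k - j) dvd (pderiv ^^ j) (f ^ k * S)" using j by (intro power_dvd_pderiv_funpow) auto
    finally obtain T where T: "(pderiv ^^ j) (f ^ k * S) = f * T" by (auto elim!: dvdE)
    have Fj: "?F = f * T + smult (int l) ?R"
      by (subst F(4)) (simp add: pderiv_funpow_add pderiv_funpow_smult T)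
    have eq: "ipoly ?F z = of_nat l * ipoly ?R z" if "z \<in> orb x" for z
      using root[OF that] by (simp add: Fj ipoly_add ipoly_mult ipoly_smult)
    have "\<exists>y\<in>orb x. ipoly ?F y = 0"
    proof (rule exists_zero_conjugate[OF xa, of _ _ l "real (N * (H * N ^ j))" N])
      show "(\<Prod>y\<in>orb x. ipoly ?R (y ^ 1)) \<in> \<int>" by (rule norm_ipoly_Ints[OF x])
      show "(\<Prod>y\<in>orb x. ipoly ?F y) = of_nat l ^ ?D * (\<Prod>y\<in>orb x. ipoly ?R (y ^ 1))"
        by (simp add: eq prod.distrib)
      show "norm (ipoly ?F z) \<le> real (N * (H * N ^ j)) * max 1 (norm z) ^ N" for z
        by (rule norm_ipoly_le) (use coeff_pderiv_funpow_bound[where j = j, OF F(2,3)] in auto)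
      have "N * (H * N ^ j) = H * N ^ Suc j" by simp
      also have "\<dots> \<le> H * N ^ k" using j N by (intro mult_left_mono power_increasing) auto
      finally have "2 * (N * (H * N ^ j)) \<le> l" unfolding l_def mult.assoc by linarith
      then show "2 * real (N * (H * N ^ j)) \<le> real l" by linarith
    qed (use M in \<open>auto simp: l_def\<close>)
    then show ?thesis using ipoly_zero_all_conjugates[OF xa _ _ y, of _ ?F 1] by auto
  qed
  define cF :: "complex poly" where "cF = map_poly of_int F"
  have cF0: "cF \<noteq> 0" using F(1) unfolding cF_def by (simp add: map_poly_eq_0_iff)
  have "[:-y, 1:] ^ k dvd cF" if "y \<in> orb x" for y
    by (rule linear_power_dvd_if_derivs)
       (use vanish[OF _ that] in \<open>simp add: cF_def pderiv_funpow_map_of_int ipoly_def\<close>)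
  then have dv: "min_poly x ^ k dvd cF"
    unfolding min_poly_def by (intro prod_linear_power_dvd finite_orb[OF xa] cF0) auto
  \<comment> \<open>So far f^k divides F over the complex numbers. Division by the monic f^k over
    the integers leaves a remainder that is a multiple of f^k of smaller degree, hence zero, so the
    quotient has integer coefficients.\<close>
  obtain q r where qr: "F = f ^ k * q + r" "\<And>i. i \<ge> degree (f ^ k) \<Longrightarrow> coeff r i = 0"
    using monic_division[OF fk(1)] by blast
  have "r = 0"
  proof (rule ccontr)
    assume r: "r \<noteq> 0"
    have "cF = min_poly x ^ k * map_poly of_int q + map_poly of_int r"
      unfolding cF_def qr(1) by (simp add: map_poly_of_int_add map_poly_of_int_mult map_poly_of_int_power f(1))
    then have "min_poly x ^ k dvd map_poly of_int r" using dv by (simp add: dvd_add_right_iff)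
    then have "degree (min_poly x ^ k) \<le> degree (map_poly of_int r :: complex poly)"
      using r by (intro dvd_imp_degree_le) (auto simp: map_poly_eq_0_iff)
    then have "degree (f ^ k) \<le> degree r"
      using fk(2) degree_min_poly[OF xa] min_poly_nz[of x] by (simp add: degree_power_eq degree_map_poly)
    then show False using qr(2)[of "degree r"] r by simp
  qed
  then have "F = f ^ k * q" using qr(1) by simp
  then show ?thesis using that[OF F(1,2)] F(3) unfolding H_def by blast
qed

text \<open>By \<open>pcompose_power_prime\<close>, F(y^p) = p^k h(y)^k G(y^p), so p^k plays the
  part of B in \<open>exists_zero_conjugate\<close>. Evaluation at a p-th power raises the exponent
  of the Mahler measure from N to p N.\<close>

lemma auxiliary_polynomial_vanishes:
  assumes x: "integral_conj x" and f: "map_poly of_int f = min_poly x"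
    and F: "\<And>i. i \<ge> N \<Longrightarrow> coeff F i = 0" "\<And>i. \<bar>coeff F i\<bar> \<le> int H" "F = f ^ k * G"
    and p: "prime p" "2 * N * H \<le> p ^ k" and M: "mahler x ^ (p * N) < 2 ^ card (orb x)"
    and y: "y \<in> orb x"
  shows "ipoly F (y ^ p) = 0"
proof -
  let ?D = "card (orb x)"
  have xa: "algebraic x" using integral_conj_algebraic[OF x] .
  obtain h where h: "pcompose f (monom 1 p) = f ^ p + of_nat p * h" using pcompose_power_prime[OF p(1)] by blast
  have hp: "ipoly f (z ^ p) = of_nat p * ipoly h z" if "z \<in> orb x" for z
  proof -
    have "map_poly of_int (pcompose f (monom 1 p)) = (pcompose (map_poly of_int f) (monom 1 p) :: complex poly)"
      by (induction f) (simp_all add: pcompose_pCons map_poly_pCons map_poly_of_int_add map_poly_of_int_mult map_poly_monom)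
    then have "ipoly (pcompose f (monom 1 p)) z = ipoly f (z ^ p)"
      by (simp add: ipoly_def poly_pcompose poly_monom)
    moreover have "ipoly f z = 0" using min_poly_root[OF xa that] f by (simp add: ipoly_def)
    moreover have "ipoly (of_nat p * h) z = of_nat p * ipoly h z"
      by (simp add: of_nat_poly ipoly_smult)
    ultimately show ?thesis using prime_gt_0_nat[OF p(1)] by (simp add: h ipoly_add ipoly_power zero_power)
  qed
  have "\<exists>y\<in>orb x. ipoly F (y ^ p) = 0"
  proof (rule exists_zero_conjugate[OF xa, of _ _ "p ^ k" "real (N * H)" "p * N"])
    show "(\<Prod>y\<in>orb x. ipoly h (y ^ 1)) ^ k * (\<Prod>y\<in>orb x. ipoly G (y ^ p)) \<in> \<int>"
      by (intro Ints_mult Ints_power norm_ipoly_Ints[OF x])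
    have "(\<Prod>y\<in>orb x. ipoly F (y ^ p)) = (\<Prod>y\<in>orb x. of_nat (p ^ k) * (ipoly h y ^ k * ipoly G (y ^ p)))"
      by (rule prod.cong) (simp_all add: F(3) ipoly_mult ipoly_power hp power_mult_distrib)
    then show "(\<Prod>y\<in>orb x. ipoly F (y ^ p)) = of_nat (p ^ k) ^ ?D * ((\<Prod>y\<in>orb x. ipoly h (y ^ 1)) ^ k * (\<Prod>y\<in>orb x. ipoly G (y ^ p)))"
      by (simp add: prod.distrib prod_power_distrib)
    show "norm (ipoly F (z ^ p)) \<le> real (N * H) * max 1 (norm z) ^ (p * N)" for z
    proof -
      have "norm (ipoly F (z ^ p)) \<le> real (N * H) * max 1 (norm (z ^ p)) ^ N" by (rule norm_ipoly_le[OF F(1,2)])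
      moreover have "max 1 (norm (z ^ p)) \<le> max 1 (norm z) ^ p"
        by (auto simp: norm_power one_le_power power_mono)
      then have "real (N * H) * max 1 (norm (z ^ p)) ^ N \<le> real (N * H) * (max 1 (norm z) ^ p) ^ N"
        by (intro mult_left_mono power_mono) auto
      ultimately show ?thesis unfolding power_mult by linarith
    qed
    show "2 * real (N * H) \<le> real (p ^ k)" using p(2) by (metis mult.assoc of_nat_le_iff of_nat_mult of_nat_numeral)
  qed (use M prime_gt_0_nat[OF p(1)] in auto)
  then show ?thesis using ipoly_zero_all_conjugates[OF xa _ _ y] by blast
qed

section \<open>Prime powers of conjugates\<close>

text \<open>If y^p = (g y)^q, iteration gives (g^n y)^(q^n) = y^(p^n). For n a period of y under g
  this becomes y^(q^n) = y^(p^n), so y and with it x would be a root of unity.\<close>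

lemma conj_powers_distinct:
  assumes x: "algebraic x" "x \<noteq> 0" and nru: "\<And>n. n > 0 \<Longrightarrow> x ^ n \<noteq> 1"
    and yz: "y \<in> orb x" "z \<in> orb x" and pq: "p \<noteq> q"
  shows "y ^ p \<noteq> z ^ q"
proof
  assume eq: "y ^ p = z ^ q"
  have ya: "algebraic y" using orb_algebraic[OF x(1) yz(1)] .
  obtain g where g: "g \<in> Gal" "z = g y" using orb_eq[OF x(1) yz(1)] yz(2) by (auto simp: orb_def)
  have gn: "algebraic ((g ^^ n) y)" for n using gal_algebraic[OF gal_funpow[OF g(1)] ya] .
  have it: "((g ^^ n) y) ^ (q ^ n) = y ^ (p ^ n)" for n
  proof (induction n)
    case (Suc n)
    have "((g ^^ Suc n) y) ^ (q ^ Suc n) = (g ((g ^^ n) y) ^ (q ^ n)) ^ q" by (simp add: power_mult[symmetric] mult.commute)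
    also have "g ((g ^^ n) y) ^ (q ^ n) = g (((g ^^ n) y) ^ (q ^ n))" using gal_power[OF g(1) gn] by simp
    also have "\<dots> = g (y ^ (p ^ n))" by (simp only: Suc)
    also have "\<dots> = z ^ (p ^ n)" using gal_power[OF g(1) ya] g(2) by simp
    also have "(z ^ (p ^ n)) ^ q = (z ^ q) ^ (p ^ n)" by (simp add: power_mult[symmetric] mult.commute)
    also have "\<dots> = y ^ (p ^ Suc n)" by (simp add: eq[symmetric] power_mult[symmetric])
    finally show ?case .
  qed simp
  obtain n where n: "n > 0" "(g ^^ n) y = y" using gal_periodic[OF ya g(1)] .
  have yy: "y ^ (q ^ n) = y ^ (p ^ n)" using it[of n] n(2) by simp
  obtain u where u: "u \<in> Gal" "y = u x" using yz(1) by (auto simp: orb_def)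
  have y0: "y \<noteq> 0" using gal_eq_0_iff[OF u(1) x(1)] x(2) u(2) by simp
  have pqn: "p ^ n \<noteq> q ^ n" using pq n(1) by (simp add: power_eq_iff_eq_base)
  have "\<exists>m>0. y ^ m = 1"
  proof (cases "p ^ n < q ^ n")
    case True
    then have "y ^ (p ^ n) * y ^ (q ^ n - p ^ n) = y ^ (p ^ n) * 1" using yy by (simp add: power_add[symmetric])
    then show ?thesis using y0 True by (intro exI[of _ "q ^ n - p ^ n"]) simp
  next
    case False
    then have "q ^ n + (p ^ n - q ^ n) = p ^ n" by simp
    then have "y ^ (q ^ n) * y ^ (p ^ n - q ^ n) = y ^ (q ^ n) * 1" using yy by (metis mult.right_neutral power_add)
    then show ?thesis using y0 False pqn by (intro exI[of _ "p ^ n - q ^ n"]) simp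
  qed
  then obtain m where m: "m > 0" "y ^ m = 1" by blast
  have "u (x ^ m) = u 1" using m(2) u gal_power[OF u(1) x(1)] gal_1[OF u(1)] by simp
  then have "x ^ m = 1" using gal_inj[OF u(1), of "x ^ m" 1] x(1) by simp
  then show False using nru m(1) by blast
qed

text \<open>At such a prime the p-th powers of the conjugates collide and provide too few zeros of
  F, so it has to be discarded.\<close>

definition noninjective_power :: "complex \<Rightarrow> nat \<Rightarrow> bool" where
  "noninjective_power x p \<longleftrightarrow> (\<exists>y\<in>orb x. \<exists>z\<in>orb x. y \<noteq> z \<and> y ^ p = z ^ p)"

lemma coprime_powers_eq_1:
  fixes a :: complex
  assumes "a ^ m = 1" "a ^ n = 1" "coprime m n" "m > 0" shows "a = 1"
proof -
  obtain u v where uv: "m * u = n * v + 1" using bezout_nat[of m n] assms(3,4) by (auto simp: coprime_iff_gcd_eq_1)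
  have "1 = a ^ (m * u)" using assms(1) by (simp add: power_mult)
  also have "\<dots> = a" unfolding uv power_add using assms(2) by (simp add: power_mult)
  finally show ?thesis by simp
qed

text \<open>Moving a single collision around by \<open>Gal\<close> shows that every fibre of the
  p-th power map on the orbit has at least two elements.\<close>

lemma card_orb_halves:
  assumes w: "algebraic w" and bad: "noninjective_power w p"
  shows "2 * card (orb (w ^ p)) \<le> card (orb w)"
proof -
  obtain w1 w2 where w12: "w1 \<in> orb w" "w2 \<in> orb w" "w1 \<noteq> w2" "w1 ^ p = w2 ^ p"
    using bad by (auto simp: noninjective_power_def)
  have alg: "algebraic w1" "algebraic w2" using w12 orb_algebraic[OF w] by auto
  have img: "orb (w ^ p) = (\<lambda>a. a ^ p) ` orb w"
    unfolding orb_def image_image by (rule image_cong) (simp_all add: gal_power w)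
  have two: "2 \<le> card {a \<in> orb w. a ^ p = u}" if u: "u \<in> orb (w ^ p)" for u
  proof -
    obtain b where b: "b \<in> orb w" "u = b ^ p" using u img by auto
    obtain h where h: "h \<in> Gal" "b = h w1" using orb_eq[OF w w12(1)] b(1) by (auto simp: orb_def)
    have "h w1 ^ p = h w2 ^ p"
      using gal_power[OF h(1) alg(1), of p] gal_power[OF h(1) alg(2), of p] w12(4) by simp
    moreover have "h w1 \<noteq> h w2" using gal_inj[OF h(1) alg] w12(3) by simp
    ultimately have "card {h w1, h w2} = 2" "{h w1, h w2} \<subseteq> {a \<in> orb w. a ^ p = u}"
      using b h gal_orb[OF h(1)] w12 by auto
    then show ?thesis using card_mono[of "{a \<in> orb w. a ^ p = u}" "{h w1, h w2}"] finite_orb[OF w] by simp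
  qed
  have "2 * card (orb (w ^ p)) = (\<Sum>u\<in>orb (w ^ p). 2)" by simp
  also have "\<dots> \<le> (\<Sum>u\<in>orb (w ^ p). card {a \<in> orb w. a ^ p = u})" by (rule sum_mono) (rule two)
  also have "\<dots> = card (orb w)"
    using sum.image_gen[OF finite_orb[OF w], of "\<lambda>_. 1::nat" "\<lambda>a. a ^ p"] by (simp add: img)
  finally show ?thesis .
qed

text \<open>Raise x to the primes of S one after another. A collision y^p = z^p survives in the
  power reached so far, because y / z is a p-th root of unity other than 1 and the exponent used so
  far is coprime to p. Each prime therefore halves the degree, and S has at most log_2 D
  elements.\<close>

lemma card_noninjective_primes:
  assumes x: "algebraic x" "x \<noteq> 0" and S: "finite S" "\<And>p. p \<in> S \<Longrightarrow> prime p \<and> noninjective_power x p"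
  shows "2 ^ card S * card (orb (x ^ \<Prod>S)) \<le> card (orb x)"
  using S
proof (induction S rule: finite_induct)
  case (insert p S)
  define w where "w = x ^ \<Prod>S"
  have wa: "algebraic w" using x by (simp add: w_def)
  have p: "prime p" "noninjective_power x p" using insert.prems by auto
  obtain y z where yz: "y \<in> orb x" "z \<in> orb x" "y \<noteq> z" "y ^ p = z ^ p" using p(2) by (auto simp: noninjective_power_def)
  have "coprime p q" if "q \<in> S" for q using insert.prems[of q] insert.hyps p(1) that by (metis insertCI primes_coprime)
  then have cop: "coprime p (\<Prod>S)" by (rule prod_coprime_right)
  have orbw: "v ^ \<Prod>S \<in> orb w" if v: "v \<in> orb x" for v
  proof -
    obtain u where u: "u \<in> Gal" "v = u x" using v by (auto simp: orb_def)
    then have "v ^ \<Prod>S = u w" using gal_power[OF u(1) x(1)] by (simp add: w_def)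
    then show ?thesis using u(1) by (auto simp: orb_def)
  qed
  have z0: "z \<noteq> 0"
  proof
    assume "z = 0"
    obtain u where u: "u \<in> Gal" "z = u x" using yz(2) by (auto simp: orb_def)
    then show False using gal_eq_0_iff[OF u(1) x(1)] x(2) \<open>z = 0\<close> by simp
  qed
  have "y ^ \<Prod>S \<noteq> z ^ \<Prod>S"
  proof
    assume "y ^ \<Prod>S = z ^ \<Prod>S"
    then have "(y / z) ^ \<Prod>S = 1" "(y / z) ^ p = 1" using yz(4) z0 by (simp_all add: power_divide)
    then have "y / z = 1" using coprime_powers_eq_1[of "y / z" p "\<Prod>S"] cop prime_gt_0_nat[OF p(1)] by blast
    then show False using yz(3) z0 by simp
  qed
  moreover have "(y ^ \<Prod>S) ^ p = (z ^ \<Prod>S) ^ p"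
    using yz(4) by (metis mult.commute power_mult)
  ultimately have "noninjective_power w p" unfolding noninjective_power_def using orbw yz(1,2) by blast
  then have "2 * card (orb (w ^ p)) \<le> card (orb w)" by (rule card_orb_halves[OF wa])
  moreover have "w ^ p = x ^ \<Prod>(insert p S)" using insert.hyps by (simp add: w_def power_mult[symmetric] mult.commute)
  ultimately have "2 ^ card S * (2 * card (orb (x ^ \<Prod>(insert p S)))) \<le> 2 ^ card S * card (orb (x ^ \<Prod>S))"
    by (simp add: w_def)
  also have "\<dots> \<le> card (orb x)" using insert by simp
  finally show ?case using insert.hyps by (simp add: mult_ac)
qed simp

section \<open>The lower bound for the Mahler measure\<close>

text \<open>At most b primes are noninjective. Each of the remaining k (k + 1) or more contributes D
  zeros of F, disjoint for distinct primes by \<open>conj_powers_distinct\<close>: at least N zeros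
  for a polynomial of degree below N. The 20 arises from 2 N (10 N), with 10 N the bound for the
  coefficients of F.\<close>

lemma mahler_lower_bound_primes:
  fixes k b B :: nat
  assumes x: "integral_conj x" "x \<noteq> 0" and nru: "\<And>n. n > 0 \<Longrightarrow> x ^ n \<noteq> 1" and k: "k \<ge> 1"
    and P: "finite P" "\<And>p. p \<in> P \<Longrightarrow> prime p \<and> p \<le> B \<and> 20 * (k * (k + 1) * card (orb x))\<^sup>2 \<le> p ^ k"
    and b: "card (orb x) < 2 ^ (b + 1)" and cP: "card P \<ge> k * (k + 1) + b"
  shows "real (k * (k + 1) * B) * ln (mahler x) \<ge> ln 2"
proof (rule ccontr)
  assume neg: "\<not> ?thesis"
  let ?D = "card (orb x)"
  define N where "N = k * (k + 1) * ?D"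
  have xa: "algebraic x" using integral_conj_algebraic[OF x(1)] .
  have D: "?D > 0" using card_orb_pos[OF xa] .
  have m1: "mahler x \<ge> 1" by (rule mahler_ge_1)
  have "card P > 0" using cP k by (metis add_gr_0 less_le_trans mult_pos_pos zero_less_one add_pos_pos less_one not_le)
  then obtain p0 where "p0 \<in> P" by fastforce
  then have B: "B \<ge> 1" using P(2)[of p0] prime_ge_1_nat[of p0] by auto
  have "ln (mahler x ^ (B * N)) = real ?D * (real (k * (k + 1) * B) * ln (mahler x))"
    using m1 by (simp add: ln_realpow N_def)
  also have "\<dots> < real ?D * ln 2" using neg D by (intro mult_strict_left_mono) auto
  also have "\<dots> = ln (2 ^ ?D)" by (simp add: ln_realpow)
  finally have "mahler x ^ (B * N) < 2 ^ ?D" using m1 by (subst (asm) ln_less_cancel_iff) auto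
  then have M: "mahler x ^ E < 2 ^ ?D" if "E \<le> B * N" for E
    using power_increasing[OF that m1] by linarith
  obtain f :: "int poly" where f: "map_poly of_int f = min_poly x" "lead_coeff f = 1" "degree f = ?D"
    using integral_min_poly[OF x(1)] .
  have "mahler x ^ N < 2 ^ ?D" using B by (intro M) simp
  then obtain F G :: "int poly" where F: "F \<noteq> 0" "\<And>i. i \<ge> N \<Longrightarrow> coeff F i = 0" "\<And>i. \<bar>coeff F i\<bar> \<le> int (10 * N)" "F = f ^ k * G"
    using auxiliary_polynomial[OF x(1) k f] unfolding N_def by metis
  have vanish: "ipoly F (y ^ p) = 0" if "p \<in> P" "y \<in> orb x" for p y
  proof (rule auxiliary_polynomial_vanishes[OF x(1) f(1) F(2,3,4) _ _ _ that(2)])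
    show "prime p" using P(2)[OF that(1)] by blast
    show "2 * N * (10 * N) \<le> p ^ k" using P(2)[OF that(1)] by (simp add: N_def power2_eq_square)
    show "mahler x ^ (p * N) < 2 ^ ?D" using P(2)[OF that(1)] by (intro M mult_right_mono) auto
  qed
  define bad where "bad = {p \<in> P. noninjective_power x p}"
  have "2 ^ card bad * card (orb (x ^ \<Prod>bad)) \<le> ?D"
    by (rule card_noninjective_primes[OF xa x(2)]) (use P in \<open>auto simp: bad_def\<close>)
  moreover have "card (orb (x ^ \<Prod>bad)) \<ge> 1" using card_orb_pos[of "x ^ \<Prod>bad"] xa by (simp add: Suc_le_eq)
  ultimately have "2 ^ card bad \<le> ?D" by (metis dual_order.trans mult.right_neutral mult_le_mono2)
  then have "(2::nat) ^ card bad < 2 ^ (b + 1)" using b by linarith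
  then have "card bad < b + 1" by (rule power_less_imp_less_exp[rotated]) simp
  then have cb: "card bad \<le> b" by simp
  define good where "good = P - bad"
  have "card good = card P - card bad" unfolding good_def using P(1) by (intro card_Diff_subset) (auto simp: bad_def)
  then have cg: "card good \<ge> k * (k + 1)" using cP cb by linarith
  have fg: "finite good" using P(1) by (simp add: good_def)
  have cd: "card ((\<lambda>y. y ^ p) ` orb x) = ?D" if "p \<in> good" for p
    by (rule card_image) (use that in \<open>auto simp: good_def bad_def noninjective_power_def inj_on_def\<close>)
  have "k * (k + 1) * ?D \<le> card good * ?D" using cg by simp
  also have "\<dots> = (\<Sum>p\<in>good. card ((\<lambda>y. y ^ p) ` orb x))" using cd by simp
  also have "\<dots> = card (\<Union>p\<in>good. (\<lambda>y. y ^ p) ` orb x)"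
  proof (rule card_UN_disjoint[symmetric, OF fg])
    show "\<forall>p\<in>good. finite ((\<lambda>y. y ^ p) ` orb x)" using finite_orb[OF xa] by simp
    show "\<forall>p\<in>good. \<forall>q\<in>good. p \<noteq> q \<longrightarrow> (\<lambda>y. y ^ p) ` orb x \<inter> (\<lambda>y. y ^ q) ` orb x = {}"
      using conj_powers_distinct[OF xa x(2) nru] by blast
  qed
  also have "\<dots> \<le> card {z. poly (map_poly of_int F :: complex poly) z = 0}"
  proof (rule card_mono)
    show "finite {z. poly (map_poly of_int F :: complex poly) z = 0}"
      using F(1) by (intro poly_roots_finite) (simp add: map_poly_eq_0_iff)
    show "(\<Union>p\<in>good. (\<lambda>y. y ^ p) ` orb x) \<subseteq> {z. poly (map_poly of_int F :: complex poly) z = 0}"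
      using vanish by (auto simp: good_def ipoly_def)
  qed
  also have "\<dots> \<le> degree (map_poly of_int F :: complex poly)"
    using F(1) by (intro card_poly_roots_bound) (simp add: map_poly_eq_0_iff)
  also have "\<dots> = degree F" by (simp add: degree_map_poly)
  also have "\<dots> < N"
  proof (rule ccontr)
    assume "\<not> degree F < N"
    then have "lead_coeff F = 0" using F(2) by simp
    then show False using F(1) by simp
  qed
  finally show False by (simp add: N_def)
qed

lemma ln_mahler: "algebraic x \<Longrightarrow> ln (mahler x) = (\<Sum>y\<in>orb x. log_plus (norm y))"
  unfolding mahler_def log_plus_def using finite_orb by (intro ln_prod) auto

section \<open>Counting primes\<close>

text \<open>The identity behind the induction is that of the Leibniz harmonic triangle,
  \<open>1 / (m (n choose m)) = 1 / (m (n - 1 choose m)) - 1 / ((m + 1) (n choose (m + 1)))\<close>.\<close>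

lemma leibniz_triangle_dvd:
  fixes L :: int
  assumes "m \<ge> 1" "\<And>i. i \<in> {1..m + d} \<Longrightarrow> int i dvd L"
  shows "\<exists>z. L = z * (int m * int ((m + d) choose m))"
  using assms
proof (induction d arbitrary: m)
  case 0
  then have "int m dvd L" by auto
  then show ?case by (auto elim!: dvdE)
next
  case (Suc d)
  define a where "a = int ((m + d) choose m)"
  define c where "c = int ((m + Suc d) choose m)"
  obtain z1 where z1: "L = z1 * (int m * a)" using Suc.IH[of m] Suc.prems unfolding a_def by auto
  obtain z2 where z2: "L = z2 * (int (Suc m) * int ((Suc m + d) choose Suc m))" using Suc.IH[of "Suc m"] Suc.prems by auto
  have n1: "Suc m * (Suc (m + d) choose Suc m) = Suc (m + d) * ((m + d) choose m)" by (rule Suc_times_binomial)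
  have e1: "int (Suc m) * int ((Suc m + d) choose Suc m) = int (Suc (m + d)) * a"
    by (simp only: a_def of_nat_mult[symmetric] add_Suc n1)
  have n2: "Suc d * ((m + Suc d) choose m) = Suc (m + d) * ((m + d) choose m)"
    using binomial_absorb_comp[of "m + Suc d" m] by simp
  have e2: "int (Suc d) * c = int (Suc (m + d)) * a"
    by (simp only: a_def c_def of_nat_mult[symmetric] n2)
  have "int (Suc d) * ((z1 - z2) * (int m * c)) = (z1 - z2) * int m * (int (Suc d) * c)" by (simp add: algebra_simps)
  also have "\<dots> = int (Suc (m + d)) * (z1 * (int m * a)) - int m * (z2 * (int (Suc (m + d)) * a))"
    unfolding e2 by (simp add: algebra_simps)
  also have "\<dots> = int (Suc (m + d)) * L - int m * L"
    by (simp only: z1[symmetric] z2[unfolded e1, symmetric])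
  also have "\<dots> = int (Suc d) * L" by (simp add: algebra_simps)
  finally have "(z1 - z2) * (int m * c) = L" by simp
  then show ?case unfolding c_def by metis
qed

definition prime_count :: "nat \<Rightarrow> nat" where
  "prime_count n = card {p. prime p \<and> p \<le> n}"

text \<open>L is the least common multiple: its p-part is the p-part of some i \<le> n, hence itself
  at most n.\<close>

lemma common_multiple_bound:
  assumes n: "n \<ge> (1::nat)"
  obtains L :: nat where "L > 0" "\<And>i. i \<in> {1..n} \<Longrightarrow> i dvd L" "L \<le> n ^ prime_count n"
proof -
  let ?P = "{p. prime p \<and> p \<le> n}"
  have fin: "finite ?P" by (rule finite_subset[of _ "{..n}"]) auto
  define e where "e p = Max ((\<lambda>i. multiplicity p i) ` {1..n})" for p
  define L where "L = (\<Prod>p\<in>?P. p ^ e p)"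
  have "i dvd L" if i: "i \<in> {1..n}" for i
  proof -
    have "i = (\<Prod>p\<in>prime_factors i. p ^ multiplicity p i)"
      using prod_prime_factors[of i] i by simp
    also have "\<dots> = (\<Prod>p\<in>?P. p ^ multiplicity p i)"
    proof (rule prod.mono_neutral_left[OF fin])
      show "prime_factors i \<subseteq> ?P" using i by (auto simp: in_prime_factors_iff dest!: dvd_imp_le)
      show "\<forall>p\<in>?P - prime_factors i. p ^ multiplicity p i = 1"
        using i by (auto simp: in_prime_factors_iff not_dvd_imp_multiplicity_0)
    qed
    also have "\<dots> dvd L"
      unfolding L_def
    proof (rule prod_dvd_prod)
      fix p
      have "multiplicity p i \<le> e p" unfolding e_def using i by (intro Max_ge) auto
      then show "p ^ multiplicity p i dvd p ^ e p" by (rule le_imp_power_dvd)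
    qed
    finally show ?thesis .
  qed
  moreover have "L > 0" unfolding L_def by (intro prod_pos) (auto intro: prime_gt_0_nat)
  moreover have "L \<le> (\<Prod>p\<in>?P. n)"
    unfolding L_def
  proof (rule prod_mono)
    fix p
    have "e p \<in> (\<lambda>i. multiplicity p i) ` {1..n}" unfolding e_def using n by (intro Max_in) auto
    then obtain i where i: "i \<in> {1..n}" "e p = multiplicity p i" by blast
    have "p ^ e p dvd i" unfolding i(2) by (rule multiplicity_dvd)
    then show "0 \<le> p ^ e p \<and> p ^ e p \<le> n" using i(1) by (auto dest: dvd_imp_le)
  qed
  ultimately show ?thesis by (intro that[of L]) (auto simp: prime_count_def)
qed

text \<open>Chebyshev's estimate by Nair's method. The number m (2 m choose m) divides a common
  multiple of 1, ..., 2 m that is at most \<open>(2 * m) ^ prime_count (2 * m)\<close>, and it is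
  itself at least 4^m / 2 \<ge> 2^m.\<close>

lemma prime_count_lower_bound:
  assumes m: "m \<ge> (1::nat)"
  shows "real (prime_count (2 * m)) * ln (real (2 * m)) \<ge> real m * ln 2"
proof -
  obtain L where L: "L > 0" "\<And>i. i \<in> {1..2 * m} \<Longrightarrow> i dvd L" "L \<le> (2 * m) ^ prime_count (2 * m)"
    using common_multiple_bound[of "2 * m"] m by auto
  obtain z where z: "int L = z * (int m * int ((m + m) choose m))"
    using leibniz_triangle_dvd[of m m "int L"] m L(2) by (auto simp: mult_2)
  have "z > 0"
  proof (rule ccontr)
    assume "\<not> z > 0"
    then have "z * (int m * int ((m + m) choose m)) \<le> 0" by (intro mult_nonpos_nonneg) auto
    then show False using z L(1) by simp
  qed
  then have "1 * (int m * int ((m + m) choose m)) \<le> int L" unfolding z by (intro mult_right_mono) auto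
  then have 1: "m * ((2 * m) choose m) \<le> L" unfolding mult_2 by (simp only: mult_1 of_nat_mult[symmetric] of_nat_le_iff)
  have "(2::real) ^ m * 2 \<le> 2 ^ m * 2 ^ m" using m power_increasing[of 1 m "2::real"] by (intro mult_left_mono) auto
  then have "(2::real) ^ m \<le> 4 ^ m / 2" by (simp add: power_mult_distrib[symmetric])
  also have "\<dots> = real m * (4 ^ m / (2 * real m))" using m by simp
  also have "\<dots> \<le> real m * real ((2 * m) choose m)"
    using m central_binomial_lower_bound[of m] by (intro mult_left_mono) auto
  also have "\<dots> \<le> real L" using 1 by (metis of_nat_le_iff of_nat_mult)
  also have "\<dots> \<le> real (2 * m) ^ prime_count (2 * m)" using L(3) by (metis of_nat_le_iff of_nat_power)
  finally have "ln ((2::real) ^ m) \<le> ln (real (2 * m) ^ prime_count (2 * m))" by (intro ln_mono) auto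
  also have "\<dots> = real (prime_count (2 * m)) * ln (real (2 * m))" by (rule ln_realpow)
  finally show ?thesis by (simp add: ln_realpow)
qed

text \<open>The number \<open>B\<close> is an admissible bound for the primes needed in
  \<open>mahler_lower_bound_primes\<close> in degree \<open>D\<close>.\<close>

definition admissible :: "nat \<Rightarrow> nat \<Rightarrow> nat \<Rightarrow> bool" where
  "admissible k D B \<longleftrightarrow> (\<exists>P b. finite P \<and>
     (\<forall>p\<in>P. prime p \<and> p \<le> B \<and> 20 * (k * (k + 1) * D)\<^sup>2 \<le> p ^ k) \<and>
     D < 2 ^ (b + 1) \<and> card P \<ge> k * (k + 1) + b)"

text \<open>Without any control on B; this serves the finitely many degrees below the threshold of
  \<open>admissible_eventually\<close>. The crude choice b = D suffices here.\<close>

lemma admissible_exists: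
  assumes k: "k \<ge> 1" shows "\<exists>B. admissible k D B"
proof -
  define A where "A = 20 * (k * (k + 1) * D)\<^sup>2"
  have "infinite ({p::nat. prime p} - {..A})" using primes_infinite by (intro Diff_infinite_finite) auto
  then obtain P where P: "finite P" "card P = k * (k + 1) + D" "P \<subseteq> {p. prime p} - {..A}"
    using infinite_arbitrarily_large by blast
  have "A \<le> p ^ k" if "p \<in> P" for p
  proof -
    have "A < p" using P(3) that by auto
    also have "p \<le> p ^ k" using k \<open>A < p\<close> by (intro self_le_power) auto
    finally show ?thesis by simp
  qed
  moreover have "p \<le> Max P" if "p \<in> P" for p using P(1) that by simp
  moreover have "D < 2 ^ (D + 1)" by (rule less_le_trans[OF less_exp]) simp
  ultimately have "admissible k D (Max P)"
    unfolding admissible_def A_def using P by (intro exI[of _ P] exI[of _ D]) auto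
  then show ?thesis by blast
qed

text \<open>The primes between D^\<eta> and D^(2 \<eta>) work: p^k \<ge> D^(k \<eta>) \<ge> D^3
  exceeds any fixed multiple of D^2 for large D, and Chebyshev's estimate provides enough of
  them.\<close>

lemma admissible_eventually:
  assumes e: "\<eta> > 0" and k: "real k * \<eta> \<ge> 3" "k \<ge> 1"
  shows "\<exists>D0. \<forall>D\<ge>D0. \<exists>B. real B \<le> real D powr (2 * \<eta>) \<and> admissible k D B"
proof -
  define K where "K = real (k * (k + 1))"
  \<comment> \<open>For x = D the quotient bounds the number of primes up to D^(2 \<eta>) from
    below, the subtracted bracket bounds the integers up to D^\<eta> rounded up, and the right side
    adds log_2 D for the noninjective primes.\<close>
  have "eventually (\<lambda>x::real. (x powr (2 * \<eta>) / 2 - 1) * ln 2 / (2 * \<eta> * ln x) - (x powr \<eta> + 1) \<ge> K + ln x / ln 2) at_top"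
    using e by real_asymp
  moreover have "eventually (\<lambda>x::real. x powr (2 * \<eta>) \<ge> 4) at_top"
    using e by real_asymp
  moreover have "eventually (\<lambda>x::real. x \<ge> max 2 (20 * K\<^sup>2)) at_top" by (rule eventually_ge_at_top)
  ultimately have "eventually (\<lambda>x::real. (x powr (2 * \<eta>) / 2 - 1) * ln 2 / (2 * \<eta> * ln x) - (x powr \<eta> + 1) \<ge> K + ln x / ln 2
      \<and> x powr (2 * \<eta>) \<ge> 4 \<and> x \<ge> max 2 (20 * K\<^sup>2)) at_top"
    by eventually_elim auto
  then obtain X where X: "\<And>x. x \<ge> X \<Longrightarrow> (x powr (2 * \<eta>) / 2 - 1) * ln 2 / (2 * \<eta> * ln x) - (x powr \<eta> + 1) \<ge> K + ln x / ln 2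
      \<and> x powr (2 * \<eta>) \<ge> 4 \<and> x \<ge> max 2 (20 * K\<^sup>2)"
    unfolding eventually_at_top_linorder by blast
  have "\<exists>B. real B \<le> real D powr (2 * \<eta>) \<and> admissible k D B" if D: "D \<ge> nat \<lceil>X\<rceil>" for D
  proof -
    define x where "x = real D"
    have "x \<ge> X" using D unfolding x_def by linarith
    note Xx = X[OF this]
    have x2: "x \<ge> 2" and xK: "x \<ge> 20 * K\<^sup>2" and x4: "x powr (2 * \<eta>) \<ge> 4" using Xx by auto
    define m where "m = nat \<lfloor>x powr (2 * \<eta>) / 2\<rfloor>"
    have m: "real m \<le> x powr (2 * \<eta>) / 2" "real m \<ge> x powr (2 * \<eta>) / 2 - 1" "m \<ge> 1"
      unfolding m_def using x4 by linarith+
    define A where "A = nat \<lceil>x powr \<eta>\<rceil>"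
    have A: "real A \<ge> x powr \<eta>" "real A \<le> x powr \<eta> + 1" 
      unfolding A_def using powr_ge_zero[of x \<eta>] by linarith+
    define b where "b = nat \<lfloor>log 2 x\<rfloor>"
    have logx: "log 2 x \<ge> 0" using x2 by simp
    have b: "real b \<le> log 2 x" "log 2 x < real b + 1" unfolding b_def using logx by linarith+
    have "x < 2 powr (real b + 1)" using b(2) x2 by (simp add: less_powr_iff)
    also have "\<dots> = 2 ^ (b + 1)" by (simp add: powr_add powr_realpow)
    finally have "real D < real (2 ^ (b + 1))" by (simp add: x_def)
    then have Db: "D < 2 ^ (b + 1)" by (simp only: of_nat_less_iff)
    define P where "P = {p. prime p \<and> p \<le> 2 * m} - {..A}"
    have fin: "finite {p. prime p \<and> p \<le> 2 * m}" by (rule finite_subset[of _ "{..2 * m}"]) auto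
    have "card {p. prime p \<and> p \<le> 2 * m} \<le> card (P \<union> {1..A})"
      using fin by (intro card_mono) (auto simp: P_def Suc_le_eq prime_gt_0_nat)
    also have "\<dots> \<le> card P + A" using card_Un_le[of P "{1..A}"] by simp
    finally have "real (prime_count (2 * m)) \<le> real (card P) + real A" unfolding prime_count_def by linarith
    moreover have "real (prime_count (2 * m)) \<ge> (x powr (2 * \<eta>) / 2 - 1) * ln 2 / (2 * \<eta> * ln x)"
    proof -
      have l2m: "ln (real (2 * m)) > 0" using m(3) by simp
      have "ln (real (2 * m)) \<le> ln (x powr (2 * \<eta>))" using m(1,3) by (intro ln_mono) auto
      then have le: "ln (real (2 * m)) \<le> 2 * \<eta> * ln x" using x2 by (simp add: ln_powr)
      have "(x powr (2 * \<eta>) / 2 - 1) * ln 2 \<le> real m * ln 2" using m(2) by (intro mult_right_mono) auto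
      also have "\<dots> \<le> real (prime_count (2 * m)) * ln (real (2 * m))" by (rule prime_count_lower_bound[OF m(3)])
      also have "\<dots> \<le> real (prime_count (2 * m)) * (2 * \<eta> * ln x)" using le by (intro mult_left_mono) auto
      finally show ?thesis using l2m le by (subst pos_divide_le_eq) auto
    qed
    moreover have "ln x / ln 2 \<ge> real b" using b(1) by (simp add: log_def)
    ultimately have "real (card P) \<ge> real (k * (k + 1) + b)" using Xx A(2) unfolding K_def by (simp; linarith)
    then have cP: "card P \<ge> k * (k + 1) + b" by (simp only: of_nat_le_iff)
    have "20 * (k * (k + 1) * D)\<^sup>2 \<le> p ^ k" if "p \<in> P" for p
    proof -
      have "real p \<ge> x powr \<eta>" using that A(1) by (auto simp: P_def)
      then have "real p ^ k \<ge> (x powr \<eta>) ^ k" by (intro power_mono) auto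
      moreover have "(x powr \<eta>) ^ k = x powr (real k * \<eta>)" using x2 by (simp add: powr_powr powr_realpow[symmetric] mult.commute)
      moreover have "x powr (real k * \<eta>) \<ge> x powr 3" using k(1) x2 by (intro powr_mono) auto
      moreover have "x powr 3 = x * x\<^sup>2" using x2 by (simp add: powr_numeral power3_eq_cube power2_eq_square)
      moreover have "x * x\<^sup>2 \<ge> 20 * K\<^sup>2 * x\<^sup>2" using xK by (intro mult_right_mono) auto
      moreover have "20 * K\<^sup>2 * x\<^sup>2 = real (20 * (k * (k + 1) * D)\<^sup>2)" by (simp add: K_def x_def power_mult_distrib)
      ultimately have "real (20 * (k * (k + 1) * D)\<^sup>2) \<le> real (p ^ k)" by simp
      then show ?thesis by (simp only: of_nat_le_iff)
    qed
    then have "admissible k D (2 * m)"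
      unfolding admissible_def using cP Db fin by (intro exI[of _ P] exI[of _ b]) (auto simp: P_def)
    moreover have "real (2 * m) \<le> real D powr (2 * \<eta>)" using m(1) by (simp add: x_def)
    ultimately show ?thesis by blast
  qed
  then show ?thesis by blast
qed

lemma admissible_bound:
  assumes d: "\<delta> > 0"
  obtains k C where "k \<ge> 1" "C \<ge> 1" "\<And>D. D \<ge> 1 \<Longrightarrow> \<exists>B. real B \<le> C * real D powr \<delta> \<and> admissible k D B"
proof -
  define \<eta> where "\<eta> = \<delta> / 2"
  define k where "k = nat \<lceil>3 / \<eta>\<rceil> + 1"
  have e: "\<eta> > 0" using d by (simp add: \<eta>_def)
  have "real k \<ge> 3 / \<eta>" unfolding k_def by linarith
  then have k: "real k * \<eta> \<ge> 3" "k \<ge> 1" using e by (simp_all add: field_simps k_def)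
  obtain D0 where D0: "\<And>D. D \<ge> D0 \<Longrightarrow> \<exists>B. real B \<le> real D powr (2 * \<eta>) \<and> admissible k D B"
    using admissible_eventually[OF e k] by blast
  obtain Bf where Bf: "\<And>D. admissible k D (Bf D)" using admissible_exists[OF k(2)] by metis
  \<comment> \<open>A sum over the finitely many small degrees dominates each of their bounds, so a
    single constant C covers all D.\<close>
  define S where "S = (\<Sum>D<D0. Bf D)"
  define C where "C = 1 + real S"
  have C: "C \<ge> 1" by (simp add: C_def)
  have "\<exists>B. real B \<le> C * real D powr \<delta> \<and> admissible k D B" if D: "D \<ge> 1" for D
  proof (cases "D \<ge> D0")
    case True
    obtain B where B: "real B \<le> real D powr (2 * \<eta>)" "admissible k D B" using D0[OF True] by blast
    have "real D powr \<delta> \<le> C * real D powr \<delta>" using C by (intro mult_le_cancel_right1[THEN iffD2]) auto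
    then show ?thesis using B by (intro exI[of _ B]) (simp add: \<eta>_def)
  next
    case False
    have "Bf D \<le> S" unfolding S_def using False by (intro member_le_sum) auto
    then have "real (Bf D) \<le> C * 1" by (simp add: C_def)
    also have "\<dots> \<le> C * real D powr \<delta>" using D d C by (intro mult_left_mono ge_one_powr_ge_zero) auto
    finally show ?thesis using Bf by blast
  qed
  then show ?thesis using that k(2) C by blast
qed

section \<open>A weak form of Dobrowolski's theorem\<close>

theorem weil_height_lower_bound:
  assumes d: "\<delta> > 0"
  obtains c where "c > 0"
    "\<And>x. algebraic x \<Longrightarrow> x \<noteq> 0 \<Longrightarrow> (\<And>n. n > 0 \<Longrightarrow> x ^ n \<noteq> 1) \<Longrightarrow>
      weil_height x \<ge> c / real (card (orb x)) powr (1 + \<delta>)"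
proof -
  obtain k C where k: "k \<ge> 1" and C: "C \<ge> 1"
    and adm: "\<And>D. D \<ge> 1 \<Longrightarrow> \<exists>B. real B \<le> C * real D powr \<delta> \<and> admissible k D B"
    by (rule admissible_bound[OF d]) blast
  \<comment> \<open>This comes from \<open>mahler_lower_bound_primes\<close> with B replaced by C
    D^\<delta>. It is at most \<open>ln 2\<close>, so the nonintegral case obeys the same
    bound.\<close>
  define c where "c = ln 2 / (real (k * (k + 1)) * C)"
  have kk: "real (k * (k + 1)) \<ge> 1" using k by (metis One_nat_def Suc_le_eq add_gr_0 nat_0_less_mult_iff of_nat_1 of_nat_le_iff zero_less_one)
  have den: "real (k * (k + 1)) * C \<ge> 1" using mult_mono[OF kk C] C by simp
  have c: "c > 0" "c \<le> ln 2" using den unfolding c_def by (simp_all add: divide_le_eq mult_le_cancel_left1)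
  have "weil_height x \<ge> c / real (card (orb x)) powr (1 + \<delta>)"
    if x: "algebraic x" "x \<noteq> 0" and nru: "\<And>n. n > 0 \<Longrightarrow> x ^ n \<noteq> 1" for x
  proof -
    define D where "D = card (orb x)"
    have D: "D \<ge> 1" using card_orb_pos[OF x(1)] by (simp add: D_def)
    have Dd: "real D powr \<delta> \<ge> 1" using D d by (intro ge_one_powr_ge_zero) auto
    have "weil_height x * real D \<ge> c / real D powr \<delta>"
    proof (cases "integral_conj x")
      case False
      have "c / real D powr \<delta> \<le> c" using Dd c(1) by (simp add: divide_le_eq mult_le_cancel_left1)
      then show ?thesis using weil_height_not_integral[OF x(1) False] c(2) by (simp add: D_def)
    next
      case True
      obtain B where B: "real B \<le> C * real D powr \<delta>" "admissible k D B" using adm[OF D] by blast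
      obtain P b where P: "finite P" "\<And>p. p \<in> P \<Longrightarrow> prime p \<and> p \<le> B \<and> 20 * (k * (k + 1) * D)\<^sup>2 \<le> p ^ k"
        "D < 2 ^ (b + 1)" "card P \<ge> k * (k + 1) + b"
        using B(2) unfolding admissible_def by blast
      have "ln 2 \<le> real (k * (k + 1) * B) * ln (mahler x)"
        by (rule mahler_lower_bound_primes[OF True x(2) nru k P(1) _ _ P(4)]) (use P in \<open>auto simp: D_def\<close>)
      also have "\<dots> = real (k * (k + 1)) * ln (mahler x) * real B" by simp
      also have "\<dots> \<le> real (k * (k + 1)) * ln (mahler x) * (C * real D powr \<delta>)"
        using B(1) mahler_ge_1[of x] by (intro mult_left_mono) auto
      finally have "ln 2 \<le> ln (mahler x) * ((real (k * (k + 1)) * C) * real D powr \<delta>)" by (simp add: mult_ac)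
      moreover have "0 < (real (k * (k + 1)) * C) * real D powr \<delta>"
        by (rule mult_pos_pos) (use den Dd in linarith)+
      ultimately have "ln 2 / ((real (k * (k + 1)) * C) * real D powr \<delta>) \<le> ln (mahler x)"
        by (subst pos_divide_le_eq)
      then have "c / real D powr \<delta> \<le> ln (mahler x)" unfolding c_def divide_divide_eq_left .
      also have "\<dots> \<le> weil_height x * real D" using weil_height_ge_log_plus[OF x(1)] by (simp add: ln_mahler[OF x(1)] D_def)
      finally show ?thesis .
    qed
    then have "weil_height x \<ge> c / real D powr \<delta> / real D" using D by (simp add: field_simps)
    also have "c / real D powr \<delta> / real D = c / real D powr (1 + \<delta>)" using D by (simp add: powr_add)
    finally show ?thesis by (simp add: D_def)
  qed
  then show ?thesis using that c(1) by blast
qed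

section \<open>Generators of a group of finite rank up to torsion\<close>

lemma subgroup_Qbar: "is_subgroup G \<Longrightarrow> x \<in> G \<Longrightarrow> algebraic x \<and> x \<noteq> 0"
  and subgroup_1: "is_subgroup G \<Longrightarrow> 1 \<in> G"
  and subgroup_mult: "is_subgroup G \<Longrightarrow> x \<in> G \<Longrightarrow> y \<in> G \<Longrightarrow> x * y \<in> G"
  and subgroup_inverse: "is_subgroup G \<Longrightarrow> x \<in> G \<Longrightarrow> inverse x \<in> G"
  unfolding is_subgroup_def Qbar_units_def by auto

lemma subgroup_power: "is_subgroup G \<Longrightarrow> x \<in> G \<Longrightarrow> x ^ n \<in> G"
  by (induction n) (auto intro: subgroup_1 subgroup_mult)

lemma subgroup_power_int: "is_subgroup G \<Longrightarrow> x \<in> G \<Longrightarrow> x powi n \<in> G"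
  by (auto simp: power_int_def intro: subgroup_power subgroup_inverse)

lemma subgroup_prod: "is_subgroup G \<Longrightarrow> (\<And>i. i \<in> A \<Longrightarrow> f i \<in> G) \<Longrightarrow> prod f A \<in> G"
  by (induction A rule: infinite_finite_induct) (auto intro: subgroup_1 subgroup_mult)

lemma div_closure_root:
  assumes G: "is_subgroup G" "G = div_closure G" and n: "n > 0" and e: "b ^ n \<in> G"
  shows "b \<in> G"
proof -
  have a: "algebraic (b ^ n)" "b ^ n \<noteq> 0" using subgroup_Qbar[OF G(1) e] by auto
  have "algebraic b"
    by (rule algebraic_root[OF a(1), of "monom 1 n"]) (use n in \<open>auto simp: poly_monom degree_monom_eq\<close>)
  moreover have "b \<noteq> 0" using a(2) n by auto
  ultimately have "b \<in> div_closure G" unfolding div_closure_def Qbar_units_def using e n by (auto simp: Suc_le_eq)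
  then show ?thesis using G(2) by simp
qed

text \<open>\<open>group_rank\<close> counts a basis picked by choice, while
  \<open>finite_rank\<close> provides a possibly different finite one. The latter is expressed
  modulo the relations by a finite part F of B; F then generates everything, and independence leaves
  no element of B outside F.\<close>

lemma tensor_basis_finite:
  assumes B: "tensor_basis G B" and B1: "tensor_basis G B1" "finite B1"
  shows "finite B"
proof -
  let ?W = "tensor_rels G"
  have "\<exists>T. finite T \<and> T \<subseteq> B \<union> ?W \<and> b \<in> free_rat.span T" if "b \<in> B1" for b
  proof -
    have "b \<in> free_rat.span (B \<union> ?W)" using B B1 that by (auto simp: tensor_basis_def)
    then obtain t r where t: "finite t" "t \<subseteq> B \<union> ?W" "b = (\<Sum>a\<in>t. Poly_Mapping.map ((*) (r a)) a)"
      unfolding free_rat.span_explicit by blast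
    have "b \<in> free_rat.span t"
      unfolding t(3) by (intro free_rat.span_sum free_rat.span_scale free_rat.span_base)
    then show ?thesis using t by blast
  qed
  then obtain T where T: "\<And>b. b \<in> B1 \<Longrightarrow> finite (T b) \<and> T b \<subseteq> B \<union> ?W \<and> b \<in> free_rat.span (T b)" by metis
  define F where "F = (\<Union>b\<in>B1. T b) \<inter> B"
  have fF: "finite F" unfolding F_def using B1(2) T by auto
  have FB: "F \<subseteq> B" by (simp add: F_def)
  have "B1 \<union> ?W \<subseteq> free_rat.span (F \<union> ?W)"
  proof
    fix b assume "b \<in> B1 \<union> ?W"
    then show "b \<in> free_rat.span (F \<union> ?W)"
    proof
      assume b: "b \<in> B1"
      have "T b \<subseteq> F \<union> ?W" using T[OF b] b by (auto simp: F_def)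
      then show ?thesis using T[OF b] free_rat.span_mono by blast
    qed (auto intro: free_rat.span_base)
  qed
  then have "free_rat.span (B1 \<union> ?W) \<subseteq> free_rat.span (F \<union> ?W)"
    by (intro free_rat.span_minimal free_rat.subspace_span)
  then have gens: "tensor_gens G \<subseteq> free_rat.span (F \<union> ?W)" using B1(1) by (simp add: tensor_basis_def)
  have "B \<subseteq> F"
  proof (rule ccontr)
    assume "\<not> B \<subseteq> F"
    then obtain b where b: "b \<in> B" "b \<notin> F" by blast
    have "b \<in> free_rat.span (F \<union> ?W)" using gens B b(1) by (auto simp: tensor_basis_def)
    moreover have "free_rat.span (F \<union> ?W) \<subseteq> free_rat.span ((B - {b}) \<union> ?W)"
      using b FB by (intro free_rat.span_mono) auto
    ultimately show False using B b(1) by (auto simp: tensor_basis_def)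
  qed
  then show ?thesis using fF finite_subset by blast
qed

section \<open>Evaluating formal rational exponents in the group\<close>

definition clears :: "nat \<Rightarrow> (complex \<Rightarrow>\<^sub>0 rat) \<Rightarrow> bool" where
  "clears n v \<longleftrightarrow> (\<forall>g. of_nat n * Poly_Mapping.lookup v g \<in> \<int>)"

text \<open>The floor is exact for the vectors of interest, those with \<open>clears n v\<close>.\<close>

definition mult_eval :: "nat \<Rightarrow> (complex \<Rightarrow>\<^sub>0 rat) \<Rightarrow> complex" where
  "mult_eval n v = (\<Prod>g\<in>Poly_Mapping.keys v. g powi \<lfloor>of_nat n * Poly_Mapping.lookup v g\<rfloor>)"

lemma mult_eval_eq:
  assumes "finite S" "Poly_Mapping.keys v \<subseteq> S"
  shows "mult_eval n v = (\<Prod>g\<in>S. g powi \<lfloor>of_nat n * Poly_Mapping.lookup v g\<rfloor>)"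
  unfolding mult_eval_def
  by (rule prod.mono_neutral_left) (use assms in \<open>auto simp: in_keys_iff\<close>)

lemma floor_add_Ints: "a \<in> \<int> \<Longrightarrow> b \<in> \<int> \<Longrightarrow> \<lfloor>a + (b::rat)\<rfloor> = \<lfloor>a\<rfloor> + \<lfloor>b\<rfloor>"
  by (auto elim!: Ints_cases)

lemma mult_eval_add:
  assumes "0 \<notin> Poly_Mapping.keys v \<union> Poly_Mapping.keys w" "clears n v" "clears n w"
  shows "mult_eval n (v + w) = mult_eval n v * mult_eval n w" "clears n (v + w)"
proof -
  let ?S = "Poly_Mapping.keys v \<union> Poly_Mapping.keys w"
  have "mult_eval n (v + w) = (\<Prod>g\<in>?S. g powi \<lfloor>of_nat n * Poly_Mapping.lookup (v + w) g\<rfloor>)"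
    by (rule mult_eval_eq) (auto simp: Poly_Mapping.keys_add)
  also have "\<dots> = (\<Prod>g\<in>?S. g powi \<lfloor>of_nat n * Poly_Mapping.lookup v g\<rfloor> * g powi \<lfloor>of_nat n * Poly_Mapping.lookup w g\<rfloor>)"
  proof (rule prod.cong[OF refl])
    fix g assume "g \<in> ?S"
    then have "g \<noteq> 0" using assms(1) by blast
    then show "g powi \<lfloor>of_nat n * Poly_Mapping.lookup (v + w) g\<rfloor>
        = g powi \<lfloor>of_nat n * Poly_Mapping.lookup v g\<rfloor> * g powi \<lfloor>of_nat n * Poly_Mapping.lookup w g\<rfloor>"
      using assms(2,3) floor_add_Ints by (simp add: lookup_add distrib_left power_int_add clears_def)
  qed
  also have "\<dots> = mult_eval n v * mult_eval n w"
    using mult_eval_eq[of ?S v n] mult_eval_eq[of ?S w n] by (simp add: prod.distrib)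
  finally show "mult_eval n (v + w) = mult_eval n v * mult_eval n w" .
  show "clears n (v + w)" using assms(2,3) by (auto simp: clears_def lookup_add distrib_left)
qed

lemma prod_power_int: "(\<Prod>i\<in>A. f i) powi k = (\<Prod>i\<in>A. f i powi k :: complex)"
  by (induction A rule: infinite_finite_induct) (auto simp: power_int_mult_distrib)

abbreviation scale :: "rat \<Rightarrow> (complex \<Rightarrow>\<^sub>0 rat) \<Rightarrow> (complex \<Rightarrow>\<^sub>0 rat)" where
  "scale q v \<equiv> Poly_Mapping.map ((*) q) v"

lemma keys_scale_subset: "Poly_Mapping.keys (scale q v) \<subseteq> Poly_Mapping.keys v"
  by (rule subsetI) (simp add: in_keys_iff lookup_scale)

lemma mult_eval_scale:
  assumes "clears n v" and b: "b > 0"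
  shows "mult_eval (n * nat b) (scale (of_int a / of_int b) v) = mult_eval n v powi a"
    "clears (n * nat b) (scale (of_int a / of_int b) v)"
proof -
  have look: "of_nat (n * nat b) * Poly_Mapping.lookup (scale (of_int a / of_int b) v) g
      = of_int a * (of_nat n * Poly_Mapping.lookup v g)" for g
    using b by (simp add: lookup_scale of_nat_nat)
  have fl: "\<lfloor>of_int a * (of_nat n * Poly_Mapping.lookup v g)\<rfloor> = \<lfloor>of_nat n * Poly_Mapping.lookup v g\<rfloor> * a" for g
  proof -
    obtain k where k: "of_nat n * Poly_Mapping.lookup v g = of_int k"
      using assms unfolding clears_def by (metis Ints_cases)
    have "\<lfloor>of_int a * (of_int k :: rat)\<rfloor> = k * a" by (simp flip: of_int_mult)
    then show ?thesis by (simp add: k)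
  qed
  have "mult_eval (n * nat b) (scale (of_int a / of_int b) v)
    = (\<Prod>g\<in>Poly_Mapping.keys v. g powi \<lfloor>of_nat (n * nat b) * Poly_Mapping.lookup (scale (of_int a / of_int b) v) g\<rfloor>)"
    by (rule mult_eval_eq[OF finite_keys keys_scale_subset])
  also have "\<dots> = (\<Prod>g\<in>Poly_Mapping.keys v. (g powi \<lfloor>of_nat n * Poly_Mapping.lookup v g\<rfloor>) powi a)"
    unfolding look fl power_int_mult ..
  finally show "mult_eval (n * nat b) (scale (of_int a / of_int b) v) = mult_eval n v powi a"
    by (simp add: mult_eval_def prod_power_int)
  show "clears (n * nat b) (scale (of_int a / of_int b) v)"
    unfolding clears_def look using assms by (auto simp: clears_def)
qed

lemma clears_exists: "\<exists>n>0. clears n v"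
proof -
  have "\<exists>n>0. \<forall>g\<in>S. of_nat n * Poly_Mapping.lookup v g \<in> \<int>" if "finite S" for S
    using that
  proof (induction S rule: finite_induct)
    case (insert g S)
    then obtain n where n: "n > 0" "\<forall>g\<in>S. of_nat n * Poly_Mapping.lookup v g \<in> \<int>" by blast
    obtain a b where ab: "quotient_of (Poly_Mapping.lookup v g) = (a, b)" by (cases "quotient_of (Poly_Mapping.lookup v g)")
    have b: "b > 0" using quotient_of_denom_pos[OF ab] .
    have vg: "of_int b * Poly_Mapping.lookup v g = of_int a" using quotient_of_div[OF ab] b by simp
    have eq: "of_nat (nat b * n) * Poly_Mapping.lookup v h = of_int b * (of_nat n * Poly_Mapping.lookup v h)" for h
      using b by (simp add: of_nat_nat)
    have bng: "of_int b * (of_nat n * Poly_Mapping.lookup v g) = of_nat n * of_int a"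
      using vg by (simp add: mult.left_commute)
    have "of_nat (nat b * n) * Poly_Mapping.lookup v g \<in> \<int>"
      unfolding eq bng by simp
    moreover have "of_nat (nat b * n) * Poly_Mapping.lookup v h \<in> \<int>" if "h \<in> S" for h
      unfolding eq by (rule Ints_mult[OF Ints_of_int]) (use n(2) that in blast)
    ultimately show ?case using n(1) b by (intro exI[of _ "nat b * n"] conjI) auto
  qed (auto intro: exI[of _ 1])
  from this[of "Poly_Mapping.keys v"] obtain n where n: "n > 0" "\<forall>g\<in>Poly_Mapping.keys v. of_nat n * Poly_Mapping.lookup v g \<in> \<int>" by auto
  have "of_nat n * Poly_Mapping.lookup v g \<in> \<int>" for g
    using n(2) by (cases "g \<in> Poly_Mapping.keys v") (auto simp: in_keys_iff)
  then show ?thesis using n(1) by (auto simp: clears_def)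
qed

lemma keys_uminus: "Poly_Mapping.keys (- v) = Poly_Mapping.keys (v :: complex \<Rightarrow>\<^sub>0 rat)"
  by (rule set_eqI) (simp add: in_keys_iff)

lemma mult_eval_single:
  "mult_eval n (Poly_Mapping.single g 1) = g ^ n" "clears n (Poly_Mapping.single g 1)"
  by (auto simp: mult_eval_def clears_def lookup_single when_def)

text \<open>The assertion about g concerns the formal vector [g]. The vectors satisfying its
  analogue form a subspace U that contains B and the relations, hence all of
  \<open>tensor_gens G\<close>.\<close>

lemma finite_rank_generators:
  assumes G: "is_subgroup G" "G = div_closure G" and B: "tensor_basis G B" "finite B"
  obtains \<gamma> where "\<And>b. b \<in> B \<Longrightarrow> \<gamma> b \<in> G"
    "\<And>g. g \<in> G \<Longrightarrow> \<exists>n>0. \<exists>m. g ^ n = (\<Prod>b\<in>B. \<gamma> b powi m b)"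
proof -
  have Gnz: "0 \<notin> G" using subgroup_Qbar[OF G(1)] by blast
  have keysspan: "Poly_Mapping.keys v \<subseteq> G" if "v \<in> tensor_gens G" for v
  proof -
    have "free_rat.subspace {v. Poly_Mapping.keys v \<subseteq> G}"
      unfolding free_rat.subspace_def
    proof (intro conjI ballI allI)
      fix v w :: "complex \<Rightarrow>\<^sub>0 rat" assume "v \<in> {v. Poly_Mapping.keys v \<subseteq> G}" "w \<in> {v. Poly_Mapping.keys v \<subseteq> G}"
      then show "v + w \<in> {v. Poly_Mapping.keys v \<subseteq> G}" using Poly_Mapping.keys_add[of v w] by blast
    next
      fix c and v :: "complex \<Rightarrow>\<^sub>0 rat" assume "v \<in> {v. Poly_Mapping.keys v \<subseteq> G}"
      then show "scale c v \<in> {v. Poly_Mapping.keys v \<subseteq> G}" using keys_scale_subset[of c v] by blast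
    qed simp
    moreover have "(\<lambda>\<gamma>. Poly_Mapping.single \<gamma> 1) ` G \<subseteq> {v :: complex \<Rightarrow>\<^sub>0 rat. Poly_Mapping.keys v \<subseteq> G}"
      by auto
    ultimately have "tensor_gens G \<subseteq> {v. Poly_Mapping.keys v \<subseteq> G}"
      unfolding tensor_gens_def by (intro free_rat.span_minimal)
    then show ?thesis using that by blast
  qed
  have Bkeys: "Poly_Mapping.keys b \<subseteq> G" if "b \<in> B" for b using B that keysspan by (auto simp: tensor_basis_def)
  \<comment> \<open>An element of B is a formal combination, not a group element. With denominators
    cleared by n it evaluates to an element of G, and an n-th root of that value, which lies in G by
    divisibility, serves as the generator.\<close>
  have "\<exists>c. c \<in> G \<and> (\<exists>n>0. clears n b \<and> mult_eval n b = c ^ n)" if b: "b \<in> B" for b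
  proof -
    obtain n where n: "n > 0" "clears n b" using clears_exists by blast
    have eG: "mult_eval n b \<in> G"
      unfolding mult_eval_def by (intro subgroup_prod[OF G(1)] subgroup_power_int[OF G(1)]) (use Bkeys[OF b] in auto)
    have "poly (monom 1 n + [:- mult_eval n b:]) c = 0 \<longleftrightarrow> c ^ n = mult_eval n b" for c
      by (simp add: poly_monom)
    moreover have "degree (monom 1 n + [:- mult_eval n b:]) = n"
      using n(1) by (subst degree_add_eq_left) (simp_all add: degree_monom_eq)
    ultimately obtain c where c: "c ^ n = mult_eval n b"
      using fundamental_theorem_of_algebra[of "monom 1 n + [:- mult_eval n b:]"] n(1) by (auto simp: constant_degree)
    have "c \<in> G" by (rule div_closure_root[OF G n(1)]) (simp add: c eG)
    then show ?thesis using n c[symmetric] by (intro exI[of _ c] conjI exI[of _ n])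
  qed
  then obtain \<gamma> where \<gamma>: "\<And>b. b \<in> B \<Longrightarrow> \<gamma> b \<in> G" "\<And>b. b \<in> B \<Longrightarrow> \<exists>n>0. clears n b \<and> mult_eval n b = \<gamma> b ^ n" by metis
  have \<gamma>nz: "\<gamma> b \<noteq> 0" if "b \<in> B" for b using \<gamma>(1)[OF that] Gnz by auto
  define U where "U = {v. Poly_Mapping.keys v \<subseteq> G \<and>
     (\<exists>n>0. clears n v \<and> (\<exists>m. mult_eval n v = (\<Prod>b\<in>B. \<gamma> b powi m b)))}"
  have add: "v + w \<in> U" if v: "v \<in> U" and w: "w \<in> U" for v w
  proof -
    obtain n1 m1 where 1: "n1 > 0" "clears n1 v" "mult_eval n1 v = (\<Prod>b\<in>B. \<gamma> b powi m1 b)" using v by (auto simp: U_def)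
    obtain n2 m2 where 2: "n2 > 0" "clears n2 w" "mult_eval n2 w = (\<Prod>b\<in>B. \<gamma> b powi m2 b)" using w by (auto simp: U_def)
    have keys: "Poly_Mapping.keys v \<union> Poly_Mapping.keys w \<subseteq> G" using v w by (auto simp: U_def)
    \<comment> \<open>Scaling by k / k fixes the vector while \<open>mult_eval_scale\<close>
      multiplies the clearing factor by k. This brings v and w to the common factor
      \<open>n1 * n2\<close>.\<close>
    have id: "scale (of_int k / of_int k) u = u" if "k > 0" for k :: int and u
      by (rule poly_mapping_eqI) (use that in \<open>simp add: lookup_scale\<close>)
    note s1 = mult_eval_scale[OF 1(2), of "int n2" "int n2", unfolded id]
    note s2 = mult_eval_scale[OF 2(2), of "int n1" "int n1", unfolded id]
    have c1: "clears (n1 * n2) v" "mult_eval (n1 * n2) v = mult_eval n1 v powi int n2" using s1 id[of "int n2"] 2(1) by auto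
    have c2: "clears (n1 * n2) w" "mult_eval (n1 * n2) w = mult_eval n2 w powi int n1" using s2 id[of "int n1"] 1(1) by (auto simp: mult.commute)
    have "mult_eval (n1 * n2) (v + w) = mult_eval (n1 * n2) v * mult_eval (n1 * n2) w" "clears (n1 * n2) (v + w)"
      using mult_eval_add[OF _ c1(1) c2(1)] keys Gnz by auto
    moreover have "mult_eval (n1 * n2) v * mult_eval (n1 * n2) w = (\<Prod>b\<in>B. \<gamma> b powi (m1 b * int n2 + m2 b * int n1))"
      unfolding c1 c2 1 2 prod_power_int prod.distrib[symmetric]
      by (rule prod.cong) (auto simp: power_int_add power_int_mult \<gamma>nz)
    ultimately have ev: "mult_eval (n1 * n2) (v + w) = (\<Prod>b\<in>B. \<gamma> b powi (m1 b * int n2 + m2 b * int n1))"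
      and cl: "clears (n1 * n2) (v + w)" by simp_all
    have "Poly_Mapping.keys (v + w) \<subseteq> G" using keys Poly_Mapping.keys_add[of v w] by blast
    moreover have "n1 * n2 > 0" using 1(1) 2(1) by simp
    ultimately show ?thesis
      unfolding U_def mem_Collect_eq using ev cl
      by (intro conjI exI[of _ "n1 * n2"] exI[of _ "\<lambda>b. m1 b * int n2 + m2 b * int n1"])
  qed
  have scale: "scale q v \<in> U" if v: "v \<in> U" for q v
  proof -
    obtain n m where n: "n > 0" "clears n v" "mult_eval n v = (\<Prod>b\<in>B. \<gamma> b powi m b)" using v by (auto simp: U_def)
    obtain a b where ab: "quotient_of q = (a, b)" by (cases "quotient_of q")
    have b: "b > 0" "q = of_int a / of_int b" using quotient_of_denom_pos[OF ab] quotient_of_div[OF ab] by auto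
    have "mult_eval (n * nat b) (scale q v) = (\<Prod>c\<in>B. \<gamma> c powi (m c * a))"
      unfolding b(2) mult_eval_scale(1)[OF n(2) b(1)] n(3) prod_power_int power_int_mult ..
    moreover have "clears (n * nat b) (scale q v)" unfolding b(2) by (rule mult_eval_scale(2)[OF n(2) b(1)])
    moreover have "Poly_Mapping.keys (scale q v) \<subseteq> G" using v keys_scale_subset[of q v] unfolding U_def by blast
    moreover have "n * nat b > 0" using n(1) b(1) by simp
    ultimately show ?thesis
      unfolding U_def mem_Collect_eq by (intro conjI exI[of _ "n * nat b"] exI[of _ "\<lambda>c. m c * a"])
  qed
  have zero: "0 \<in> U"
    unfolding U_def by (auto simp: clears_def mult_eval_def intro!: exI[of _ 1] exI[of _ "\<lambda>_. 0"])
  have sub: "free_rat.subspace U"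
    unfolding free_rat.subspace_def using zero add scale by blast
  have "B \<subseteq> U"
  proof
    fix b assume b: "b \<in> B"
    obtain n where n: "n > 0" "clears n b" "mult_eval n b = \<gamma> b ^ n" using \<gamma>(2)[OF b] by blast
    have "(\<Prod>c\<in>B. \<gamma> c powi (if c = b then int n else 0)) = (\<Prod>c\<in>B. if c = b then \<gamma> b ^ n else 1)"
      by (rule prod.cong) auto
    also have "\<dots> = \<gamma> b ^ n" using B(2) b by simp
    finally have "mult_eval n b = (\<Prod>c\<in>B. \<gamma> c powi (if c = b then int n else 0))" using n(3) by simp
    then show "b \<in> U"
      unfolding U_def mem_Collect_eq using n Bkeys[OF b]
      by (intro conjI exI[of _ n] exI[of _ "\<lambda>c. if c = b then int n else 0"])
  qed
  \<comment> \<open>A relation evaluates to \<open>x * y * inverse x * inverse y = 1\<close> with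
    clearing factor 1, which is the product with all exponents 0.\<close>
  moreover have "{Poly_Mapping.single (\<gamma> * \<delta>) 1 - Poly_Mapping.single \<gamma> 1 - Poly_Mapping.single \<delta> 1 | \<gamma> \<delta>.
        \<gamma> \<in> G \<and> \<delta> \<in> G} \<subseteq> U"
  proof clarify
    fix x y assume xy: "x \<in> G" "y \<in> G"
    let ?s = "\<lambda>g. Poly_Mapping.single g (1::rat)"
    have xyG: "x * y \<in> G" by (rule subgroup_mult[OF G(1) xy])
    have fl: "\<lfloor>- 1 :: rat\<rfloor> = - 1" by (rule floor_unique) auto
    have neg: "mult_eval 1 (- ?s g) = inverse g \<and> clears 1 (- ?s g)" for g
      by (auto simp: mult_eval_def clears_def lookup_single when_def keys_uminus power_int_minus fl)
    have nz: "x \<noteq> 0" "y \<noteq> 0" using xy Gnz by auto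
    have 1: "mult_eval 1 (?s (x * y) + - ?s x) = x * y * inverse x \<and> clears 1 (?s (x * y) + - ?s x)"
      using mult_eval_add[of "?s (x * y)" "- ?s x" 1] mult_eval_single[of 1 "x * y"] neg[of x] nz by (auto simp: keys_uminus)
    have k: "Poly_Mapping.keys (?s (x * y) + - ?s x) \<subseteq> {x * y, x}"
      using Poly_Mapping.keys_add[of "?s (x * y)" "- ?s x"] by (auto simp: keys_uminus)
    have 2: "mult_eval 1 (?s (x * y) + - ?s x + - ?s y) = x * y * inverse x * inverse y \<and> clears 1 (?s (x * y) + - ?s x + - ?s y)"
    proof -
      have k0: "0 \<notin> Poly_Mapping.keys (?s (x * y) + - ?s x) \<union> Poly_Mapping.keys (- ?s y)"
        using subsetD[OF k, of 0] nz by (auto simp: keys_uminus)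
      note c1 = conjunct2[OF 1] and c2 = conjunct2[OF neg[of y]]
      show ?thesis
        using mult_eval_add[OF k0 c1 c2] conjunct1[OF 1] conjunct1[OF neg[of y]] by (intro conjI) simp_all
    qed
    have "mult_eval 1 (?s (x * y) - ?s x - ?s y) = (\<Prod>b\<in>B. \<gamma> b powi 0)"
      using 2 nz by (simp add: field_simps)
    moreover have "Poly_Mapping.keys (?s (x * y) - ?s x - ?s y) \<subseteq> G"
      using Poly_Mapping.keys_add[of "?s (x * y) + - ?s x" "- ?s y"] k xy xyG by (auto simp: keys_uminus)
    moreover have "clears 1 (?s (x * y) - ?s x - ?s y)" using 2 by simp
    ultimately show "?s (x * y) - ?s x - ?s y \<in> U"
      unfolding U_def mem_Collect_eq by (intro conjI exI[of _ 1] exI[of _ "\<lambda>_. 0"]) simp_all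
  qed
  then have "tensor_rels G \<subseteq> U" unfolding tensor_rels_def by (rule free_rat.span_minimal) (rule sub)
  ultimately have "free_rat.span (B \<union> tensor_rels G) \<subseteq> U" by (intro free_rat.span_minimal sub) auto
  then have gens: "tensor_gens G \<subseteq> U" using B(1) by (simp add: tensor_basis_def)
  have "\<exists>n>0. \<exists>m. g ^ n = (\<Prod>b\<in>B. \<gamma> b powi m b)" if "g \<in> G" for g
  proof -
    have "Poly_Mapping.single g 1 \<in> tensor_gens G" unfolding tensor_gens_def using that by (intro free_rat.span_base) auto
    then have "Poly_Mapping.single g 1 \<in> U" using gens by blast
    then show ?thesis unfolding U_def by (auto simp: mult_eval_single)
  qed
  then show ?thesis using that \<gamma>(1) by blast
qed

lemma group_rank_generators:
  assumes G: "is_subgroup G" "finite_rank G" "G = div_closure G"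
  obtains c where "\<And>i. i < group_rank G \<Longrightarrow> c i \<in> G"
    "\<And>g. g \<in> G \<Longrightarrow> \<exists>n>0. \<exists>m. g ^ n = (\<Prod>i<group_rank G. c i powi m i)"
proof -
  define B where "B = (SOME B. tensor_basis G B)"
  obtain B1 where B1: "tensor_basis G B1" "finite B1" using G(2) by (auto simp: finite_rank_def)
  have B: "tensor_basis G B" unfolding B_def by (rule someI) (rule B1(1))
  have fin: "finite B" by (rule tensor_basis_finite[OF B B1])
  have r: "group_rank G = card B" by (simp add: group_rank_def B_def)
  obtain \<gamma> where \<gamma>: "\<And>b. b \<in> B \<Longrightarrow> \<gamma> b \<in> G"
    "\<And>g. g \<in> G \<Longrightarrow> \<exists>n>0. \<exists>m. g ^ n = (\<Prod>b\<in>B. \<gamma> b powi m b)"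
    by (rule finite_rank_generators[OF G(1,3) B fin]) blast
  obtain h where h: "bij_betw h {..<card B} B" using ex_bij_betw_nat_finite[OF fin] by (auto simp: atLeast0LessThan)
  show ?thesis
  proof (rule that[of "\<lambda>i. \<gamma> (h i)"])
    fix i assume "i < group_rank G"
    then show "\<gamma> (h i) \<in> G" using bij_betwE[OF h] \<gamma>(1) by (auto simp: r)
  next
    fix g assume "g \<in> G"
    then obtain n m where n: "n > 0" "g ^ n = (\<Prod>b\<in>B. \<gamma> b powi m b)" using \<gamma>(2) by blast
    have "g ^ n = (\<Prod>i<group_rank G. \<gamma> (h i) powi m (h i))"
      unfolding n(2) r by (rule prod.reindex_bij_betw[OF h, symmetric])
    then show "\<exists>n>0. \<exists>m. g ^ n = (\<Prod>i<group_rank G. \<gamma> (h i) powi m i)"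
      using n(1) by (intro exI[of _ n] conjI exI[of _ "\<lambda>i. m (h i)"]) auto
  qed
qed

section \<open>The theorem\<close>

text \<open>A positive k gives a power of x and a negative k a power of 1/x; the sum of the two
  heights bounds both cases at once.\<close>

lemma weil_height_power_int_le:
  assumes x: "algebraic x"
  shows "weil_height (x powi k) \<le> \<bar>real_of_int k\<bar> * (weil_height x + weil_height (inverse x))"
proof (cases "k \<ge> 0")
  case True
  then have "weil_height (x powi k) = real (nat k) * weil_height x" by (simp add: power_int_def weil_height_power[OF x])
  also have "\<dots> \<le> real (nat k) * (weil_height x + weil_height (inverse x))"
    using weil_height_nonneg[of "inverse x"] x by (intro mult_left_mono) auto
  finally show ?thesis using True by simp
next
  case False
  have "weil_height (x powi k) = real (nat (- k)) * weil_height (inverse x)"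
    using False weil_height_power[OF algebraic_inverse[OF x]] by (simp add: power_int_def)
  also have "\<dots> \<le> real (nat (- k)) * (weil_height x + weil_height (inverse x))"
    using weil_height_nonneg[OF x] by (intro mult_left_mono) auto
  finally show ?thesis using False by simp
qed

lemma weil_height_1: "weil_height 1 = 0"
  using weil_height_power[of 1 0] by simp

lemma weil_height_prod_le:
  assumes "\<And>i. i \<in> A \<Longrightarrow> algebraic (f i)"
  shows "weil_height (prod f A) \<le> (\<Sum>i\<in>A. weil_height (f i))"
  using assms
proof (induction A rule: infinite_finite_induct)
  case (insert a A)
  have "weil_height (f a * prod f A) \<le> weil_height (f a) + weil_height (prod f A)"
    by (rule weil_height_mult_le) (use insert.prems in auto)
  then show ?case using insert by simp
qed (auto simp: weil_height_1)

text \<open>The bound is uniform in k. Through it the degree of \<beta> does not depend on the size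
  of the approximating integers.\<close>

lemma card_orb_power_int_le: "algebraic x \<Longrightarrow> card (orb (x powi k)) \<le> card (orb x)"
  using card_orb_power_le[of x "nat k"]
    order.trans[OF card_orb_power_le[of "inverse x" "nat (- k)"] card_orb_inverse_le[of x]]
  by (simp add: power_int_def algebraic_inverse)

lemma card_orb_1: "card (orb 1) = 1"
proof -
  have "orb 1 = {1}" using orb_self[of 1] gal_1 by (auto simp: orb_def)
  then show ?thesis by simp
qed

lemma card_orb_prod_le:
  assumes "\<And>i. i \<in> A \<Longrightarrow> algebraic (f i)"
  shows "card (orb (prod f A)) \<le> (\<Prod>i\<in>A. card (orb (f i)))"
  using assms
proof (induction A rule: infinite_finite_induct)
  case (insert a A)
  have "card (orb (f a * prod f A)) \<le> card (orb (f a)) * card (orb (prod f A))"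
    by (rule card_orb_mult_le) (use insert.prems in auto)
  also have "\<dots> \<le> card (orb (f a)) * (\<Prod>i\<in>A. card (orb (f i)))" using insert by (intro mult_left_mono) auto
  finally show ?case using insert by simp
qed (auto simp: card_orb_1)

theorem theorem1p3:
  fixes \<Gamma> :: "complex set"
  assumes "is_subgroup \<Gamma>"
    and "finite_rank \<Gamma>"
    and "\<Gamma> = div_closure \<Gamma>"
  shows "\<forall>\<epsilon>>0::real. \<exists>C>0::real. \<forall>\<alpha> \<in> Qbar_units - \<Gamma>.
           height_mod \<Gamma> \<alpha> \<ge>
             C / real (field_degree (adjoin \<alpha>)) powr (real (group_rank \<Gamma>) + 1 + \<epsilon>)"
proof (intro allI impI)
  fix \<epsilon> :: real assume eps: "\<epsilon> > 0"
  note G = assms(1)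
  define r where "r = group_rank \<Gamma>"
  obtain \<gamma> where \<gamma>: "\<And>i. i < r \<Longrightarrow> \<gamma> i \<in> \<Gamma>"
    "\<And>g. g \<in> \<Gamma> \<Longrightarrow> \<exists>n>0. \<exists>m. g ^ n = (\<Prod>i<r. \<gamma> i powi m i)"
    using group_rank_generators[OF assms] unfolding r_def by blast
  have \<gamma>a: "algebraic (\<gamma> i)" "\<gamma> i \<noteq> 0" if "i < r" for i using subgroup_Qbar[OF G \<gamma>(1)[OF that]] by auto
  \<comment> \<open>The final estimate divides by s^(r + 1), in which D has the exponent (1 +
    \<delta>) (r + 1).\<close>
  define \<delta> where "\<delta> = \<epsilon> / real (r + 1)"
  have d: "\<delta> > 0" using eps by (simp add: \<delta>_def)
  have de: "(1 + \<delta>) * real (r + 1) = real r + 1 + \<epsilon>" by (simp add: \<delta>_def field_simps)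
  obtain c where c: "c > 0"
    and lower: "\<And>x. algebraic x \<Longrightarrow> x \<noteq> 0 \<Longrightarrow> (\<And>n. n > 0 \<Longrightarrow> x ^ n \<noteq> 1) \<Longrightarrow>
      weil_height x \<ge> c / real (card (orb x)) powr (1 + \<delta>)"
    by (rule weil_height_lower_bound[OF d]) blast
  \<comment> \<open>The summand 1 keeps A positive also for r = 0, and T with it, as Dirichlet's
    theorem requires.\<close>
  define A where "A = 1 + (\<Sum>i<r. weil_height (\<gamma> i) + weil_height (inverse (\<gamma> i)))"
  have kap: "weil_height (\<gamma> i) + weil_height (inverse (\<gamma> i)) \<ge> 0" if "i < r" for i
    using weil_height_nonneg \<gamma>a[OF that] by (intro add_nonneg_nonneg) auto
  have "(\<Sum>i<r. weil_height (\<gamma> i) + weil_height (inverse (\<gamma> i))) \<ge> 0"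
    by (intro sum_nonneg) (use kap in auto)
  then have A: "A \<ge> 1" unfolding A_def by simp
  \<comment> \<open>A bound for the degree of every product of integer powers of the generators,
    whatever the exponents are.\<close>
  define C0 where "C0 = (\<Prod>i<r. card (orb (\<gamma> i)))"
  have C0: "C0 \<ge> 1" unfolding C0_def using card_orb_pos \<gamma>a by (intro prod_ge_1) (auto simp: Suc_le_eq)
  \<comment> \<open>Chosen for \<open>T \<le> E * s\<close>; the summand 1 pays for rounding up in
    T, since \<open>s \<ge> 1\<close>.\<close>
  define E where "E = 2 * A / c + 1"
  have E: "E \<ge> 1" using A c by (simp add: E_def)
  define C where "C = c / (2 * E ^ r * real C0 powr (real r + 1 + \<epsilon>))"
  have Cpos: "C > 0" unfolding C_def using c E C0 by (intro divide_pos_pos mult_pos_pos) auto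
  have "height_mod \<Gamma> \<alpha> \<ge> C / real (field_degree (adjoin \<alpha>)) powr (real r + 1 + \<epsilon>)"
    if \<alpha>: "\<alpha> \<in> Qbar_units - \<Gamma>" for \<alpha>
  proof -
    have aa: "algebraic \<alpha>" "\<alpha> \<noteq> 0" using \<alpha> by (auto simp: Qbar_units_def)
    define D where "D = card (orb \<alpha>)"
    have D: "D \<ge> 1" using card_orb_pos[OF aa(1)] by (simp add: D_def)
    have fd: "field_degree (adjoin \<alpha>) = D" using field_degree_adjoin[OF aa(1)] by (simp add: D_def)
    define s where "s = real (C0 * D) powr (1 + \<delta>)"
    have CD: "real (C0 * D) \<ge> 1" using C0 D by (metis mult_le_mono mult_1 of_nat_1 of_nat_le_iff)
    then have s: "s \<ge> 1" unfolding s_def using d by (intro ge_one_powr_ge_zero) auto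
    \<comment> \<open>The height of b will be at least c / s. With this T the error A / T is at most
      half of that.\<close>
    define T where "T = nat \<lceil>2 * A * s / c\<rceil>"
    have As: "2 * A * s / c > 0" using A s c by simp
    have T: "real T \<ge> 2 * A * s / c" "real T \<le> 2 * A * s / c + 1" "T > 0" unfolding T_def using As by linarith+
    have TE: "real T \<le> E * s" using T(2) s by (simp add: E_def algebra_simps)
    have bound: "weil_height (\<alpha> / g) \<ge> C / real D powr (real r + 1 + \<epsilon>)" if g: "g \<in> \<Gamma>" for g
    proof -
      have ga: "algebraic g" "g \<noteq> 0" using subgroup_Qbar[OF G g] by auto
      obtain n m where nm: "n > 0" "g ^ n = (\<Prod>i<r. \<gamma> i powi m i)" using \<gamma>(2)[OF g] by blast
      \<comment> \<open>The fractions m_i / n are the exponents of g in terms of the generators.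
        Approximating them with a common multiplier q makes u close to g^q up to torsion.\<close>
      obtain q0 p where qp: "0 < q0" "q0 \<le> int (T ^ r)"
        "\<And>i. i < r \<Longrightarrow> \<bar>of_int q0 * (real_of_int (m i) / real n) - of_int (p i)\<bar> < 1 / real T"
        using Dirichlet_approx_simult[OF T(3), where n = r and \<theta> = "\<lambda>i. real_of_int (m i) / real n"] by metis
      define q where "q = nat q0"
      have q: "q > 0" "q \<le> T ^ r" "q0 = int q" using qp(1,2) by (auto simp: q_def nat_le_iff)
      define u where "u = (\<Prod>i<r. \<gamma> i powi p i)"
      have uG: "u \<in> \<Gamma>" unfolding u_def by (intro subgroup_prod[OF G] subgroup_power_int[OF G] \<gamma>(1)) auto
      have ua: "algebraic u" "u \<noteq> 0" using subgroup_Qbar[OF G uG] by auto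
      define b where "b = \<alpha> ^ q / u"
      have ba: "algebraic b" "b \<noteq> 0" using aa ua by (auto simp: b_def)
      have b_nru: "b ^ N \<noteq> 1" if N: "N > 0" for N
      proof
        assume "b ^ N = 1"
        then have "\<alpha> ^ (q * N) = u ^ N" using ua(2) by (simp add: b_def power_divide power_mult)
        then have "\<alpha> ^ (q * N) \<in> \<Gamma>" using subgroup_power[OF G uG] by simp
        then have "\<alpha> \<in> \<Gamma>" by (rule div_closure_root[OF G assms(3), rotated]) (use q(1) N in simp)
        then show False using \<alpha> by blast
      qed
      \<comment> \<open>The approximation error, with b = (\<alpha>/g)^q w. Passing to w^n removes
        the torsion ambiguity and leaves exponents q m_i - n p_i of absolute value at most n / T, so
        dividing by n gives a height of at most A / T.\<close>
      define w where "w = g ^ q / u"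
      have wa: "algebraic w" using ga ua by (simp add: w_def)
      have "w ^ n = (\<Prod>i<r. \<gamma> i powi (int q * m i - int n * p i))"
      proof -
        have "w ^ n = (g ^ n) powi int q / u powi int n"
          by (simp add: w_def power_divide power_mult[symmetric] mult.commute)
        also have "\<dots> = (\<Prod>i<r. \<gamma> i powi (m i * int q) / \<gamma> i powi (p i * int n))"
          unfolding nm(2) u_def prod_power_int power_int_mult prod_dividef ..
        also have "\<dots> = (\<Prod>i<r. \<gamma> i powi (int q * m i - int n * p i))"
          by (rule prod.cong) (use \<gamma>a in \<open>auto simp: power_int_diff mult.commute\<close>)
        finally show ?thesis .
      qed
      then have "real n * weil_height w = weil_height (\<Prod>i<r. \<gamma> i powi (int q * m i - int n * p i))"
        using weil_height_power[OF wa, of n] by simp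
      also have "\<dots> \<le> (\<Sum>i<r. weil_height (\<gamma> i powi (int q * m i - int n * p i)))"
        by (rule weil_height_prod_le) (use \<gamma>a in auto)
      also have "\<dots> \<le> (\<Sum>i<r. (real n / real T) * (weil_height (\<gamma> i) + weil_height (inverse (\<gamma> i))))"
      proof (rule sum_mono)
        fix i assume "i \<in> {..<r}"
        then have i: "i < r" by simp
        have "real_of_int (int q * m i - int n * p i) = real n * (of_int q0 * (real_of_int (m i) / real n) - of_int (p i))"
          using nm(1) unfolding q(3) by (simp add: right_diff_distrib)
        then have "\<bar>real_of_int (int q * m i - int n * p i)\<bar> = real n * \<bar>of_int q0 * (real_of_int (m i) / real n) - of_int (p i)\<bar>"
          by (simp only: abs_mult abs_of_nat)
        also have "\<dots> \<le> real n * (1 / real T)" using qp(3)[OF i] by (intro mult_left_mono) auto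
        finally have "\<bar>real_of_int (int q * m i - int n * p i)\<bar> \<le> real n / real T" by simp
        then have "\<bar>real_of_int (int q * m i - int n * p i)\<bar> * (weil_height (\<gamma> i) + weil_height (inverse (\<gamma> i)))
          \<le> (real n / real T) * (weil_height (\<gamma> i) + weil_height (inverse (\<gamma> i)))"
          by (rule mult_right_mono[OF _ kap[OF i]])
        then show "weil_height (\<gamma> i powi (int q * m i - int n * p i)) \<le> (real n / real T) * (weil_height (\<gamma> i) + weil_height (inverse (\<gamma> i)))"
          using weil_height_power_int_le[OF \<gamma>a(1)[OF i], of "int q * m i - int n * p i"] by linarith
      qed
      also have "\<dots> = (real n / real T) * (A - 1)" by (simp add: A_def sum_distrib_left)
      also have "\<dots> \<le> (real n / real T) * A" by (intro mult_left_mono) auto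
      finally have "real n * weil_height w \<le> real n * (A / real T)" by simp
      then have hw: "weil_height w \<le> A / real T"
        by (rule mult_left_le_imp_le) (use nm(1) in simp)
      have "A / real T \<le> A / (2 * A * s / c)" 
        by (rule divide_left_mono[OF T(1)]) (use T(3) As A in \<open>auto intro!: mult_pos_pos simp del: times_divide_eq_right\<close>)
      also have "\<dots> = c / (2 * s)" using A by simp
      finally have hw2: "weil_height w \<le> c / (2 * s)" using hw by linarith
      have xa: "algebraic (\<alpha> / g)" using aa ga by auto
      have "b = (\<alpha> / g) ^ q * w" using ga(2) by (simp add: b_def w_def power_divide)
      then have hb: "weil_height b \<le> real q * weil_height (\<alpha> / g) + weil_height w"
        using weil_height_mult_le[OF algebraic_power[OF xa, of q] wa] weil_height_power[OF xa, of q] by simp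
      have "card (orb b) \<le> card (orb (\<alpha> ^ q)) * card (orb (inverse u))"
        unfolding b_def divide_inverse by (rule card_orb_mult_le) (use aa ua in auto)
      also have "\<dots> \<le> D * C0"
      proof (rule mult_le_mono)
        show "card (orb (\<alpha> ^ q)) \<le> D" unfolding D_def by (rule card_orb_power_le[OF aa(1)])
        have "card (orb (inverse u)) \<le> card (orb u)" by (rule card_orb_inverse_le[OF ua(1)])
        also have "\<dots> \<le> (\<Prod>i<r. card (orb (\<gamma> i powi p i)))" unfolding u_def by (rule card_orb_prod_le) (use \<gamma>a in auto)
        also have "\<dots> \<le> C0" unfolding C0_def by (intro prod_mono) (use card_orb_power_int_le \<gamma>a in auto)
        finally show "card (orb (inverse u)) \<le> C0" .
      qed
      finally have "real (card (orb b)) \<le> real (C0 * D)" by (metis mult.commute of_nat_le_iff)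
      then have "real (card (orb b)) powr (1 + \<delta>) \<le> s" unfolding s_def using d by (intro powr_mono2) auto
      moreover have "real (card (orb b)) powr (1 + \<delta>) > 0" using card_orb_pos[OF ba(1)] by simp
      ultimately have "c / s \<le> c / real (card (orb b)) powr (1 + \<delta>)"
        using c s by (intro divide_left_mono mult_pos_pos) auto
      also have "\<dots> \<le> weil_height b" by (rule lower[OF ba b_nru])
      finally have "c / s \<le> real q * weil_height (\<alpha> / g) + c / (2 * s)" using hb hw2 by linarith
      then have "c / (2 * s) \<le> real q * weil_height (\<alpha> / g)" using s by (simp add: field_simps)
      also have "\<dots> \<le> (E * s) ^ r * weil_height (\<alpha> / g)"
      proof (rule mult_right_mono[OF _ weil_height_nonneg[OF xa]])
        have "real q \<le> real T ^ r" using q(2) by (metis of_nat_le_iff of_nat_power)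
        also have "\<dots> \<le> (E * s) ^ r" using TE by (intro power_mono) auto
        finally show "real q \<le> (E * s) ^ r" .
      qed
      finally have "c / (2 * s) / (E * s) ^ r \<le> weil_height (\<alpha> / g)"
        using E s by (subst pos_divide_le_eq) (auto simp: mult.commute)
      moreover have "c / (2 * s) / (E * s) ^ r = C / real D powr (real r + 1 + \<epsilon>)"
      proof -
        \<comment> \<open>One factor s comes from the lower bound for the height of b, the other r
          from q \<le> T^r.\<close>
        have "s * s ^ r = s ^ (r + 1)" by simp
        also have "\<dots> = s powr real (r + 1)" using s by (intro powr_realpow[symmetric]) simp
        also have "\<dots> = real (C0 * D) powr ((1 + \<delta>) * real (r + 1))" unfolding s_def by (rule powr_powr)
        also have "\<dots> = real C0 powr (real r + 1 + \<epsilon>) * real D powr (real r + 1 + \<epsilon>)"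
          unfolding de by (simp add: powr_mult)
        finally have "2 * s * (E * s) ^ r = 2 * E ^ r * real C0 powr (real r + 1 + \<epsilon>) * real D powr (real r + 1 + \<epsilon>)"
          by (simp add: power_mult_distrib mult_ac)
        then show ?thesis unfolding C_def divide_divide_eq_left by simp
      qed
      ultimately show ?thesis by simp
    qed
    show ?thesis unfolding height_mod_def fd
      by (rule cINF_greatest) (use bound subgroup_1[OF G] in auto)
  qed
  then show "\<exists>C>0::real. \<forall>\<alpha> \<in> Qbar_units - \<Gamma>.
           height_mod \<Gamma> \<alpha> \<ge>
             C / real (field_degree (adjoin \<alpha>)) powr (real (group_rank \<Gamma>) + 1 + \<epsilon>)"
    using Cpos unfolding r_def by blast
qed


end
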